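(* Let $S$ be an $n$-vertex combinatorial $2$-sphere. If $n\ge 5$, then $S$ is a subcomplex of an $n$-vertex polytopal $3$-sphere (so the two complexes have the same vertex set).
   Context: Simplicial complexes are finite and abstract; isomorphic complexes are identified. An $n$-vertex complex is one with exactly $n$ vertices. A combinatorial $k$-sphere is a simplicial complex whose geometric carrier (with the induced PL structure) is PL homeomorphic to the boundary of a $(k+1)$-simplex. A polytopal $(k-1)$-sphere is a simplicial complex isomorphic to the boundary complex of a simplicial $k$-polytope. *)

theory Defs
  imports "HOL-Analysis.Analysis" "HOL-Analysis.Finite_Function_Topology"
begin

text \<open>
  Abstract complexes are families of faces closed under passing to subsets, so a nonempty
  complex contains the empty face, and \<open>\<Union>K\<close> is exactly the vertex set of \<open>K\<close>.
\<close>

definition abstract_complex :: "'a set set \<Rightarrow> bool" where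
  "abstract_complex K \<longleftrightarrow>
     finite K \<and> (\<forall>\<sigma>\<in>K. finite \<sigma> \<and> (\<forall>\<tau>. \<tau> \<subseteq> \<sigma> \<longrightarrow> \<tau> \<in> K))"

definition complex_iso :: "'a set set \<Rightarrow> 'b set set \<Rightarrow> bool" where
  "complex_iso K L \<longleftrightarrow> (\<exists>f. bij_betw f (\<Union>K) (\<Union>L) \<and> (\<lambda>\<sigma>. f ` \<sigma>) ` K = L)"

text \<open>
  The geometric carrier is the standard realization: each vertex becomes a unit vector of the
  free real vector space on the vertex type. On the finite-dimensional subspace containing the
  carrier, the norm topology of that space is the Euclidean one.
\<close>

definition carrier_of :: "'a set set \<Rightarrow> ('a \<Rightarrow>\<^sub>0 real) set" where
  "carrier_of K = (\<Union>\<sigma>\<in>K. convex hull ((\<lambda>v. Poly_Mapping.single v 1) ` \<sigma>))"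

text \<open>
  A map on a compact polyhedron \<open>X\<close> is piecewise linear if \<open>X\<close> is covered by finitely many
  polytopes contained in \<open>X\<close> on each of which the map is affine. Continuity is then automatic.
\<close>

definition pl_on :: "'a::real_normed_vector set \<Rightarrow> ('a \<Rightarrow> 'b::real_normed_vector) \<Rightarrow> bool" where
  "pl_on X f \<longleftrightarrow>
     (\<exists>\<C>. finite \<C> \<and> \<Union>\<C> = X \<and>
        (\<forall>C\<in>\<C>. polytope C \<and>
           (\<forall>x\<in>C. \<forall>y\<in>C. \<forall>u\<in>{0..1}.
              f ((1 - u) *\<^sub>R x + u *\<^sub>R y) = (1 - u) *\<^sub>R f x + u *\<^sub>R f y)))"

definition pl_homeomorphic ::
    "'a::real_normed_vector set \<Rightarrow> 'b::real_normed_vector set \<Rightarrow> bool" where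
  "pl_homeomorphic X Y \<longleftrightarrow> (\<exists>f g. homeomorphism X Y f g \<and> pl_on X f \<and> pl_on Y g)"

text \<open>All proper faces of the simplex with the \<open>k + 2\<close> vertices \<open>0, \<dots>, k + 1\<close>.\<close>

definition simplex_boundary :: "nat \<Rightarrow> nat set set" where
  "simplex_boundary k = {\<sigma>. \<sigma> \<subset> {..k + 1}}"

definition combinatorial_sphere :: "nat \<Rightarrow> 'a set set \<Rightarrow> bool" where
  "combinatorial_sphere k K \<longleftrightarrow>
     abstract_complex K \<and> pl_homeomorphic (carrier_of K) (carrier_of (simplex_boundary k))"

definition simplicial_polytope :: "'e::euclidean_space set \<Rightarrow> bool" where
  "simplicial_polytope P \<longleftrightarrow>
     polytope P \<and> aff_dim P = int DIM('e) \<and>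
     (\<forall>F. F face_of P \<and> F \<noteq> P \<longrightarrow> (\<exists>m. m simplex F))"

text \<open>
  The boundary complex as an abstract complex on the vertices of \<open>P\<close>: every proper face
  (including the empty one) is recorded by its set of vertices.
\<close>

definition boundary_complex :: "'e::euclidean_space set \<Rightarrow> 'e set set" where
  "boundary_complex P = {{v. v extreme_point_of F} | F. F face_of P \<and> F \<noteq> P}"

text \<open>
  The dimension is carried by the ambient type: polytopes are full-dimensional in \<open>'e\<close>, so
  \<open>polytopal_sphere TYPE(real^4) K\<close> says that \<open>K\<close> is a polytopal 3-sphere.
\<close>

definition polytopal_sphere :: "'e::euclidean_space itself \<Rightarrow> 'a set set \<Rightarrow> bool" where
  "polytopal_sphere _ K \<longleftrightarrow>
     abstract_complex K \<and>
     (\<exists>P::'e set. simplicial_polytope P \<and> complex_iso K (boundary_complex P))"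

end

theory Submission
  imports Defs
begin

text \<open>
  The three-dimensional case of Steinitz' theorem suffices: if \<open>S\<close> bounds a simplicial 3-polytope,
  lift the vertices to \<open>\<real>\<^sup>4\<close> and perturb them into general position. A plane supporting the
  3-polytope in a triangle of \<open>S\<close> lifts to a hyperplane supporting the lifted points in the same
  triangle, and exact support in affinely independent vertices survives small perturbations.

  To realize \<open>S\<close> in dimension three, remove an outer triangle and peel off the remaining disc one
  boundary vertex at a time; a vertex that is not an end of a chord of the boundary exists by the
  Jordan curve theorem. Rebuilding the disc in reverse, each new vertex is placed in the plane
  just beyond the edges it covers, so that the boundary stays a strictly concave chain, and is
  lifted so high that all triangles remain faces of the lower convex hull.
\<close>

section \<open>Edge paths and triangulated discs\<close>

text \<open>In general position every proper face of a polytope is a simplex, so only the faces of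
  \<open>S\<close> need control, and each of these lies in a triangle. It is therefore enough to
  find, for every triangle of \<open>S\<close>, a functional that is constant on it and strictly
  smaller at all other vertices. This also keeps every vertex on the hull, and the three-dimensional
  realization never has to be described as a polytope with a known face lattice.

  Topology enters through mod 2 boundaries of sets of triangles. In these terms the Jordan curve
  theorem says that every edge cycle is the boundary of a set of triangles. What it does not say is
  which of the two complementary sets lies within the disc. The part of the sphere already removed
  decides this, as long as it stays connected through edges, and so this connectedness is carried
  along while the disc is peeled.

  In the rebuilding, the planar position of a new vertex must be settled before its height: the
  position protects the concave chain, and after that every triangle, old or new, only asks for a
  height that is large enough. The outer triangle gets its supporting plane at the very end, from
  the concavity of the last chain.\<close>

fun ledges :: "'a list \<Rightarrow> 'a set set" where
  "ledges (a # b # xs) = insert {a, b} (ledges (b # xs))"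
| "ledges _ = {}"

lemma ledges_append: "ledges (xs @ a # ys) = ledges (xs @ [a]) \<union> ledges (a # ys)"
  by (induction xs rule: ledges.induct) (auto simp: neq_Nil_conv)

lemma ledges_append_Cons2: "ledges (xs @ a # b # ys) = ledges (xs @ [a]) \<union> insert {a, b} (ledges (b # ys))"
  by (subst ledges_append) simp

lemma ledges_subset: "e \<in> ledges xs \<Longrightarrow> e \<subseteq> set xs"
  by (induction xs rule: ledges.induct) auto

lemma ledges_card: "distinct xs \<Longrightarrow> e \<in> ledges xs \<Longrightarrow> card e = 2"
  by (induction xs rule: ledges.induct) auto

lemma ledges_split:
  "e \<in> ledges xs \<longleftrightarrow> (\<exists>A a b B. xs = A @ a # b # B \<and> e = {a, b})"
proof
  show "e \<in> ledges xs \<Longrightarrow> \<exists>A a b B. xs = A @ a # b # B \<and> e = {a, b}"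
  proof (induction xs rule: ledges.induct)
    case (1 a b xs)
    then show ?case
    proof (cases "e = {a, b}")
      case False
      then obtain A c d B where "b # xs = A @ c # d # B" "e = {c, d}" using 1 by auto
      then show ?thesis by (intro exI[of _ "a # A"]) auto
    qed blast
  qed auto
qed (auto simp: ledges_append_Cons2)

lemma ledges_cover: "x \<in> set xs \<Longrightarrow> 2 \<le> length xs \<Longrightarrow> \<exists>e\<in>ledges xs. x \<in> e"
proof (induction xs rule: ledges.induct)
  case (1 a b xs)
  then show ?case by (cases xs) auto
qed auto

lemma ends_notin_ledges:
  assumes "distinct xs" "3 \<le> length xs"
  shows "{hd xs, last xs} \<notin> ledges xs"
proof
  assume "{hd xs, last xs} \<in> ledges xs"
  then obtain A a b B where xs: "xs = A @ a # b # B" and e: "{hd xs, last xs} = {a, b}"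
    unfolding ledges_split by blast
  show False
  proof (cases A)
    case Nil
    then show ?thesis using xs e assms by (cases B rule: rev_cases) (auto simp: doubleton_eq_iff)
  next
    case (Cons c A')
    then show ?thesis using xs e assms by (auto simp: doubleton_eq_iff)
  qed
qed

section \<open>Mod 2 boundaries on a triangulated sphere\<close>

definition tri :: "'a set set \<Rightarrow> 'a set set" where
  "tri S = {t \<in> S. card t = 3}"

text \<open>When every edge lies in exactly two triangles, this is the mod 2 boundary of the 2-chain
  \<open>A\<close>: an edge survives iff just one of its two triangles belongs to
  \<open>A\<close>.\<close>

definition bd :: "'a set set \<Rightarrow> 'a set set \<Rightarrow> 'a set set" where
  "bd S A = {e \<in> S. card e = 2 \<and> (\<exists>t\<in>tri S. e \<subseteq> t \<and> t \<in> A) \<and> (\<exists>t\<in>tri S. e \<subseteq> t \<and> t \<notin> A)}"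

text \<open>
  The list is the boundary of the disc without the edge \<open>v1 v2\<close>. The disc on a single edge has no
  triangle, and its boundary runs along \<open>v1 v2\<close> twice.
\<close>

inductive fan_disc :: "'a \<Rightarrow> 'a \<Rightarrow> 'a set set \<Rightarrow> 'a list \<Rightarrow> bool" for v1 v2 where
  edge: "v1 \<noteq> v2 \<Longrightarrow> fan_disc v1 v2 {} [v1, v2]"
| cone: "fan_disc v1 v2 D (A @ p # xs @ q # B) \<Longrightarrow> distinct (A @ p # xs @ q # B) \<Longrightarrow>
     w \<notin> \<Union>D \<union> set (A @ p # xs @ q # B) \<Longrightarrow>
     fan_disc v1 v2 (D \<union> insert w ` ledges (p # xs @ [q])) (A @ p # w # q # B)"

lemma card_3_insert: "card t = 3 \<Longrightarrow> e \<subseteq> t \<Longrightarrow> card e = 2 \<Longrightarrow> w \<in> t \<Longrightarrow> w \<notin> e \<Longrightarrow> t = insert w e"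
proof -
  assume a: "card t = 3" "e \<subseteq> t" "card e = 2" "w \<in> t" "w \<notin> e"
  have "finite t" using a(1) by (metis card.infinite zero_neq_numeral)
  moreover have "finite e" using \<open>finite t\<close> a finite_subset by blast
  ultimately show ?thesis using a by (intro card_subset_eq[symmetric]) auto
qed

lemma card_3_third: "card t = 3 \<Longrightarrow> x \<in> t \<Longrightarrow> y \<in> t \<Longrightarrow> x \<noteq> y \<Longrightarrow> \<exists>z. z \<noteq> x \<and> z \<noteq> y \<and> t = {x, y, z}"
  by (auto simp: card_3_iff)

lemma card_2_other: "card e = 2 \<Longrightarrow> x \<in> e \<Longrightarrow> \<exists>y. y \<noteq> x \<and> e = {x, y}"
  by (auto simp: card_2_iff)

text \<open>For peeling a vertex: \<open>L1\<close> and \<open>L2\<close> are the boundary edges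
  that stay, \<open>W\<close> the two edges at the peeled vertex, \<open>X\<close> the path that
  replaces them, \<open>b\<close> the closing edge. \<open>b\<close> may lie in \<open>X\<close>,
  where it cancels; this happens when the boundary shrinks to a single edge.\<close>

lemma sym_diff_exchange:
  assumes "W \<inter> L1 = {}" "W \<inter> L2 = {}" "X \<inter> L1 = {}" "X \<inter> L2 = {}" "X \<inter> W = {}" "b \<notin> W"
  shows "sym_diff (sym_diff (L1 \<union> W \<union> L2) {b}) (W \<union> X) = sym_diff (L1 \<union> X \<union> L2) {b}"
proof (intro set_eqI)
  fix e
  show "e \<in> sym_diff (sym_diff (L1 \<union> W \<union> L2) {b}) (W \<union> X) \<longleftrightarrow> e \<in> sym_diff (L1 \<union> X \<union> L2) {b}"
    using assms by (cases "e = b"; cases "e \<in> W"; cases "e \<in> X"; cases "e \<in> L1"; cases "e \<in> L2") auto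
qed

text \<open>The combinatorial shadow of a 2-sphere. \<open>star_connected\<close> makes the
  triangles around a vertex hang together through edges at it, \<open>strongly_connected\<close>
  does so for the whole surface, and \<open>cycle_separates\<close> is the Jordan curve theorem as
  vanishing mod 2 homology. Phrasing all three through \<open>bd\<close> lets them be combined by
  adding boundaries.\<close>

locale planar_surface =
  fixes S :: "'a set set"
  assumes finite_complex: "finite S"
    and face_closed: "\<sigma> \<in> S \<Longrightarrow> \<tau> \<subseteq> \<sigma> \<Longrightarrow> \<tau> \<in> S"
    and face_finite: "\<sigma> \<in> S \<Longrightarrow> finite \<sigma>"
    and nonempty: "S \<noteq> {}"
    and face_in_triangle: "\<sigma> \<in> S \<Longrightarrow> \<exists>t\<in>tri S. \<sigma> \<subseteq> t"
    and edge_two: "e \<in> S \<Longrightarrow> card e = 2 \<Longrightarrow> card {t \<in> tri S. e \<subseteq> t} = 2"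
    and star_connected: "A \<subseteq> {t \<in> tri S. v \<in> t} \<Longrightarrow> \<forall>e\<in>bd S A. v \<notin> e \<Longrightarrow>
          A = {} \<or> A = {t \<in> tri S. v \<in> t}"
    and strongly_connected: "A \<subseteq> tri S \<Longrightarrow> bd S A = {} \<Longrightarrow> A = {} \<or> A = tri S"
    and cycle_separates: "distinct zs \<Longrightarrow> 3 \<le> length zs \<Longrightarrow>
          insert {last zs, hd zs} (ledges zs) \<subseteq> S \<Longrightarrow>
          \<exists>A\<subseteq>tri S. bd S A = insert {last zs, hd zs} (ledges zs)"

section \<open>Canonical orderings\<close>

context planar_surface
begin

lemma edge_tris:
  assumes "e \<in> S" "card e = 2"
  shows "\<exists>t1 t2. t1 \<noteq> t2 \<and> {t \<in> tri S. e \<subseteq> t} = {t1, t2}"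
  using card_2_iff[THEN iffD1, OF edge_two[OF assms]] by (elim exE conjE) (intro exI conjI)

lemma not_three_tris:
  assumes "e \<in> S" "card e = 2" "t1 \<in> tri S" "t2 \<in> tri S" "t3 \<in> tri S"
    "e \<subseteq> t1" "e \<subseteq> t2" "e \<subseteq> t3" "t1 \<noteq> t2" "t1 \<noteq> t3" "t2 \<noteq> t3"
  shows False
proof -
  obtain s1 s2 where "{t \<in> tri S. e \<subseteq> t} = {s1, s2}" using edge_tris[OF assms(1,2)] by blast
  then have "t1 \<in> {s1, s2}" "t2 \<in> {s1, s2}" "t3 \<in> {s1, s2}" using assms by blast+
  then show False using assms by blast
qed

text \<open>Additivity of the mod 2 boundary: whether an edge belongs to it depends only on whether
  its two triangles disagree about the set.\<close>

lemma bd_symdiff: "bd S (sym_diff A B) = sym_diff (bd S A) (bd S B)"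
proof (intro set_eqI)
  fix e
  show "e \<in> bd S (sym_diff A B) \<longleftrightarrow> e \<in> sym_diff (bd S A) (bd S B)"
  proof (cases "e \<in> S \<and> card e = 2")
    case True
    obtain t1 t2 where ne: "t1 \<noteq> t2" and eq: "{t \<in> tri S. e \<subseteq> t} = {t1, t2}"
      using edge_tris[OF conjunct1[OF True] conjunct2[OF True]] by (elim exE conjE) (rule that)
    have *: "t1 \<in> tri S" "t2 \<in> tri S" "e \<subseteq> t1" "e \<subseteq> t2" using eq by blast+
    have only: "t = t1 \<or> t = t2" if "t \<in> tri S" "e \<subseteq> t" for t using that eq by blast
    have **: "e \<in> bd S C \<longleftrightarrow> (t1 \<in> C \<longleftrightarrow> t2 \<notin> C)" for C
    proof (cases "t1 \<in> C \<longleftrightarrow> t2 \<in> C")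
      case True
      then have "e \<notin> bd S C" using only unfolding bd_def by blast
      then show ?thesis using True by blast
    next
      case False
      then have "e \<in> bd S C" using * \<open>e \<in> S \<and> card e = 2\<close> unfolding bd_def by blast
      then show ?thesis using False by blast
    qed
    show ?thesis unfolding Un_iff Diff_iff ** by blast
  qed (auto simp: bd_def)
qed

lemma bd_diff_complement: "bd S (tri S - A) = bd S A"
  by (auto simp: bd_def)

text \<open>Unique continuation around a vertex. The symmetric difference of \<open>A\<close> and
  \<open>B\<close> has no boundary edge at \<open>v\<close>, so within the star of \<open>v\<close>
  it is empty or everything; one triangle of agreement decides.\<close>

lemma star_agree:
  assumes edges: "\<And>e. v \<in> e \<Longrightarrow> e \<in> bd S A \<longleftrightarrow> e \<in> bd S B"
    and t: "t \<in> tri S" "v \<in> t" "t \<in> A \<longleftrightarrow> t \<in> B"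
    and t': "t' \<in> tri S" "v \<in> t'"
  shows "t' \<in> A \<longleftrightarrow> t' \<in> B"
proof -
  let ?X = "{t \<in> tri S. v \<in> t \<and> t \<in> sym_diff A B}"
  have "e \<in> bd S (sym_diff A B)" if "e \<in> bd S ?X" "v \<in> e" for e
    using that unfolding bd_def by blast
  then have "\<forall>e\<in>bd S ?X. v \<notin> e"
    using edges unfolding bd_symdiff by blast
  then have "?X = {} \<or> ?X = {t \<in> tri S. v \<in> t}"
    by (intro star_connected) auto
  then show ?thesis using t t' by blast
qed

text \<open>
  The complement of a disc is kept dual-connected so that it lies on one side of any cycle made of
  a boundary arc and a chord.
\<close>

definition dual_connected :: "'a set set \<Rightarrow> bool" where
  "dual_connected E \<longleftrightarrow> (\<forall>A. (\<forall>t\<in>E. \<forall>t'\<in>E. card (t \<inter> t') = 2 \<longrightarrow> (t \<in> A \<longleftrightarrow> t' \<in> A)) \<longrightarrow>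
     E \<subseteq> A \<or> E \<inter> A = {})"

text \<open>The symmetric difference lets the closing edge cancel when \<open>ws\<close> has only
  two vertices, so the last stage of the peeling, a single edge with empty boundary, falls under the
  same definition.\<close>

definition disc :: "'a set set \<Rightarrow> 'a list \<Rightarrow> bool" where
  "disc D ws \<longleftrightarrow> D \<subseteq> tri S \<and> tri S - D \<noteq> {} \<and> dual_connected (tri S - D) \<and>
     distinct ws \<and> 2 \<le> length ws \<and> bd S D = sym_diff (ledges ws) {{hd ws, last ws}}"

lemma disc_bd:
  assumes "disc D ws" "3 \<le> length ws"
  shows "bd S D = insert {hd ws, last ws} (ledges ws)"
  using assms ends_notin_ledges[of ws] unfolding disc_def by auto

text \<open>Supplies the reference triangle for \<open>star_agree\<close> at a boundary
  vertex.\<close>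

lemma disc_outer_triangle:
  assumes "disc D ws" "3 \<le> length ws" "x \<in> set ws"
  obtains t where "t \<in> tri S - D" "x \<in> t"
proof -
  obtain e where "e \<in> ledges ws" "x \<in> e"
    using ledges_cover[of x ws] assms by force
  then have "e \<in> bd S D" using disc_bd[OF assms(1,2)] by auto
  then show ?thesis using \<open>x \<in> e\<close> that unfolding bd_def by blast
qed

section \<open>Chords and fans of a disc\<close>

lemma adjacent_inter:
  assumes "t \<in> tri S" "t' \<in> tri S" "card (t \<inter> t') = 2"
  shows "t \<noteq> t'" "t \<inter> t' \<in> S"
  using assms face_closed[of t "t \<inter> t'"] unfolding tri_def by auto

text \<open>The chord \<open>a b\<close> closes the boundary arc \<open>a M b\<close> to a cycle.
  The complement of the disc lies on one side of it; let \<open>K\<close> be the other side. At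
  \<open>w\<close> the boundaries of \<open>D\<close> and \<open>K\<close> agree, so
  \<open>t\<close> lies in \<open>K\<close>. At \<open>x\<close>, which is off the cycle,
  \<open>K\<close> has no boundary, so \<open>t\<close> does not lie in \<open>K\<close>.\<close>

lemma chord_separates:
  assumes D: "disc D ws" and ws: "ws = A @ a # M @ b # B" and M: "w \<in> set M"
    and t0: "t0 \<in> D" "a \<in> t0" "b \<in> t0"
    and x: "x \<in> set A \<union> set B" and t: "t \<in> D" "w \<in> t" "x \<in> t"
  shows False
proof -
  have dist: "distinct ws" and DS: "D \<subseteq> tri S" using D unfolding disc_def by auto
  have len: "3 \<le> length ws" using ws M by (cases M) auto
  define zs where "zs = a # M @ [b]"
  have zs: "distinct zs" "3 \<le> length zs" "hd zs = a" "last zs = b"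
    using dist ws M unfolding zs_def by (auto simp: Suc_le_eq neq_Nil_conv intro: Suc_leI) (cases M, auto)
  have leq: "ledges ws = ledges (A @ [a]) \<union> ledges zs \<union> ledges (b # B)"
    unfolding ws zs_def using ledges_append[of A a "M @ b # B"] ledges_append[of "a # M" b B] by auto
  have "{a, b} \<in> S" using face_closed[of t0 "{a, b}"] t0 DS unfolding tri_def by auto
  moreover have bdS: "e \<in> S" if "e \<in> bd S D" for e using that unfolding bd_def by auto
  ultimately have "insert {last zs, hd zs} (ledges zs) \<subseteq> S"
    using zs leq disc_bd[OF D len] by (auto simp: insert_commute)
  then obtain J where J: "J \<subseteq> tri S" "bd S J = insert {b, a} (ledges zs)"
    using cycle_separates[OF zs(1,2)] zs(3,4) by metis
  let ?E = "tri S - D"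
  have "\<forall>t\<in>?E. \<forall>t'\<in>?E. card (t \<inter> t') = 2 \<longrightarrow> (t \<in> J \<longleftrightarrow> t' \<in> J)"
  proof (intro ballI impI)
    fix t t' assume tt: "t \<in> ?E" "t' \<in> ?E" "card (t \<inter> t') = 2"
    let ?e = "t \<inter> t'"
    have ne: "t \<noteq> t'" "?e \<in> S" using adjacent_inter tt by auto
    have only: "s \<in> tri S \<Longrightarrow> ?e \<subseteq> s \<Longrightarrow> s = t \<or> s = t'" for s
      using not_three_tris[of ?e s t t'] ne tt by blast
    \<comment> \<open>An edge between two outer triangles is neither a boundary edge of the disc nor
      the chord, whose triangle \<open>t0\<close> lies in \<open>D\<close>. So it is not on the
      cycle, and crossing it does not change the side.\<close>
    have "?e \<notin> bd S D" using only tt unfolding bd_def by blast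
    then have "?e \<notin> ledges zs" using disc_bd[OF D len] leq by auto
    moreover have "?e \<noteq> {b, a}" using only[of t0] t0 DS tt by auto
    ultimately have "?e \<notin> bd S J" using J by auto
    then show "t \<in> J \<longleftrightarrow> t' \<in> J" using tt ne unfolding bd_def by blast
  qed
  then have "?E \<subseteq> J \<or> ?E \<inter> J = {}" using D unfolding disc_def dual_connected_def by blast
  then obtain K where K: "?E \<inter> K = {}" "bd S K = insert {b, a} (ledges zs)"
  proof
    assume "?E \<subseteq> J"
    then show ?thesis using that[of "tri S - J"] J bd_diff_complement by auto
  next
    assume "?E \<inter> J = {}"
    then show ?thesis using that[of J] J by auto
  qed
  have "t \<in> D \<longleftrightarrow> t \<in> K"
  proof -
    have w: "w \<noteq> a" "w \<noteq> b" "w \<notin> set A" "w \<notin> set B" using dist ws M by auto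
    \<comment> \<open>\<open>w\<close> is interior to the arc, so neither the closing edge of the
      disc nor the chord touches it.\<close>
    have "hd ws \<in> insert a (set A)" "last ws \<in> insert b (set B)"
      unfolding ws by (cases A; simp) (cases B rule: rev_cases; simp)
    then have "w \<noteq> hd ws" "w \<noteq> last ws" using w by auto
    then have "e \<in> bd S D \<longleftrightarrow> e \<in> bd S K" if "w \<in> e" for e
      using that w ledges_subset[of e "A @ [a]"] ledges_subset[of e "b # B"]
      unfolding disc_bd[OF D len] K(2) leq by auto
    moreover obtain s where "s \<in> ?E" "w \<in> s"
      using disc_outer_triangle[OF D len, of w] ws M by auto
    ultimately show ?thesis using star_agree[of w D K s t] K(1) t DS by blast
  qed
  moreover have "t \<in> K \<longleftrightarrow> t \<in> {}"
  proof -
    have "x \<notin> set zs" using dist ws x zs_def by auto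
    then have "e \<in> bd S K \<longleftrightarrow> e \<in> bd S {}" if "x \<in> e" for e
      using that ledges_subset[of e zs] K(2) zs unfolding bd_def[of S "{}"] zs_def by auto
    moreover obtain s where "s \<in> ?E" "x \<in> s"
      using disc_outer_triangle[OF D len, of x] ws x by auto
    ultimately show ?thesis using star_agree[of x K "{}" s t] K(1) t DS by blast
  qed
  ultimately show False using t by auto
qed

text \<open>Take an innermost chord, with as few boundary vertices beneath it as possible. Its first
  such vertex \<open>w\<close> has no chord to the others beneath it or to the far end, by
  minimality, and none to vertices outside, by \<open>chord_separates\<close>. If there is no chord
  at all, any vertex strictly inside the list will do.\<close>

lemma chordless_vertex:
  assumes D: "disc D ws" and len: "3 \<le> length ws"
  obtains A p w q B where "ws = A @ p # w # q # B"
    "\<forall>t\<in>D. w \<in> t \<longrightarrow> t \<inter> set ws \<subseteq> {p, w, q}"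
proof -
  \<comment> \<open>A chord is taken to be two boundary vertices in a common triangle of
    \<open>D\<close>. Excluding \<open>A = [] \<and> B = []\<close> keeps the closing edge of the
    boundary from counting as one.\<close>
  define ch where "ch A a M b B \<longleftrightarrow> ws = A @ a # M @ b # B \<and> M \<noteq> [] \<and> \<not> (A = [] \<and> B = []) \<and>
      (\<exists>t\<in>D. a \<in> t \<and> b \<in> t)" for A a M b B
  have dist: "distinct ws" using D unfolding disc_def by auto
  show ?thesis
  proof (cases "\<exists>A a M b B. ch A a M b B")
    case False
    obtain p w q B where ws: "ws = p # w # q # B"
      using len by (metis (no_types, opaque_lifting) Suc_le_length_iff numeral_3_eq_3)
    have "x = p \<or> x = w \<or> x = q" if "t \<in> D" "w \<in> t" "x \<in> t" "x \<in> set ws" for x t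
    proof (rule ccontr)
      assume "\<not> ?thesis"
      then have "x \<in> set B" using that ws by auto
      then obtain B1 B2 where "B = B1 @ x # B2" by (meson split_list)
      then have "ch [p] w (q # B1) x B2" using that ws unfolding ch_def by auto
      then show False using False by blast
    qed
    then have "\<forall>t\<in>D. w \<in> t \<longrightarrow> t \<inter> set ws \<subseteq> {p, w, q}" by blast
    then show ?thesis using that[of "[]" p w q B] ws by simp
  next
    case True
    define n where "n = (LEAST n. \<exists>A a M b B. ch A a M b B \<and> length M = n)"
    obtain A0 a0 M0 b0 B0 where "ch A0 a0 M0 b0 B0" using True by blast
    then have "\<exists>A a M b B. ch A a M b B \<and> length M = length M0" by blast
    then have "\<exists>A a M b B. ch A a M b B \<and> length M = n" unfolding n_def by (rule LeastI)
    then obtain A a M b B where c: "ch A a M b B" "length M = n" by blast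
    have mini: "\<not> ch A' a' M' b' B'" if "length M' < n" for A' a' M' b' B'
      using not_less_Least[of "length M'" "\<lambda>n. \<exists>A a M b B. ch A a M b B \<and> length M = n"] that
      unfolding n_def by blast
    obtain w M' where M: "M = w # M'" using c unfolding ch_def by (cases M) auto
    obtain q B' where q: "M' @ b # B = q # B'" by (cases M') auto
    have ws: "ws = A @ a # M @ b # B" using c unfolding ch_def by auto
    have ws': "ws = A @ a # w # q # B'" using ws M q by auto
    have "x = a \<or> x = w \<or> x = q" if t: "t \<in> D" "w \<in> t" "x \<in> t" "x \<in> set ws" for x t
    proof (rule ccontr)
      assume n: "\<not> ?thesis"
      then consider "x \<in> set A \<union> set B" | "x \<in> set M'" | "x = b" "x \<notin> set M'"
        using t ws M by auto
      then show False
      proof cases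
        case 1
        obtain t0 where "t0 \<in> D" "a \<in> t0" "b \<in> t0" using c unfolding ch_def by auto
        then show False using chord_separates[OF D ws, of w t0 x t] 1 t M by auto
      next
        case 2
        then obtain M1 M2 where M': "M' = M1 @ x # M2" by (meson split_list)
        have "M1 \<noteq> []" using M' q n by auto
        then have "ch (A @ [a]) w M1 x (M2 @ b # B)" using t ws M M' unfolding ch_def by auto
        moreover have "length M1 < n" using c M M' by auto
        ultimately show False using mini by blast
      next
        case 3
        then have "M' \<noteq> []" using q n by auto
        then have "ch (A @ [a]) w M' b B" using 3 t ws M unfolding ch_def by auto
        moreover have "length M' < n" using c M by auto
        ultimately show False using mini by blast
      qed
    qed
    then have "\<forall>t\<in>D. w \<in> t \<longrightarrow> t \<inter> set ws \<subseteq> {a, w, q}" by blast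
    then show ?thesis using that[OF ws'] by simp
  qed
qed

text \<open>A longest path from \<open>p\<close> in the link of \<open>w\<close>, along triangles of
  \<open>D\<close>, can only stop at \<open>q\<close>: anywhere else its last edge at
  \<open>w\<close> is interior and has a second triangle. The fan over the path then has the same
  boundary edges at \<open>w\<close> as \<open>D\<close>, so by \<open>star_agree\<close> it
  contains every triangle of \<open>D\<close> at \<open>w\<close>.\<close>

lemma boundary_fan:
  assumes D: "disc D ws" and ws: "ws = A @ p # w # q # B"
    and chordless: "\<forall>t\<in>D. w \<in> t \<longrightarrow> t \<inter> set ws \<subseteq> {p, w, q}"
  obtains xs where "distinct (p # xs @ [q])" "w \<notin> set (p # xs @ [q])" "set xs \<inter> set ws = {}"
    "{t \<in> D. w \<in> t} = insert w ` ledges (p # xs @ [q])"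
proof -
  have dist: "distinct ws" and DS: "D \<subseteq> tri S" using D unfolding disc_def by auto
  have len: "3 \<le> length ws" using ws by auto
  have pwq: "p \<noteq> w" "p \<noteq> q" "w \<noteq> q" using dist ws by auto
  have leq: "ledges ws = ledges (A @ [p]) \<union> {{p, w}, {w, q}} \<union> ledges (q # B)"
    unfolding ws by (simp add: ledges_append_Cons2)
  have w: "w \<notin> set A" "w \<notin> set B" "w \<noteq> hd ws" "w \<noteq> last ws" using dist ws pwq by (auto simp: hd_append)
  have bdw: "e \<in> bd S D \<longleftrightarrow> e = {p, w} \<or> e = {w, q}" if "w \<in> e" for e
    using that w pwq ledges_subset[of e "A @ [p]"] ledges_subset[of e "q # B"]
    unfolding disc_bd[OF D len] leq by auto
  define path where "path ys \<longleftrightarrow> ys \<noteq> [] \<and> hd ys = p \<and> distinct ys \<and> w \<notin> set ys \<and> insert w ` ledges ys \<subseteq> D" for ys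
  have triD: "t \<in> D \<Longrightarrow> t \<in> S \<and> card t = 3" for t using DS unfolding tri_def by auto
  have pS: "p \<in> \<Union>S" using bdw[of "{p, w}"] unfolding bd_def by blast
  have path_S: "set ys \<subseteq> insert p (\<Union>S)" if "path ys" for ys
  proof
    fix y assume y: "y \<in> set ys"
    show "y \<in> insert p (\<Union>S)"
    proof (cases "length ys \<ge> 2")
      case True
      then obtain e where "e \<in> ledges ys" "y \<in> e" using ledges_cover y by metis
      then show ?thesis using that triD unfolding path_def by blast
    next
      case False
      then show ?thesis using that y unfolding path_def by (cases ys) (auto simp: Suc_le_eq)
    qed
  qed
  have fin: "finite (insert p (\<Union>S))" using finite_complex face_finite by auto
  have "length ys \<le> card (insert p (\<Union>S))" if "path ys" for ys
    using card_mono[OF fin path_S[OF that]] that distinct_card[of ys] unfolding path_def by auto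
  moreover have "path [p]" using pwq unfolding path_def by auto
  ultimately obtain ys where ys: "path ys" and max: "\<And>zs. path zs \<Longrightarrow> length zs \<le> length ys"
    using ex_has_greatest_nat[of path "[p]" length "Suc (card (insert p (\<Union>S)))"] by (auto simp: less_Suc_eq_le)
  have edgeS: "{w, x} \<in> S" if "t \<in> D" "w \<in> t" "x \<in> t" for x t
    using that triD face_closed[of t "{w, x}"] by auto
  have extend: False if "z \<notin> set ys" "z \<noteq> w" "{w, last ys, z} \<in> D" for z
  proof -
    have "ledges (ys @ [z]) = insert {last ys, z} (ledges ys)"
      using ys ledges_append[of "butlast ys" "last ys" "[z]"] unfolding path_def
      by (metis append_butlast_last_id append_Cons append_assoc append_Nil Un_insert_right ledges.simps sup_bot_right)
    then have "path (ys @ [z])" using ys that unfolding path_def by (auto simp: hd_append)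
    then show False using max by fastforce
  qed
  have two_w: False if "{w, x} \<subseteq> t1" "{w, x} \<subseteq> t2" "{w, x} \<subseteq> t3" "x \<noteq> w"
    "t1 \<in> tri S" "t2 \<in> tri S" "t3 \<in> tri S" "t1 \<noteq> t2" "t1 \<noteq> t3" "t2 \<noteq> t3" for x t1 t2 t3
    using not_three_tris[of "{w, x}" t1 t2 t3] that face_closed[of t1 "{w, x}"] unfolding tri_def by auto
  have in_path: "{w, a, b} \<in> D" if "ys = Y @ a # b # Z" for a b Y Z
    using that ys unfolding path_def by (auto simp: ledges_append_Cons2)
  have last_q: "last ys = q"
  proof (rule ccontr)
    assume nq: "last ys \<noteq> q"
    show False
    proof (cases "ys = [p]")
      case True
      have "{p, w} \<in> bd S D" using bdw by auto
      then obtain t where t: "t \<in> D" "p \<in> t" "w \<in> t" unfolding bd_def by auto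
      then obtain z where "z \<noteq> w" "z \<noteq> p" "t = {w, p, z}"
        using card_3_third[of t w p] triD pwq by auto
      then show False using extend[of z] True t by auto
    next
      case False
      obtain ys' y where y0: "ys = ys' @ [y]" using ys unfolding path_def by (cases ys rule: rev_cases) auto
      moreover have "ys' \<noteq> []" using False y0 ys unfolding path_def by auto
      ultimately obtain Y u where y: "ys = Y @ [u, y]" by (cases ys' rule: rev_cases) auto
      have dy: "distinct ys" "w \<notin> set ys" "hd ys = p" using ys unfolding path_def by auto
      have t1: "{w, u, y} \<in> D" using in_path[of Y u y "[]"] y by auto
      have yp: "y \<noteq> p" "y \<noteq> q" "y \<noteq> w" "u \<noteq> w" "u \<noteq> y" using dy y nq by (cases Y; auto)+
      then have nb: "{w, y} \<notin> bd S D" using bdw[of "{w, y}"] by (auto simp: doubleton_eq_iff)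
      have eS: "{w, y} \<in> S" using edgeS[OF t1] by auto
      have ce: "card {w, y} = 2" using yp by auto
      obtain s1 s2 where "s1 \<noteq> s2" and seq: "{t \<in> tri S. {w, y} \<subseteq> t} = {s1, s2}"
        using edge_tris[OF eS ce] by (elim exE conjE) (rule that)
      then have "\<exists>t2 \<in> {t \<in> tri S. {w, y} \<subseteq> t}. t2 \<noteq> {w, u, y}"
        unfolding seq by (metis insertI1 insertI2)
      then obtain t2 where t2: "t2 \<noteq> {w, u, y}" "t2 \<in> tri S" "{w, y} \<subseteq> t2" by blast
      have "{w, u, y} \<in> tri S" "{w, y} \<subseteq> {w, u, y}" using t1 DS by auto
      then have t2D: "t2 \<in> D" using nb eS ce t1 t2 unfolding bd_def by blast
      obtain z where z: "z \<noteq> w" "z \<noteq> y" "t2 = {w, y, z}"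
        using card_3_third[of t2 w y] t2 yp unfolding tri_def by auto
      have zu: "z \<noteq> u" using z t2 by (auto simp: insert_commute)
      \<comment> \<open>By maximality the vertex \<open>z\<close> already occurs on the path. Then
        three triangles share the edge \<open>{w, z}\<close>: \<open>t2\<close>, the path triangle
        after \<open>z\<close>, and the one before \<open>z\<close> or, if \<open>z = p\<close>, the
        triangle outside the disc.\<close>
      have "z \<in> set ys" using extend[of z] z t2D y by auto
      then have "z \<in> set Y" using y z zu by auto
      then obtain Y1 Y2 where Y: "Y = Y1 @ z # Y2" by (meson split_list)
      obtain c Z where cZ: "Y2 @ [u, y] = c # Z" by (cases Y2) auto
      have cy: "c \<noteq> y" "c \<noteq> z" "c \<noteq> w" using cZ dy y Y by (cases Y2; auto)+
      have c2: "{w, z, c} \<in> D" using in_path[of Y1 z c Z] y Y cZ by auto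
      have t3: "{w, z, c} \<noteq> t2" using z cy by auto
      show False
      proof (cases Y1 rule: rev_cases)
        case Nil
        then have zp: "z = p" using dy y Y by auto
        have "{p, w} \<in> bd S D" using bdw by auto
        then obtain t where t: "t \<notin> D" "{p, w} \<subseteq> t" "t \<in> tri S" unfolding bd_def by auto
        show False
          using two_w[of p t t2 "{w, z, c}"] t z zp t2D c2 t3 DS pwq by auto
      next
        case (snoc Y0 d)
        have c1: "{w, d, z} \<in> D" using in_path[of Y0 d z "c # Z"] y Y cZ snoc by auto
        have d: "d \<noteq> y" "d \<noteq> z" "d \<noteq> w" "d \<noteq> c" using dy y Y cZ snoc by (cases Y2; auto)+
        have "{w, d, z} \<noteq> t2" "{w, d, z} \<noteq> {w, z, c}" using z d by auto
        then show False
          using two_w[of z "{w, d, z}" t2 "{w, z, c}"] z c1 t2D c2 t3 DS by auto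
      qed
    qed
  qed
  obtain xs where xs: "ys = p # xs @ [q]"
  proof -
    obtain ys' where "ys = ys' @ [q]" using last_q ys unfolding path_def by (metis append_butlast_last_id)
    then show ?thesis using that ys pwq unfolding path_def by (cases ys') auto
  qed
  have dy: "distinct ys" "w \<notin> set ys" and PD: "insert w ` ledges ys \<subseteq> D" using ys unfolding path_def by auto
  \<comment> \<open>An inner path vertex shares a triangle of \<open>D\<close> with
    \<open>w\<close>, so on the boundary it could only be \<open>p\<close>, \<open>w\<close> or
    \<open>q\<close>.\<close>
  have disj: "set xs \<inter> set ws = {}"
  proof -
    have False if "x \<in> set xs" "x \<in> set ws" for x
    proof -
      have "x \<in> set ys" "2 \<le> length ys" using xs that(1) by auto
      then obtain e where e: "e \<in> ledges ys" "x \<in> e" using ledges_cover by metis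
      then have "x = p \<or> x = w \<or> x = q" using bspec[OF chordless, of "insert w e"] that PD by auto
      then show False using that xs dy by auto
    qed
    then show ?thesis by blast
  qed
  let ?P = "insert w ` ledges ys"
  \<comment> \<open>Both boundaries contain the edges from \<open>w\<close> to \<open>p\<close> and
    to \<open>q\<close> and no other edge at \<open>w\<close>. For an inner path vertex
    \<open>x\<close> the fan already holds both triangles on \<open>{w, x}\<close>.\<close>
  have bdP: "e \<in> bd S D \<longleftrightarrow> e \<in> bd S ?P" if we: "w \<in> e" for e
  proof (cases "e \<in> S \<and> card e = 2")
    case False
    then show ?thesis by (auto simp: bd_def)
  next
    case True
    then obtain x where x: "x \<noteq> w" "e = {w, x}" using card_2_other we by metis
    consider "x \<notin> set ys" | "x = p \<or> x = q" | "x \<in> set xs" using xs by auto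
    then show ?thesis
    proof cases
      case 1
      then have "e \<notin> bd S ?P" using x ledges_subset[of _ ys] unfolding bd_def by fastforce
      moreover have "e \<notin> bd S D" using bdw[OF we] 1 x xs by (auto simp: doubleton_eq_iff)
      ultimately show ?thesis by simp
    next
      case 2
      then have "e \<in> bd S D" using bdw[OF we] x by auto
      moreover have "\<exists>t\<in>?P. e \<subseteq> t"
        using ledges_cover[of x ys] 2 xs x by auto
      ultimately show ?thesis using PD DS unfolding bd_def by blast
    next
      case 3
      have "e \<notin> bd S D" using bdw[OF we] 3 x xs dy by (auto simp: doubleton_eq_iff)
      moreover have "e \<notin> bd S ?P"
      proof
        assume "e \<in> bd S ?P"
        then obtain t where t: "t \<in> tri S" "e \<subseteq> t" "t \<notin> ?P" unfolding bd_def by auto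
        obtain Y1 Y2 where Y: "xs = Y1 @ x # Y2" using 3 by (meson split_list)
        obtain c C where c: "p # Y1 = C @ [c]" by (metis list.distinct(1) rev_exhaust)
        obtain d E where d: "Y2 @ [q] = d # E" by (cases Y2) auto
        have ysY: "ys = C @ c # x # d # E" using xs Y c d
          by (metis append.assoc append_Cons append_Nil)
        have P: "{w, c, x} \<in> ?P" "{w, x, d} \<in> ?P"
          unfolding ysY by (auto simp: ledges_append_Cons2)
        then have "{w, c, x} \<in> tri S" "{w, x, d} \<in> tri S" using PD DS by auto
        moreover have "{w, c, x} \<noteq> {w, x, d}" "c \<noteq> x" "d \<noteq> x" using dy ysY by auto
        ultimately show False using two_w[of x t "{w, c, x}" "{w, x, d}"] t x P by auto
      qed
      ultimately show ?thesis by simp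
    qed
  qed
  obtain s where s: "s \<in> tri S - D" "w \<in> s"
    using disc_outer_triangle[OF D len, of w] ws by auto
  have "{t \<in> D. w \<in> t} = ?P"
  proof (intro set_eqI)
    fix t
    show "t \<in> {t \<in> D. w \<in> t} \<longleftrightarrow> t \<in> ?P"
    proof (cases "t \<in> tri S \<and> w \<in> t")
      case True
      moreover have "s \<in> D \<longleftrightarrow> s \<in> ?P" using s PD by auto
      ultimately have "t \<in> D \<longleftrightarrow> t \<in> ?P"
        using star_agree[of w D ?P s t, OF bdP] s by simp
      then show ?thesis using True by simp
    next
      case False
      have "w \<in> t" if "t \<in> ?P" using that by auto
      moreover have "t \<in> D" if "t \<in> ?P" using that PD by (rule rev_subsetD)
      ultimately show ?thesis using False subsetD[OF DS, of t] by (cases "t \<in> D"; cases "t \<in> ?P") simp_all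
    qed
  qed
  then show ?thesis using that[of xs] dy xs disj by auto
qed

text \<open>By additivity of \<open>bd\<close> the two boundary edges at \<open>w\<close> cancel and
  the far side of the fan takes their place. The complement stays connected through edges because
  the star of \<open>w\<close> also contains a triangle outside the old disc.\<close>

lemma disc_remove_fan:
  assumes D: "disc D ws" and ws: "ws = A @ p # w # q # B"
    and ys: "distinct (p # xs @ [q])" "w \<notin> set (p # xs @ [q])" "set xs \<inter> set ws = {}"
    and P: "{t \<in> D. w \<in> t} = insert w ` ledges (p # xs @ [q])"
  shows "disc (D - {t \<in> D. w \<in> t}) (A @ p # xs @ q # B)"
proof -
  have dist: "distinct ws" and DS: "D \<subseteq> tri S" and dc: "dual_connected (tri S - D)"
    using D unfolding disc_def by auto
  have len: "3 \<le> length ws" using ws by auto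
  have pwq: "p \<noteq> w" "p \<noteq> q" "w \<noteq> q" using dist ws by auto
  let ?P = "{t \<in> D. w \<in> t}" and ?ys = "p # xs @ [q]" and ?ws' = "A @ p # xs @ q # B"
  have ends: "hd ?ws' = hd ws" "last ?ws' = last ws" using ws by (auto simp: hd_append)
  have leq: "ledges ws = ledges (A @ [p]) \<union> {{p, w}, {w, q}} \<union> ledges (q # B)"
    unfolding ws by (simp add: ledges_append_Cons2)
  have leq': "ledges ?ws' = ledges (A @ [p]) \<union> ledges ?ys \<union> ledges (q # B)"
    using ledges_append[of A p "xs @ q # B"] ledges_append[of "p # xs" q B] by auto
  have w: "w \<notin> set A" "w \<notin> set B" "w \<noteq> hd ws" "w \<noteq> last ws" using dist ws pwq by (auto simp: hd_append)
  have bdw: "e \<in> bd S D \<longleftrightarrow> e = {p, w} \<or> e = {w, q}" if "w \<in> e" for e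
    using that w pwq ledges_subset[of e "A @ [p]"] ledges_subset[of e "q # B"]
    unfolding disc_bd[OF D len] leq by auto
  have bdP: "bd S ?P = {{p, w}, {w, q}} \<union> ledges ?ys"
  proof (intro set_eqI)
    fix e
    show "e \<in> bd S ?P \<longleftrightarrow> e \<in> {{p, w}, {w, q}} \<union> ledges ?ys"
    proof (cases "w \<in> e")
      case True
      have "e \<in> bd S ?P \<longleftrightarrow> e \<in> bd S D" using True unfolding bd_def by blast
      moreover have "e \<notin> ledges ?ys" using True ys ledges_subset[of e ?ys] by auto
      ultimately show ?thesis using bdw[OF True] by auto
    next
      case False
      have "e \<in> bd S ?P \<longleftrightarrow> e \<in> ledges ?ys"
      proof
        assume "e \<in> bd S ?P"
        then obtain t where t: "t \<in> ?P" "e \<subseteq> t" "card e = 2" unfolding bd_def by auto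
        then obtain e' where e': "e' \<in> ledges ?ys" "t = insert w e'" using P by auto
        moreover have "w \<notin> e'" using ys ledges_subset[OF e'(1)] by auto
        moreover have "t = insert w e"
          using t DS False unfolding tri_def by (intro card_3_insert) auto
        ultimately show "e \<in> ledges ?ys" using False by (metis insert_ident)
      next
        assume e: "e \<in> ledges ?ys"
        then have t: "insert w e \<in> ?P" using P by auto
        have c: "card e = 2" using ledges_card[OF ys(1) e] .
        have eS: "e \<in> S" using face_closed[of "insert w e" e] t DS unfolding tri_def by auto
        obtain t1 t2 where "t1 \<noteq> t2" and seq: "{t \<in> tri S. e \<subseteq> t} = {t1, t2}"
          using edge_tris[OF eS c] by (elim exE conjE) (rule that)
        then have "\<exists>t \<in> {t \<in> tri S. e \<subseteq> t}. t \<noteq> insert w e"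
          unfolding seq by (metis insertI1 insertI2)
        then obtain t where s: "t \<noteq> insert w e" "t \<in> tri S" "e \<subseteq> t" by blast
        have "w \<notin> t" if "t \<in> tri S" "e \<subseteq> t" "t \<noteq> insert w e" for t
          using card_3_insert[of t e w] that c False unfolding tri_def by auto
        then have "\<exists>t\<in>tri S. e \<subseteq> t \<and> t \<notin> ?P" using s by blast
        then show "e \<in> bd S ?P" using t DS c eS unfolding bd_def by blast
      qed
      then show ?thesis using False by auto
    qed
  qed
  have Deq: "D - ?P = sym_diff D ?P" by auto
  have dist': "distinct ?ws'" using dist ys ws by auto
  have "bd S (D - ?P) = sym_diff (ledges ?ws') {{hd ws, last ws}}"
  proof -
    have bD: "bd S D = sym_diff (ledges (A @ [p]) \<union> {{p, w}, {w, q}} \<union> ledges (q # B)) {{hd ws, last ws}}"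
      using D leq unfolding disc_def by simp
    have d1: "e \<notin> ledges (A @ [p]) \<and> e \<notin> ledges (q # B) \<and> e \<notin> {{p, w}, {w, q}}"
      if e: "e \<in> ledges ?ys" for e
    proof -
      have c: "card e = 2" "e \<subseteq> set ?ys" using ledges_card[OF ys(1) e] ledges_subset[OF e] by auto
      have "set ?ys \<inter> set (A @ [p]) = {p}" "set ?ys \<inter> set (q # B) = {q}"
        using ys dist ws by auto
      moreover have "\<not> e \<subseteq> {p}" "\<not> e \<subseteq> {q}"
        using c(1) card_mono[of "{p}" e] card_mono[of "{q}" e] by auto
      ultimately have "\<not> e \<subseteq> set (A @ [p])" "\<not> e \<subseteq> set (q # B)"
        using c(2) by blast+
      then show ?thesis using ledges_subset[of e "A @ [p]"] ledges_subset[of e "q # B"] c ys by auto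
    qed
    have d2: "{p, w} \<notin> ledges (A @ [p])" "{w, q} \<notin> ledges (A @ [p])"
       "{p, w} \<notin> ledges (q # B)" "{w, q} \<notin> ledges (q # B)"
      using ledges_subset[of "{p, w}"] ledges_subset[of "{w, q}"] w pwq by force+
    have d3: "{hd ws, last ws} \<notin> {{p, w}, {w, q}}" using w by auto
    have "bd S (D - ?P) = sym_diff (bd S D) (bd S ?P)" by (subst Deq) (rule bd_symdiff)
    also have "\<dots> = sym_diff (ledges ?ws') {{hd ws, last ws}}"
      unfolding bdP leq' bD by (rule sym_diff_exchange) (use d1 d2 d3 in blast)+
    finally show ?thesis .
  qed
  moreover have "dual_connected (tri S - (D - ?P))"
    unfolding dual_connected_def
  proof (intro allI impI)
    fix A'
    let ?E = "tri S - (D - ?P)"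
    assume A': "\<forall>t\<in>?E. \<forall>t'\<in>?E. card (t \<inter> t') = 2 \<longrightarrow> (t \<in> A' \<longleftrightarrow> t' \<in> A')"
    then have 1: "tri S - D \<subseteq> A' \<or> (tri S - D) \<inter> A' = {}"
      using dc unfolding dual_connected_def by blast
    \<comment> \<open>All triangles at \<open>w\<close> now belong to the complement. Those that
      share an edge at \<open>w\<close> agree on \<open>A'\<close>, so \<open>?X\<close> has no
      boundary edge at \<open>w\<close>, and the whole star follows the outer triangle in
      it.\<close>
    let ?X = "{t \<in> tri S. w \<in> t \<and> t \<in> A'}"
    have "\<forall>e\<in>bd S ?X. w \<notin> e"
    proof (intro ballI notI)
      fix e assume e: "e \<in> bd S ?X" "w \<in> e"
      then obtain t t' where t: "t \<in> tri S" "e \<subseteq> t" "t \<in> A'" "t' \<in> tri S" "e \<subseteq> t'" "t' \<notin> A'"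
        and c: "card e = 2" unfolding bd_def by blast
      have "finite t" "card t = 3" "card t' = 3" "finite t'" using t face_finite unfolding tri_def by auto
      have "card (t \<inter> t') \<ge> 2" using card_mono[of "t \<inter> t'" e] t c \<open>finite t\<close> by auto
      moreover have "card (t \<inter> t') < 3"
      proof -
        have "t \<inter> t' \<subset> t" using t \<open>finite t'\<close> \<open>card t = 3\<close> \<open>card t' = 3\<close> card_subset_eq[of t' t] by auto
        then show ?thesis using psubset_card_mono[OF \<open>finite t\<close>] \<open>card t = 3\<close> by metis
      qed
      ultimately have "card (t \<inter> t') = 2" by auto
      then show False using A' t e by blast
    qed
    then have "?X = {} \<or> ?X = {t \<in> tri S. w \<in> t}"
      by (intro star_connected) auto
    moreover obtain s where "s \<in> tri S - D" "w \<in> s"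
      using disc_outer_triangle[OF D len, of w] ws by auto
    ultimately have "tri S - D \<subseteq> A' \<and> ?P \<subseteq> A' \<or> (tri S - D) \<inter> A' = {} \<and> ?P \<inter> A' = {}"
      using 1 DS by blast
    then show "?E \<subseteq> A' \<or> ?E \<inter> A' = {}" by blast
  qed
  moreover have "tri S - (D - ?P) \<noteq> {}" using D unfolding disc_def by auto
  ultimately show ?thesis using dist' DS unfolding disc_def ends by (auto simp: ends)
qed

text \<open>\<open>fan_disc\<close> retraces the peeling backwards. With two boundary vertices left,
  the boundary is empty, and strong connectivity together with the nonempty complement forces
  \<open>D = {}\<close>.\<close>

lemma disc_imp_fan_disc: "disc D ws \<Longrightarrow> fan_disc (hd ws) (last ws) D ws"
proof (induction "card D" arbitrary: D ws rule: less_induct)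
  case less
  note D = less.prems
  have finD: "finite D" and DS: "D \<subseteq> tri S"
    using D finite_complex finite_subset[of D S] unfolding disc_def tri_def by auto
  show ?case
  proof (cases "length ws = 2")
    case True
    then obtain a b where ws: "ws = [a, b]" by (auto simp: length_Suc_conv numeral_2_eq_2)
    then have "bd S D = {}" using D unfolding disc_def by auto
    then have "D = {}" using strongly_connected[of D] D unfolding disc_def by auto
    then show ?thesis using fan_disc.edge[of a b] ws D unfolding disc_def by auto
  next
    case False
    then have len: "3 \<le> length ws" using D unfolding disc_def by auto
    obtain A p w q B where ws: "ws = A @ p # w # q # B"
      and ch: "\<forall>t\<in>D. w \<in> t \<longrightarrow> t \<inter> set ws \<subseteq> {p, w, q}"
      using chordless_vertex[OF D len] by blast
    obtain xs where ys: "distinct (p # xs @ [q])" "w \<notin> set (p # xs @ [q])" "set xs \<inter> set ws = {}"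
      and P: "{t \<in> D. w \<in> t} = insert w ` ledges (p # xs @ [q])"
      using boundary_fan[OF D ws ch] by blast
    let ?D' = "D - {t \<in> D. w \<in> t}" and ?ws' = "A @ p # xs @ q # B"
    have D': "disc ?D' ?ws'" by (rule disc_remove_fan[OF D ws ys P])
    have "{t \<in> D. w \<in> t} \<noteq> {}" unfolding P by (cases xs) auto
    then have "card ?D' < card D" using finD by (intro psubset_card_mono) auto
    then have "fan_disc (hd ?ws') (last ?ws') ?D' ?ws'" using less.hyps D' by blast
    moreover have "hd ?ws' = hd ws" "last ?ws' = last ws" using ws by (auto simp: hd_append)
    moreover have "distinct ws" using D unfolding disc_def by auto
    ultimately have "fan_disc (hd ws) (last ws) (?D' \<union> insert w ` ledges (p # xs @ [q])) (A @ p # w # q # B)"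
      using ys ws by (intro fan_disc.cone) auto
    moreover have "?D' \<union> insert w ` ledges (p # xs @ [q]) = D" unfolding P[symmetric] by auto
    ultimately show ?thesis using ws by simp
  qed
qed

text \<open>The start of the peeling: the complement of the disc is one triangle, which is trivially
  dual-connected. The order \<open>[a, c, b]\<close> makes \<open>a b\<close> the edge on which the
  rebuilding begins.\<close>

lemma fan_disc_complement:
  obtains a b c where "a \<noteq> b" "a \<noteq> c" "b \<noteq> c" "{a, b, c} \<in> tri S"
    "fan_disc a b (tri S - {{a, b, c}}) [a, c, b]"
proof -
  obtain \<sigma> where "\<sigma> \<in> S" using nonempty by auto
  then obtain t where t: "t \<in> tri S" using face_in_triangle by blast
  then obtain a b c where abc: "t = {a, b, c}" "a \<noteq> b" "a \<noteq> c" "b \<noteq> c"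
    unfolding tri_def by (auto simp: card_3_iff)
  have tS: "{a, b} \<in> S" "{a, c} \<in> S" "{b, c} \<in> S"
    using t face_closed[of t] abc unfolding tri_def by auto
  have "bd S {t} = {{a, b}, {a, c}, {c, b}}"
  proof
    show "bd S {t} \<subseteq> {{a, b}, {a, c}, {c, b}}"
    proof
      fix e assume "e \<in> bd S {t}"
      then have "e \<subseteq> {a, b, c}" "card e = 2" using abc unfolding bd_def by auto
      moreover from this obtain x y where "e = {x, y}" "x \<noteq> y" by (meson card_2_iff)
      ultimately show "e \<in> {{a, b}, {a, c}, {c, b}}" by (auto simp: insert_commute)
    qed
    have "e \<in> bd S {t}" if "e \<in> S" "card e = 2" "e \<subseteq> t" for e
    proof -
      obtain t1 t2 where "t1 \<noteq> t2" and seq: "{t \<in> tri S. e \<subseteq> t} = {t1, t2}"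
        using edge_tris[OF \<open>e \<in> S\<close> \<open>card e = 2\<close>] by (elim exE conjE) (rule that)
      then have "\<exists>s \<in> {t \<in> tri S. e \<subseteq> t}. s \<noteq> t"
        unfolding seq by (metis insertI1 insertI2)
      then show ?thesis using that t unfolding bd_def by blast
    qed
    then show "{{a, b}, {a, c}, {c, b}} \<subseteq> bd S {t}" using tS abc by (auto simp: insert_commute)
  qed
  then have "bd S (tri S - {t}) = sym_diff (ledges [a, c, b]) {{hd [a, c, b], last [a, c, b]}}"
    unfolding bd_diff_complement using abc by (auto simp: doubleton_eq_iff)
  moreover have "tri S - (tri S - {t}) = {t}" using t by auto
  ultimately have "disc (tri S - {t}) [a, c, b]"
    using abc unfolding disc_def dual_connected_def by auto
  then show ?thesis using that[OF abc(2-4)] disc_imp_fan_disc[of "tri S - {t}" "[a, c, b]"] t abc by auto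
qed

end

section \<open>Convex realization of a canonical ordering\<close>

definition line_above :: "('a \<Rightarrow> real) \<Rightarrow> ('a \<Rightarrow> real) \<Rightarrow> 'a set \<Rightarrow> 'a \<Rightarrow> 'a \<Rightarrow> real \<Rightarrow> bool" where
  "line_above x y U a b m \<longleftrightarrow>
     y b = y a + m * (x b - x a) \<and> (\<forall>u\<in>U - {a, b}. y u < y a + m * (x u - x a))"

lemma line_above_le: "line_above x y U a b m \<Longrightarrow> u \<in> U \<Longrightarrow> y u \<le> y a + m * (x u - x a)"
  unfolding line_above_def by (cases "u = a \<or> u = b") (auto intro: less_imp_le)

lemma line_above_le': "line_above x y U a b m \<Longrightarrow> u \<in> U \<Longrightarrow> y u \<le> y b + m * (x u - x b)"
  using line_above_le[of x y U a b m u] unfolding line_above_def by (auto simp: algebra_simps)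

lemma line_above_less: "line_above x y U a b m \<Longrightarrow> u \<in> U \<Longrightarrow> u \<noteq> a \<Longrightarrow> u \<noteq> b \<Longrightarrow> y u < y a + m * (x u - x a)"
  unfolding line_above_def by auto

lemma line_above_less': "line_above x y U a b m \<Longrightarrow> u \<in> U \<Longrightarrow> u \<noteq> a \<Longrightarrow> u \<noteq> b \<Longrightarrow> y u < y b + m * (x u - x b)"
proof -
  assume a: "line_above x y U a b m" "u \<in> U" "u \<noteq> a" "u \<noteq> b"
  have "y b = y a + m * (x b - x a)" using a(1) unfolding line_above_def by blast
  then show ?thesis using line_above_less[OF a] by (simp add: right_diff_distrib)
qed

text \<open>\<open>m1\<close> is the slope of the edge leaving \<open>p\<close>, \<open>m0\<close>
  that of the edge entering it. A slope strictly between them bounds the points to the right of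
  \<open>p\<close> because it exceeds \<open>m1\<close>, and those to the left because it stays
  below \<open>m0\<close>. If nothing lies to the left, \<open>m1 + 1\<close> is a stand-in for
  \<open>m0\<close>.\<close>

lemma tilt_right:
  assumes pc: "line_above x y U p c m1" "x p < x c"
    and left: "(\<forall>u\<in>U - {p}. x p < x u) \<or> (\<exists>p0. line_above x y U p0 p m0 \<and> x p0 < x p \<and> c \<in> U)"
    and m0: "(\<forall>u\<in>U - {p}. x p < x u) \<Longrightarrow> m0 = m1 + 1"
  obtains s where "m1 < s" "s < m0" "\<forall>u\<in>U - {p}. y u < y p + s * (x u - x p)"
proof (cases "\<forall>u\<in>U - {p}. x p < x u")
  case True
  have "y u < y p + (m1 + 1/2) * (x u - x p)" if "u \<in> U - {p}" for u
  proof -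
    define d where "d = x u - x p"
    have "0 < d" "y u \<le> y p + m1 * d"
      using line_above_le[OF pc(1), of u] that True unfolding d_def by auto
    moreover have "(m1 + 1/2) * d = m1 * d + d / 2"
      by (simp add: field_simps)
    ultimately show ?thesis unfolding d_def[symmetric] by linarith
  qed
  then show ?thesis using that[of "m1 + 1/2"] m0[OF True] by auto
next
  case False
  then obtain p0 where p0: "line_above x y U p0 p m0" "x p0 < x p" "c \<in> U" using left by auto
  have "y c < y p + m0 * (x c - x p)"
    using line_above_less'[OF p0(1,3)] p0(2) pc(2) by force
  moreover have "y c = y p + m1 * (x c - x p)" using pc unfolding line_above_def by auto
  ultimately have m: "m1 < m0" using pc(2) by (auto simp: mult_less_cancel_right)
  define s where "s = (m1 + m0) / 2"
  have s: "m1 < s" "s < m0" using m unfolding s_def by auto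
  have "y u < y p + s * (x u - x p)" if u: "u \<in> U - {p}" for u
  proof -
    consider "x u < x p" | "x u > x p" | "x u = x p" by linarith
    then show ?thesis
    proof cases
      case 1
      then have "m0 * (x u - x p) < s * (x u - x p)" using s by (auto simp: mult_less_cancel_right)
      then show ?thesis using line_above_le'[OF p0(1), of u] u by auto
    next
      case 2
      then have "m1 * (x u - x p) < s * (x u - x p)" using s by (auto simp: mult_less_cancel_right)
      then show ?thesis using line_above_le[OF pc(1), of u] u by auto
    next
      case 3
      then have "u \<noteq> c" using pc by auto
      then show ?thesis using line_above_less[OF pc(1), of u] u 3 by simp
    qed
  qed
  then show ?thesis using that s by blast
qed

lemma line_above_mirror:
  "line_above x y U a b m \<Longrightarrow> line_above (\<lambda>u. - x u) y U b a (- m)"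
  using line_above_less'[of x y U a b m] unfolding line_above_def by (auto simp: algebra_simps)

lemma tilt_left:
  assumes cq: "line_above x y U c q m2" "x c < x q"
    and right: "(\<forall>u\<in>U - {q}. x u < x q) \<or> (\<exists>q0. line_above x y U q q0 m3 \<and> x q < x q0 \<and> c \<in> U)"
    and m3: "(\<forall>u\<in>U - {q}. x u < x q) \<Longrightarrow> m3 = m2 - 1"
  obtains s where "s < m2" "m3 < s" "\<forall>u\<in>U - {q}. y u < y q + s * (x u - x q)"
proof -
  let ?x = "\<lambda>u. - x u"
  have "(\<forall>u\<in>U - {q}. ?x q < ?x u) \<or> (\<exists>q0. line_above ?x y U q0 q (- m3) \<and> ?x q0 < ?x q \<and> c \<in> U)"
    using right line_above_mirror by fastforce
  from tilt_right[OF line_above_mirror[OF cq(1)] _ this]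
  obtain s where s: "- m2 < s" "s < - m3" "\<forall>u\<in>U - {q}. y u < y q + s * (?x u - ?x q)"
    using cq(2) m3 by auto
  then show ?thesis using that[of "- s"] by (auto simp: algebra_simps)
qed

text \<open>Both slopes are compared with that of the segment from \<open>a\<close> to
  \<open>d\<close>: the first line passes above \<open>d\<close> and the second above
  \<open>a\<close>, possibly through them.\<close>

lemma slope_decreasing:
  assumes ab: "line_above x y U a b m" and cd: "line_above x y U c d m'"
    and U: "b \<in> U" "c \<in> U" and "x a \<le> x c" "x c < x d" "x a < x b" "x b \<le> x d" "a \<in> U" "d \<in> U"
  shows "m' \<le> m"
proof -
  have "y d \<le> y a + m * (x d - x a)" using line_above_le[OF ab] assms by auto
  moreover have "y a \<le> y d + m' * (x a - x d)" using line_above_le'[OF cd] assms by auto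
  ultimately have "m' * (x d - x a) \<le> m * (x d - x a)" by (auto simp: algebra_simps)
  then show ?thesis using assms by (auto simp: mult_le_cancel_right)
qed

text \<open>
  The new point is the intersection of a line through \<open>p\<close> slightly steeper than the first covered
  edge and a line through \<open>q\<close> slightly less steep than the last covered edge.
\<close>

lemma place_vertex:
  fixes x y :: "'a \<Rightarrow> real"
  assumes ws: "ws = A @ p # xs @ q # B" and U: "set ws \<subseteq> U"
    and ends: "hd ws = v1" "last ws = v2"
    and sorted: "sorted_wrt (\<lambda>a b. x a < x b) ws"
    and chain: "\<And>A a b B. ws = A @ a # b # B \<Longrightarrow> \<exists>m. line_above x y U a b m"
    and left: "\<forall>u\<in>U - {v1}. x v1 < x u" and right: "\<forall>u\<in>U - {v2}. x u < x v2"
    and pos: "\<forall>u\<in>U. 0 \<le> y u"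
  obtains X Y where "x p < X" "X < x q" "0 < Y"
    "\<forall>C a b E m. A @ [p] = C @ a # b # E \<or> q # B = C @ a # b # E \<longrightarrow> line_above x y U a b m \<longrightarrow>
        Y < y a + m * (X - x a)"
    "\<forall>C a b E m. p # xs @ [q] = C @ a # b # E \<longrightarrow> line_above x y U a b m \<longrightarrow> y a + m * (X - x a) < Y"
    "\<exists>m. Y = y p + m * (X - x p) \<and> (\<forall>u\<in>U - {p}. y u < y p + m * (x u - x p))"
    "\<exists>m. Y = y q + m * (X - x q) \<and> (\<forall>u\<in>U - {q}. y u < y q + m * (x u - x q))"
proof -
  have pq: "p \<in> U" "q \<in> U" "x p < x q" using U sorted ws by (auto simp: sorted_wrt_append)
  obtain c1 xs1 where c1: "xs @ [q] = c1 # xs1" by (cases xs) auto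
  obtain c2 xs2 where c2: "p # xs = xs2 @ [c2]" by (metis list.distinct(1) rev_exhaust)
  have ws1: "ws = A @ p # c1 # xs1 @ B" using ws c1 by (metis append.assoc append_Cons append_Nil)
  have ws2: "ws = (A @ xs2) @ c2 # q # B" using ws c2 by (metis append.assoc append_Cons append_Nil)
  have U12: "c1 \<in> U" "c2 \<in> U"
    using U[unfolded ws1] U[unfolded ws2] by simp_all
  have x12: "x p < x c1" "x c2 < x q"
    using sorted[unfolded ws1] sorted[unfolded ws2] by (simp_all add: sorted_wrt_append)
  obtain m1 where m1: "line_above x y U p c1 m1" using chain[OF ws1] by auto
  obtain m2 where m2: "line_above x y U c2 q m2" using chain[OF ws2] by auto
  obtain m0 s1 where s1: "m1 < s1" "\<forall>u\<in>U - {p}. y u < y p + s1 * (x u - x p)"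
    and m0: "A = [] \<or> (\<exists>p0. p0 \<in> U \<and> line_above x y U p0 p m0 \<and> s1 < m0 \<and> x p0 < x p)"
  proof (cases A rule: rev_cases)
    case Nil
    then have "p = v1" using ws ends by auto
    then have l: "\<forall>u\<in>U - {p}. x p < x u" using left by auto
    show ?thesis using tilt_right[OF m1 x12(1), of "m1 + 1"] l that Nil by metis
  next
    case (snoc A0 p0)
    then have w0: "ws = A0 @ p0 # p # xs @ q # B" using ws by auto
    then obtain m0 where m0: "line_above x y U p0 p m0" using chain by blast
    have p0: "x p0 < x p" "p0 \<in> U" using w0 sorted U by (auto simp: sorted_wrt_append)
    then have "p0 \<in> U - {p}" "\<not> x p < x p0" by auto
    then have "\<not> (\<forall>u\<in>U - {p}. x p < x u)" by blast
    then obtain s where "m1 < s" "s < m0" "\<forall>u\<in>U - {p}. y u < y p + s * (x u - x p)"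
      using tilt_right[OF m1 x12(1), of m0] m0 p0 U12 by metis
    then show ?thesis using that m0 p0 by blast
  qed
  obtain m3 s2 where s2: "s2 < m2" "\<forall>u\<in>U - {q}. y u < y q + s2 * (x u - x q)"
    and m3: "B = [] \<or> (\<exists>q0. q0 \<in> U \<and> line_above x y U q q0 m3 \<and> m3 < s2 \<and> x q < x q0)"
  proof (cases B)
    case Nil
    then have "q = v2" using ws ends by auto
    then have l: "\<forall>u\<in>U - {q}. x u < x q" using right by auto
    show ?thesis using tilt_left[OF m2 x12(2), of "m2 - 1"] l that Nil by metis
  next
    case (Cons q0 B0)
    then have w0: "ws = (A @ p # xs) @ q # q0 # B0" using ws by auto
    then obtain m3 where m3: "line_above x y U q q0 m3" using chain by blast
    have q0: "x q < x q0" "q0 \<in> U" using w0 sorted U by (auto simp: sorted_wrt_append)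
    then have "q0 \<in> U - {q}" "\<not> x q0 < x q" by auto
    then have "\<not> (\<forall>u\<in>U - {q}. x u < x q)" by blast
    then obtain s where "s < m2" "m3 < s" "\<forall>u\<in>U - {q}. y u < y q + s * (x u - x q)"
      using tilt_left[OF m2 x12(2), of m3] m3 q0 U12 by metis
    then show ?thesis using that m3 q0 by blast
  qed
  have sq: "s2 * (x q - x p) < y q - y p" "y q - y p < s1 * (x q - x p)"
  proof -
    have "y p < y q + s2 * (x p - x q)" "y q < y p + s1 * (x q - x p)"
      using s1 s2 pq by auto
    then show "s2 * (x q - x p) < y q - y p" "y q - y p < s1 * (x q - x p)" by (auto simp: algebra_simps)
  qed
  then have "s2 * (x q - x p) < s1 * (x q - x p)" by linarith
  then have s12: "s2 < s1" using pq by (auto simp: mult_less_cancel_right)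
  \<comment> \<open>The solution of \<open>y p + s1 * (X - x p) = y q + s2 * (X - x q)\<close>. Each
    of \<open>p\<close> and \<open>q\<close> lies strictly below the line through the other, which
    puts \<open>X\<close> strictly between them.\<close>
  define X where "X = x p + (y q - y p - s2 * (x q - x p)) / (s1 - s2)"
  define Y where "Y = y p + s1 * (X - x p)"
  have Xp: "x p < X" unfolding X_def using sq s12 by simp
  have Xe: "(X - x p) * (s1 - s2) = y q - y p - s2 * (x q - x p)" unfolding X_def using s12 by simp
  have "(X - x p) * (s1 - s2) < (x q - x p) * (s1 - s2)" unfolding Xe using sq by (auto simp: algebra_simps)
  then have Xq: "X < x q" using s12 by (auto simp: mult_less_cancel_right)
  have Y2: "Y = y q + s2 * (X - x q)" using Xe unfolding Y_def by (auto simp: algebra_simps)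
  have Y1m: "y p + m1 * (X - x p) < Y" unfolding Y_def using s1 Xp by auto
  have Y2m: "y q + m2 * (X - x q) < Y" unfolding Y2 using s2 Xq by (auto simp: mult_less_cancel_right)
  have m21: "m2 \<le> m1"
  proof (rule slope_decreasing[OF m1 m2])
    have "c1 \<in> set (xs @ [q])" "c2 \<in> set (p # xs)" unfolding c1 c2 by auto
    then show "x p \<le> x c2" "x c1 \<le> x q"
      using sorted[unfolded ws] by (auto simp: sorted_wrt_append intro: less_imp_le)
  qed (use pq U12 x12 in auto)
  \<comment> \<open>The new point is above the lines of the first and the last covered edge. Since
    \<open>m2 \<le> m1\<close>, either the first does not descend from \<open>p\<close> or the last
    descends towards \<open>q\<close>; in both cases one of the lines is nonnegative at
    \<open>X\<close>.\<close>
  have "0 < Y"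
  proof (cases "0 \<le> m1")
    case True
    then have "0 \<le> m1 * (X - x p)" using Xp by auto
    then show ?thesis using Y1m pos pq by fastforce
  next
    case False
    then have "0 \<le> m2 * (X - x q)" using Xq m21 by (auto simp: mult_nonpos_nonpos)
    then show ?thesis using Y2m pos pq by fastforce
  qed
  \<comment> \<open>By concavity the uncovered edges on the left are at least as steep as
    \<open>m0\<close>, those on the right at most as steep as \<open>m3\<close>. The slopes
    \<open>s1\<close> and \<open>s2\<close> lie strictly within these bounds, so the new point stays
    below every uncovered edge line.\<close>
  moreover have "Y < y a + m * (X - x a)"
    if e: "A @ [p] = C @ a # b # E \<or> q # B = C @ a # b # E" and m: "line_above x y U a b m" for C a b E m
    using e
  proof
    assume e: "A @ [p] = C @ a # b # E"
    then have "A \<noteq> []" by (cases C) auto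
    then obtain p0 where p0: "p0 \<in> U" "line_above x y U p0 p m0" "s1 < m0" "x p0 < x p" using m0 by auto
    have aw: "ws = C @ a # b # E @ xs @ q # B" using e ws
      by (metis append.assoc append_Cons append_Nil)
    have aU: "a \<in> U" using aw U by auto
    have "a \<in> set A" using e by (cases E rule: rev_cases) auto
    then have ap: "x a < x p" using sorted ws by (auto simp: sorted_wrt_append)
    have yp: "y p \<le> y a + m * (x p - x a)" using line_above_le[OF m] pq by auto
    moreover have "y a \<le> y p + m0 * (x a - x p)" using line_above_le'[OF p0(2) aU] .
    ultimately have "m0 * (x p - x a) \<le> m * (x p - x a)" by (auto simp: algebra_simps)
    then have "m0 \<le> m" using ap by (auto simp: mult_le_cancel_right)
    then have "s1 * (X - x p) < m * (X - x p)" using p0 Xp by auto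
    then show ?thesis using yp unfolding Y_def by (auto simp: algebra_simps)
  next
    assume e: "q # B = C @ a # b # E"
    then have "B \<noteq> []" by (cases C) auto
    then obtain q0 where q0: "q0 \<in> U" "line_above x y U q q0 m3" "m3 < s2" "x q < x q0" using m3 by auto
    have bw: "ws = (A @ p # xs @ C) @ a # b # E" using e ws by simp
    have bU: "b \<in> U" using bw U by auto
    have "b \<in> set B" using e by (cases C) auto
    then have qb: "x q < x b" using sorted ws by (auto simp: sorted_wrt_append)
    have yq: "y q \<le> y b + m * (x q - x b)" using line_above_le'[OF m] pq by auto
    moreover have "y b \<le> y q + m3 * (x b - x q)" using line_above_le[OF q0(2) bU] .
    ultimately have "m * (x b - x q) \<le> m3 * (x b - x q)" by (auto simp: algebra_simps)
    then have "m \<le> m3" using qb by (auto simp: mult_le_cancel_right)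
    then have "s2 * (X - x q) < m * (X - x q)" using q0 Xq by (auto simp: mult_less_cancel_right)
    then have "Y < y b + m * (X - x b)" using yq unfolding Y2 by (auto simp: algebra_simps)
    moreover have "y b = y a + m * (x b - x a)" using m unfolding line_above_def by auto
    ultimately show ?thesis by (auto simp: algebra_simps)
  qed
  \<comment> \<open>The slope of a covered edge lies between \<open>m2\<close> and
    \<open>m1\<close>. At \<open>X\<close> its line is dominated by that of the first covered edge
    if \<open>x a \<le> X\<close>, and by that of the last one otherwise; the new point is above
    both.\<close>
  moreover have "y a + m * (X - x a) < Y"
    if e: "p # xs @ [q] = C @ a # b # E" and m: "line_above x y U a b m" for C a b E m
  proof -
    have abw: "ws = (A @ C) @ a # b # E @ B" using e ws
      by (metis append.assoc append_Cons append_Nil)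
    have abU: "a \<in> U" "b \<in> U" "x a < x b"
      using U[unfolded abw] sorted[unfolded abw] by (simp_all add: sorted_wrt_append)
    have "a \<in> set (p # xs @ [q])" "b \<in> set (p # xs @ [q])" unfolding e by auto
    then have pa: "x p \<le> x a" and bq: "x b \<le> x q"
      using sorted[unfolded ws] by (auto simp: sorted_wrt_append intro: less_imp_le)
    have yba: "y b = y a + m * (x b - x a)" using m unfolding line_above_def by auto
    have mm1: "m \<le> m1"
    proof -
      have "y b \<le> y p + m1 * (x b - x p)" using line_above_le[OF m1] abU by auto
      moreover have "y p \<le> y b + m * (x p - x b)" using line_above_le'[OF m] pq by auto
      ultimately have "m * (x b - x p) \<le> m1 * (x b - x p)" by (auto simp: algebra_simps)
      then show ?thesis using abU pa by (auto simp: mult_le_cancel_right)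
    qed
    have mm2: "m2 \<le> m"
    proof -
      have "y a \<le> y q + m2 * (x a - x q)" using line_above_le'[OF m2] abU by auto
      moreover have "y q \<le> y a + m * (x q - x a)" using line_above_le[OF m] pq by auto
      ultimately have "m2 * (x q - x a) \<le> m * (x q - x a)" by (auto simp: algebra_simps)
      then show ?thesis using abU bq by (auto simp: mult_le_cancel_right)
    qed
    show ?thesis
    proof (cases "x a \<le> X")
      case True
      have "y a \<le> y p + m1 * (x a - x p)" using line_above_le[OF m1] abU by auto
      moreover have "m * (X - x a) \<le> m1 * (X - x a)" using mm1 True by (auto simp: mult_right_mono)
      ultimately have "y a + m * (X - x a) \<le> y p + m1 * (X - x p)" by (auto simp: algebra_simps)
      then show ?thesis using Y1m by linarith
    next
      case False
      have "y b \<le> y q + m2 * (x b - x q)" using line_above_le'[OF m2] abU by auto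
      moreover have "m * (X - x b) \<le> m2 * (X - x b)" using mm2 False abU by (intro mult_right_mono_neg) auto
      ultimately have "y b + m * (X - x b) \<le> y q + m2 * (X - x q)" by (auto simp: algebra_simps)
      then show ?thesis using Y2m yba by (auto simp: algebra_simps)
    qed
  qed
  moreover have "\<exists>m. Y = y p + m * (X - x p) \<and> (\<forall>u\<in>U - {p}. y u < y p + m * (x u - x p))"
    using s1 Y_def by blast
  moreover have "\<exists>m. Y = y q + m * (X - x q) \<and> (\<forall>u\<in>U - {q}. y u < y q + m * (x u - x q))"
    using s2 Y2 by blast
  ultimately show ?thesis using that[of X Y] Xp Xq by blast
qed

text \<open>The planes through the lifted edge \<open>a b\<close> form the pencil
  \<open>g + s * f\<close>, where \<open>f\<close> is the signed height over the line
  \<open>a b\<close> in the projection. As \<open>f\<close> is negative at the other old points and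
  positive at the new one, a large \<open>Z\<close> forces a large \<open>s\<close>, which sinks the
  plane below all old points.\<close>

lemma plane_through_new_vertex:
  fixes x y z :: "'a \<Rightarrow> real"
  assumes m: "line_above x y U a b m" and ab: "x a < x b" and v: "y a + m * (X - x a) < Y" and "finite U"
  shows "\<forall>\<^sub>F Z in at_top. \<exists>\<alpha> \<beta> \<delta>. (\<forall>u\<in>{a, b}. z u = \<alpha> * x u + \<beta> * y u + \<delta>) \<and>
      Z = \<alpha> * X + \<beta> * Y + \<delta> \<and> (\<forall>u\<in>U - {a, b}. \<alpha> * x u + \<beta> * y u + \<delta> < z u)"
proof -
  define k where "k = (z b - z a) / (x b - x a)"
  define f where "f u = y u - y a - m * (x u - x a)" for u
  define F where "F = Y - y a - m * (X - x a)"
  define g where "g u = z a + k * (x u - x a)" for u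
  define G where "G = z a + k * (X - x a)"
  have F: "0 < F" using v unfolding F_def by auto
  have f: "f u < 0" if "u \<in> U - {a, b}" for u using line_above_less[OF m, of u] that unfolding f_def by auto
  have "\<forall>\<^sub>F Z in at_top. \<forall>u\<in>U - {a, b}. G + F * ((g u - z u) / (- f u)) < Z"
    using \<open>finite U\<close> by (intro eventually_ball_finite) (auto intro: eventually_gt_at_top)
  then show ?thesis
  proof (rule eventually_mono)
    fix Z assume Z: "\<forall>u\<in>U - {a, b}. G + F * ((g u - z u) / (- f u)) < Z"
    \<comment> \<open>The parameter at which the plane of the pencil passes through the new point at
      height \<open>Z\<close>.\<close>
    define s where "s = (Z - G) / F"
    define \<alpha> where "\<alpha> = k - s * m"
    define \<delta> where "\<delta> = z a - k * x a - s * y a + s * m * x a"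
    have e: "\<alpha> * x u + s * y u + \<delta> = g u + s * f u" for u
      unfolding \<alpha>_def \<delta>_def g_def f_def by (simp add: algebra_simps)
    have E: "\<alpha> * X + s * Y + \<delta> = G + s * F"
      unfolding \<alpha>_def \<delta>_def G_def F_def by (simp add: algebra_simps)
    have "f a = 0" "f b = 0" "g a = z a" using m unfolding f_def g_def line_above_def by auto
    moreover have "g b = z b" using ab unfolding g_def k_def by auto
    ultimately have "\<forall>u\<in>{a, b}. z u = \<alpha> * x u + s * y u + \<delta>" unfolding e by auto
    moreover have "s * F = Z - G" unfolding s_def using F by simp
    then have "Z = \<alpha> * X + s * Y + \<delta>" unfolding E by simp
    moreover have "\<alpha> * x u + s * y u + \<delta> < z u" if u: "u \<in> U - {a, b}" for u
    proof -
      have "F * ((g u - z u) / (- f u)) < Z - G" using Z u by force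
      then have "(g u - z u) / (- f u) < s" unfolding s_def using F by (simp add: pos_less_divide_eq mult.commute)
      moreover have "0 < - f u" using f[OF u] by auto
      ultimately have "g u - z u < s * (- f u)" using pos_divide_less_eq by blast
      then show ?thesis unfolding e by auto
    qed
    ultimately show "\<exists>\<alpha> \<beta> \<delta>. (\<forall>u\<in>{a, b}. z u = \<alpha> * x u + \<beta> * y u + \<delta>) \<and>
      Z = \<alpha> * X + \<beta> * Y + \<delta> \<and> (\<forall>u\<in>U - {a, b}. \<alpha> * x u + \<beta> * y u + \<delta> < z u)" by blast
  qed
qed

text \<open>Planes supporting the lifted points from below in the triangles stand in for any
  statement on how the projected triangles fit together. Pinning \<open>v1 v2\<close> at height 0
  prepares the plane of the outer triangle, and the nondegenerate shadows in the last clause later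
  yield affine independence.\<close>

definition convex_lift :: "'a \<Rightarrow> 'a \<Rightarrow> 'a set set \<Rightarrow> 'a list \<Rightarrow> ('a \<Rightarrow> real) \<Rightarrow> ('a \<Rightarrow> real) \<Rightarrow> ('a \<Rightarrow> real) \<Rightarrow> bool" where
  "convex_lift v1 v2 D ws x y z \<longleftrightarrow>
     (let U = \<Union>D \<union> set ws in
      x v1 = 0 \<and> y v1 = 0 \<and> z v1 = 0 \<and> x v2 = 1 \<and> y v2 = 0 \<and> z v2 = 0 \<and>
      (\<forall>u\<in>U - {v1, v2}. 0 < x u \<and> x u < 1 \<and> 0 < y u) \<and>
      sorted_wrt (\<lambda>a b. x a < x b) ws \<and>
      (\<forall>A a b B. ws = A @ a # b # B \<longrightarrow> (\<exists>m. line_above x y U a b m)) \<and>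
      (\<forall>t\<in>D. \<exists>\<alpha> \<beta> \<delta>. (\<forall>u\<in>t. z u = \<alpha> * x u + \<beta> * y u + \<delta>) \<and> (\<forall>u\<in>U - t. \<alpha> * x u + \<beta> * y u + \<delta> < z u)) \<and>
      (\<forall>t\<in>D. \<exists>a b c. t = {a, b, c} \<and> (x b - x a) * (y c - y a) \<noteq> (x c - x a) * (y b - y a)))"

lemma fan_disc_finite: "fan_disc v1 v2 D ws \<Longrightarrow> finite (\<Union>D \<union> set ws) \<and> v1 \<noteq> v2 \<and> hd ws = v1 \<and> last ws = v2"
proof (induction rule: fan_disc.induct)
  case (cone D A p xs q B w)
  have "\<Union>(insert w ` ledges (p # xs @ [q])) \<subseteq> insert w (set (p # xs @ [q]))"
    using ledges_subset by fastforce
  then have "finite (\<Union>(insert w ` ledges (p # xs @ [q])))" by (rule finite_subset) auto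
  then show ?case using cone by (auto simp: hd_append)
qed auto

text \<open>The position \<open>(X, Y)\<close> of the new vertex keeps the boundary chain concave,
  and the height \<open>Z\<close> is chosen afterwards. An old triangle only needs \<open>Z\<close>
  above its plane, a new one needs \<open>Z\<close> so large that its plane clears the old points;
  finitely many such conditions hold together.\<close>

lemma fan_disc_convex_lift:
  "fan_disc v1 v2 D ws \<Longrightarrow> \<exists>x y z. convex_lift v1 v2 D ws x y z"
proof (induction rule: fan_disc.induct)
  case edge
  define x :: "'a \<Rightarrow> real" where "x = (\<lambda>u. if u = v2 then 1 else 0)"
  have "line_above x (\<lambda>_. 0) {v1, v2} a b 0" if "[v1, v2] = A @ a # b # B" for A a b B
    using that unfolding line_above_def by (cases A) auto
  then have chain: "\<forall>A a b B. [v1, v2] = A @ a # b # B \<longrightarrow> (\<exists>m. line_above x (\<lambda>_. 0) {v1, v2} a b m)"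
    by blast
  have U: "\<Union>{} \<union> set [v1, v2] = {v1, v2}" by simp
  have "x v1 = 0" "x v2 = 1" using edge unfolding x_def by auto
  then show ?case unfolding convex_lift_def Let_def U
    by (intro exI[of _ x] exI[of _ "\<lambda>_. 0"] conjI chain) auto
next
  case (cone D A p xs q B w)
  define ws where "ws = A @ p # xs @ q # B"
  define ws' where "ws' = A @ p # w # q # B"
  define ys where "ys = p # xs @ [q]"
  define U where "U = \<Union>D \<union> set ws"
  define P where "P = insert w ` ledges ys"
  have inv: "finite U" "v1 \<noteq> v2" "hd ws = v1" "last ws = v2"
    using fan_disc_finite[OF cone.hyps(1)] unfolding U_def ws_def by auto
  have w: "w \<notin> U" using cone.hyps unfolding U_def ws_def by auto
  have U': "\<Union>(D \<union> P) \<union> set ws' = insert w U"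
  proof -
    have "\<Union>P \<subseteq> insert w (set ys)" using ledges_subset unfolding P_def by fastforce
    moreover have "set ys \<subseteq> \<Union>P"
      using ledges_cover[of _ ys] unfolding P_def ys_def by fastforce
    ultimately show ?thesis unfolding U_def ws_def ws'_def ys_def by auto
  qed
  obtain x y z where cl: "convex_lift v1 v2 D ws x y z" using cone.IH unfolding ws_def by auto
  then have base: "x v1 = 0" "y v1 = 0" "z v1 = 0" "x v2 = 1" "y v2 = 0" "z v2 = 0"
    and pos': "\<forall>u\<in>U - {v1, v2}. 0 < x u \<and> x u < 1 \<and> 0 < y u"
    and sorted: "sorted_wrt (\<lambda>a b. x a < x b) ws"
    and chain': "\<forall>A a b B. ws = A @ a # b # B \<longrightarrow> (\<exists>m. line_above x y U a b m)"
    and plane: "\<forall>t\<in>D. \<exists>\<alpha> \<beta> \<delta>. (\<forall>u\<in>t. z u = \<alpha> * x u + \<beta> * y u + \<delta>) \<and>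
        (\<forall>u\<in>U - t. \<alpha> * x u + \<beta> * y u + \<delta> < z u)"
    and nondeg: "\<forall>t\<in>D. \<exists>a b c. t = {a, b, c} \<and> (x b - x a) * (y c - y a) \<noteq> (x c - x a) * (y b - y a)"
    unfolding convex_lift_def Let_def U_def[symmetric] by - (elim conjE, assumption)+
  note pos = pos'[rule_format] and chain = chain'[rule_format]
  have wsU: "set ws \<subseteq> U" unfolding U_def by auto
  have v12U: "v1 \<in> U" "v2 \<in> U" using wsU inv unfolding ws_def by (metis Un_iff append_is_Nil_conv hd_in_set last_in_set list.distinct(1) subsetD)+
  have wv: "w \<noteq> v1" "w \<noteq> v2" using w v12U by auto
  have x01: "\<forall>u\<in>U - {v1}. x v1 < x u" "\<forall>u\<in>U - {v2}. x u < x v2" "\<forall>u\<in>U. 0 \<le> y u"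
    using pos base by (metis Diff_iff insert_iff less_numeral_extra(1) empty_iff less_eq_real_def)+
  obtain X Y where XY: "x p < X" "X < x q" "0 < Y"
    and below: "\<forall>C a b E m. A @ [p] = C @ a # b # E \<or> q # B = C @ a # b # E \<longrightarrow> line_above x y U a b m \<longrightarrow>
        Y < y a + m * (X - x a)"
    and above: "\<forall>C a b E m. p # xs @ [q] = C @ a # b # E \<longrightarrow> line_above x y U a b m \<longrightarrow> y a + m * (X - x a) < Y"
    and pv: "\<exists>m. Y = y p + m * (X - x p) \<and> (\<forall>u\<in>U - {p}. y u < y p + m * (x u - x p))"
    and vq: "\<exists>m. Y = y q + m * (X - x q) \<and> (\<forall>u\<in>U - {q}. y u < y q + m * (x u - x q))"
    by (rule place_vertex[OF ws_def wsU inv(3,4) sorted chain x01])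
  have pqU: "p \<in> U" "q \<in> U" using wsU unfolding ws_def by auto
  have ysU: "set ys \<subseteq> U" using wsU unfolding ws_def ys_def by auto
  have edge: "\<exists>a b m. e = {a, b} \<and> x a < x b \<and> line_above x y U a b m \<and> y a + m * (X - x a) < Y"
    if e0: "e \<in> ledges ys" for e
  proof -
    obtain C a b E where e: "ys = C @ a # b # E" "e = {a, b}" using e0 unfolding ledges_split by blast
    then have wsab: "ws = (A @ C) @ a # b # E @ B" unfolding ws_def ys_def
      by (metis append.assoc append_Cons append_Nil)
    obtain m where "line_above x y U a b m" using chain[OF wsab] by auto
    moreover have "x a < x b" using sorted wsab by (auto simp: sorted_wrt_append)
    ultimately show ?thesis using above e unfolding ys_def by blast
  qed
  have finL: "finite (ledges ys)" using finite_subset[of "ledges ys" "Pow (set ys)"] ledges_subset by blast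
  have ev1: "\<forall>\<^sub>F Z in at_top. \<forall>e\<in>ledges ys. \<exists>\<alpha> \<beta> \<delta>. (\<forall>u\<in>e. z u = \<alpha> * x u + \<beta> * y u + \<delta>) \<and>
      Z = \<alpha> * X + \<beta> * Y + \<delta> \<and> (\<forall>u\<in>U - e. \<alpha> * x u + \<beta> * y u + \<delta> < z u)"
  proof (rule eventually_ball_finite[OF finL], rule ballI)
    fix e assume "e \<in> ledges ys"
    then obtain a b m where e: "e = {a, b}" "x a < x b" "line_above x y U a b m" "y a + m * (X - x a) < Y"
      using edge by blast
    show "\<forall>\<^sub>F Z in at_top. \<exists>\<alpha> \<beta> \<delta>. (\<forall>u\<in>e. z u = \<alpha> * x u + \<beta> * y u + \<delta>) \<and>
      Z = \<alpha> * X + \<beta> * Y + \<delta> \<and> (\<forall>u\<in>U - e. \<alpha> * x u + \<beta> * y u + \<delta> < z u)"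
      unfolding e(1) by (rule plane_through_new_vertex[OF e(3,2,4) inv(1)])
  qed
  have finD: "finite D" using inv(1) finite_UnionD unfolding U_def by blast
  have ev2: "\<forall>\<^sub>F Z in at_top. \<forall>t\<in>D. \<exists>\<alpha> \<beta> \<delta>. (\<forall>u\<in>t. z u = \<alpha> * x u + \<beta> * y u + \<delta>) \<and>
        (\<forall>u\<in>U - t. \<alpha> * x u + \<beta> * y u + \<delta> < z u) \<and> \<alpha> * X + \<beta> * Y + \<delta> < Z"
  proof (rule eventually_ball_finite[OF finD], rule ballI)
    fix t assume "t \<in> D"
    then obtain \<alpha> \<beta> \<delta> where "\<forall>u\<in>t. z u = \<alpha> * x u + \<beta> * y u + \<delta>" "\<forall>u\<in>U - t. \<alpha> * x u + \<beta> * y u + \<delta> < z u"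
      using plane by blast
    then show "\<forall>\<^sub>F Z in at_top. \<exists>\<alpha> \<beta> \<delta>. (\<forall>u\<in>t. z u = \<alpha> * x u + \<beta> * y u + \<delta>) \<and>
        (\<forall>u\<in>U - t. \<alpha> * x u + \<beta> * y u + \<delta> < z u) \<and> \<alpha> * X + \<beta> * Y + \<delta> < Z"
      by (intro eventually_mono[OF eventually_gt_at_top[of "\<alpha> * X + \<beta> * Y + \<delta>"]]
            exI[of _ \<alpha>] exI[of _ \<beta>] exI[of _ \<delta>] conjI)
  qed
  obtain Z where Z1: "\<forall>e\<in>ledges ys. \<exists>\<alpha> \<beta> \<delta>. (\<forall>u\<in>e. z u = \<alpha> * x u + \<beta> * y u + \<delta>) \<and>
      Z = \<alpha> * X + \<beta> * Y + \<delta> \<and> (\<forall>u\<in>U - e. \<alpha> * x u + \<beta> * y u + \<delta> < z u)"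
    and Z2: "\<forall>t\<in>D. \<exists>\<alpha> \<beta> \<delta>. (\<forall>u\<in>t. z u = \<alpha> * x u + \<beta> * y u + \<delta>) \<and>
        (\<forall>u\<in>U - t. \<alpha> * x u + \<beta> * y u + \<delta> < z u) \<and> \<alpha> * X + \<beta> * Y + \<delta> < Z"
    using eventually_happens'[OF trivial_limit_at_top_linorder eventually_conj[OF ev1 ev2]]
    by (elim exE conjE) (rule that)
  define x' y' z' where "x' = x(w := X)" "y' = y(w := Y)" "z' = z(w := Z)"
  have old: "x' u = x u" "y' u = y u" "z' u = z u" if "u \<in> U" for u
    using that w unfolding x'_y'_z'_def by auto
  have new: "x' w = X" "y' w = Y" "z' w = Z" unfolding x'_y'_z'_def by auto
  \<comment> \<open>A line that passes strictly above the new point still bounds the enlarged vertex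
    set; by \<open>below\<close> this covers all boundary edges that remain.\<close>
  have line_old: "line_above x' y' (insert w U) a b m"
    if "line_above x y U a b m" "a \<in> U" "b \<in> U" "Y < y a + m * (X - x a)" for a b m
    using that unfolding line_above_def by (auto simp: old new)
  have "convex_lift v1 v2 (D \<union> P) ws' x' y' z'"
    unfolding convex_lift_def Let_def U'
  proof (intro conjI)
    show "x' v1 = 0" "y' v1 = 0" "z' v1 = 0" "x' v2 = 1" "y' v2 = 0" "z' v2 = 0"
      using base old v12U by auto
    have "0 \<le> x p" "x q \<le> 1" using pos pqU base by (metis Diff_iff insert_iff empty_iff less_eq_real_def zero_le_one)+
    then show "\<forall>u\<in>insert w U - {v1, v2}. 0 < x' u \<and> x' u < 1 \<and> 0 < y' u"
      using pos XY wv by (auto simp: old new)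
    have "\<forall>a\<in>set ws. x' a = x a" using old wsU by auto
    moreover have "\<forall>a\<in>set A. x a < X" "\<forall>b\<in>set B. X < x b"
      using sorted XY unfolding ws_def by (auto simp: sorted_wrt_append intro: less_trans)
    moreover have "sorted_wrt (\<lambda>a b. x' a < x' b) ws"
    proof (rule sorted_wrt_mono_rel[OF _ sorted])
      fix a b assume ab: "a \<in> set ws" "b \<in> set ws" "x a < x b"
      then have "a \<in> U" "b \<in> U" using wsU by auto
      then show "x' a < x' b" using ab(3) by (simp add: old)
    qed
    ultimately show "sorted_wrt (\<lambda>a b. x' a < x' b) ws'"
      using XY new unfolding ws_def ws'_def by (auto simp: sorted_wrt_append)
    show "\<forall>C a b E. ws' = C @ a # b # E \<longrightarrow> (\<exists>m. line_above x' y' (insert w U) a b m)"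
    proof (intro allI impI)
      fix C a b E assume e: "ws' = C @ a # b # E"
      consider E0 where "A @ [p] = C @ a # b # E0" | "a = p" "b = w" | "a = w" "b = q"
        | C0 where "q # B = C0 @ a # b # E"
      proof -
        have "(A @ [p]) @ w # q # B = C @ a # b # E" using e unfolding ws'_def by simp
        then consider us where "A @ [p] = C @ us" "us @ w # q # B = a # b # E"
          | us where "A @ [p] @ us = C" "w # q # B = us @ a # b # E"
          unfolding append_eq_append_conv2 by auto
        then show ?thesis
        proof cases
          case 1
          show ?thesis
          proof (cases us)
            case Nil
            then show ?thesis using 1 that by auto
          next
            case (Cons u us')
            then show ?thesis using 1 that by (cases us') auto
          qed
        next
          case 2
          show ?thesis
          proof (cases us)
            case Nil
            then show ?thesis using 2 that by auto
          next
            case (Cons u us')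
            then show ?thesis using 2 that by auto
          qed
        qed
      qed
      then show "\<exists>m. line_above x' y' (insert w U) a b m"
      proof cases
        case 1
        then have "ws = C @ a # b # E0 @ xs @ q # B" unfolding ws_def
          by (metis append.assoc append_Cons append_Nil)
        moreover from this obtain m where "line_above x y U a b m" using chain by blast
        ultimately show ?thesis using line_old[of a b m] below 1 wsU by auto
      next
        case 2
        then show ?thesis using pv pqU w unfolding line_above_def by (auto simp: old new)
      next
        case 3
        obtain m where m: "Y = y q + m * (X - x q)" "\<forall>u\<in>U - {q}. y u < y q + m * (x u - x q)" using vq by auto
        have eq: "Y + m * (x u - X) = y q + m * (x u - x q)" for u
          unfolding m(1) by (simp add: algebra_simps)
        have "y u < Y + m * (x u - X)" if "u \<in> U - {q}" for u
          unfolding eq using m that by blast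
        moreover have "y q = Y + m * (x q - X)" unfolding eq by simp
        ultimately have "line_above x' y' (insert w U) w q m"
          using pqU w unfolding line_above_def by (auto simp: old new)
        then show ?thesis using 3 by auto
      next
        case 4
        then have "ws = (A @ p # xs @ C0) @ a # b # E" unfolding ws_def by simp
        moreover from this obtain m where "line_above x y U a b m" using chain by blast
        ultimately show ?thesis using line_old[of a b m] below 4 wsU by auto
      qed
    qed
    show "\<forall>t\<in>D \<union> P. \<exists>\<alpha> \<beta> \<delta>. (\<forall>u\<in>t. z' u = \<alpha> * x' u + \<beta> * y' u + \<delta>) \<and>
        (\<forall>u\<in>insert w U - t. \<alpha> * x' u + \<beta> * y' u + \<delta> < z' u)"
    proof
      fix t assume "t \<in> D \<union> P"
      then show "\<exists>\<alpha> \<beta> \<delta>. (\<forall>u\<in>t. z' u = \<alpha> * x' u + \<beta> * y' u + \<delta>) \<and>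
        (\<forall>u\<in>insert w U - t. \<alpha> * x' u + \<beta> * y' u + \<delta> < z' u)"
      proof
        assume t: "t \<in> D"
        then have "t \<subseteq> U" unfolding U_def by auto
        obtain \<alpha> \<beta> \<delta> where *: "\<forall>u\<in>t. z u = \<alpha> * x u + \<beta> * y u + \<delta>"
          "\<forall>u\<in>U - t. \<alpha> * x u + \<beta> * y u + \<delta> < z u" "\<alpha> * X + \<beta> * Y + \<delta> < Z"
          using Z2 t by blast
        then show ?thesis using \<open>t \<subseteq> U\<close>
          by (intro exI[of _ \<alpha>] exI[of _ \<beta>] exI[of _ \<delta>]) (auto simp: old new subset_iff)
      next
        assume "t \<in> P"
        then obtain e where e: "e \<in> ledges ys" "t = insert w e" unfolding P_def by auto
        then have "e \<subseteq> U" using ledges_subset ysU by blast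
        obtain \<alpha> \<beta> \<delta> where *: "\<forall>u\<in>e. z u = \<alpha> * x u + \<beta> * y u + \<delta>"
          "\<forall>u\<in>U - e. \<alpha> * x u + \<beta> * y u + \<delta> < z u" "Z = \<alpha> * X + \<beta> * Y + \<delta>"
          using Z1 e by blast
        then show ?thesis using \<open>e \<subseteq> U\<close> e w
          by (intro exI[of _ \<alpha>] exI[of _ \<beta>] exI[of _ \<delta>]) (auto simp: old new subset_iff)
      qed
    qed
    show "\<forall>t\<in>D \<union> P. \<exists>a b c. t = {a, b, c} \<and> (x' b - x' a) * (y' c - y' a) \<noteq> (x' c - x' a) * (y' b - y' a)"
    proof
      fix t assume "t \<in> D \<union> P"
      then show "\<exists>a b c. t = {a, b, c} \<and> (x' b - x' a) * (y' c - y' a) \<noteq> (x' c - x' a) * (y' b - y' a)"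
      proof
        assume t: "t \<in> D"
        then have "t \<subseteq> U" unfolding U_def by auto
        obtain a b c where "t = {a, b, c}" "(x b - x a) * (y c - y a) \<noteq> (x c - x a) * (y b - y a)"
          using nondeg t by blast
        then show ?thesis using \<open>t \<subseteq> U\<close> old
          by (intro exI[of _ a] exI[of _ b] exI[of _ c]) auto
      next
        assume "t \<in> P"
        then obtain e where e: "e \<in> ledges ys" "t = insert w e" unfolding P_def by auto
        then have "e \<subseteq> U" using ledges_subset ysU by blast
        obtain a b m where ab: "e = {a, b}" "x a < x b" "line_above x y U a b m" "y a + m * (X - x a) < Y"
          using edge e by blast
        have "y b - y a = m * (x b - x a)" using ab unfolding line_above_def by auto
        moreover have "(x b - x a) * (m * (X - x a)) < (x b - x a) * (Y - y a)"
          using ab by (intro mult_strict_left_mono) auto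
        moreover have "(X - x a) * (m * (x b - x a)) = (x b - x a) * (m * (X - x a))"
          by (simp add: algebra_simps)
        ultimately have "(X - x a) * (y b - y a) \<noteq> (x b - x a) * (Y - y a)"
          by (metis less_irrefl)
        moreover have "t = {a, b, w}" using e ab by auto
        ultimately show ?thesis using \<open>e \<subseteq> U\<close> ab
          by (intro exI[of _ a] exI[of _ b] exI[of _ w]) (auto simp: old new)
      qed
    qed
  qed
  then show ?case unfolding P_def ys_def ws'_def by blast
qed

text \<open>The outer triangle is supported from above by the plane
  \<open>z = (z c / y c) * y\<close>. The shadow of any other vertex \<open>u\<close> is a strict
  convex combination of those of \<open>a\<close>, \<open>b\<close>, \<open>c\<close>. A lower plane
  of a triangle at \<open>u\<close> has height \<open>z u\<close> there, and at the three corners it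
  is nowhere above and somewhere below the outer plane.\<close>

lemma fan_disc_supporting_planes:
  assumes disc: "fan_disc a b D [a, c, b]" and out: "{a, b, c} \<notin> D" and ac: "a \<noteq> c" "b \<noteq> c"
  obtains x y z :: "'a \<Rightarrow> real" where
    "\<forall>t\<in>insert {a, b, c} D. \<exists>\<alpha> \<beta> \<gamma> \<delta>. (\<forall>u\<in>t. \<alpha> * x u + \<beta> * y u + \<gamma> * z u = \<delta>) \<and>
        (\<forall>u\<in>\<Union>D \<union> {a, b, c} - t. \<alpha> * x u + \<beta> * y u + \<gamma> * z u < \<delta>)"
    "\<forall>t\<in>insert {a, b, c} D.
        \<exists>a b c. t = {a, b, c} \<and> (x b - x a) * (y c - y a) \<noteq> (x c - x a) * (y b - y a)"
proof -
  define U where "U = \<Union>D \<union> set [a, c, b]"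
  have U: "\<Union>D \<union> {a, b, c} = U" unfolding U_def by auto
  obtain x y z where "convex_lift a b D [a, c, b] x y z"
    using fan_disc_convex_lift[OF disc] by blast
  then have base: "x a = 0" "y a = 0" "z a = 0" "x b = 1" "y b = 0" "z b = 0"
    and pos': "\<forall>u\<in>U - {a, b}. 0 < x u \<and> x u < 1 \<and> 0 < y u"
    and chain': "\<forall>A d e B. [a, c, b] = A @ d # e # B \<longrightarrow> (\<exists>m. line_above x y U d e m)"
    and plane: "\<forall>t\<in>D. \<exists>\<alpha> \<beta> \<delta>. (\<forall>u\<in>t. z u = \<alpha> * x u + \<beta> * y u + \<delta>) \<and>
        (\<forall>u\<in>U - t. \<alpha> * x u + \<beta> * y u + \<delta> < z u)"
    and nondeg: "\<forall>t\<in>D. \<exists>a b c. t = {a, b, c} \<and> (x b - x a) * (y c - y a) \<noteq> (x c - x a) * (y b - y a)"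
    unfolding convex_lift_def Let_def U_def[symmetric] by - (elim conjE, assumption)+
  note pos = pos'[rule_format] and chain = chain'[rule_format]
  have abc: "a \<in> U" "b \<in> U" "c \<in> U" unfolding U_def by auto
  have c: "0 < x c" "x c < 1" "0 < y c" using pos[of c] abc ac by auto
  obtain m1 where m1: "line_above x y U a c m1" using chain[of "[]" a c "[b]"] by auto
  obtain m2 where m2: "line_above x y U c b m2" using chain[of "[a]" c b "[]"] by auto
  have y1: "y c = m1 * x c" using m1 base unfolding line_above_def by auto
  have y2: "y c = m2 * (x c - 1)" using m2 base unfolding line_above_def by (auto simp: algebra_simps)
  have outer: "z u < z c * y u / y c" if u: "u \<in> U - {a, b, c}" for u
  proof -
    have yu: "0 < y u" using pos u by auto
    have l1: "y u < m1 * x u" using m1 u base unfolding line_above_def by auto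
    have l2: "y u < m2 * (x u - 1)" using m2 u base unfolding line_above_def by (auto simp: algebra_simps)
    define l where "l = y u / y c"
    have l: "0 < l" "y u = l * y c" unfolding l_def using yu c by auto
    have "l * x c * m1 < m1 * x u" using l1 l y1 by (auto simp: algebra_simps)
    moreover have "0 < m1" using y1 c by (metis zero_less_mult_pos2)
    ultimately have lx: "l * x c < x u" by (auto simp: algebra_simps)
    have "m2 * (l * (x c - 1)) < m2 * (x u - 1)" using l2 l y2 by (auto simp: algebra_simps)
    moreover have "m2 < 0"
    proof (rule ccontr)
      assume "\<not> m2 < 0"
      then have "m2 * (x c - 1) \<le> 0" using c by (intro mult_nonneg_nonpos) auto
      then show False using y2 c by linarith
    qed
    ultimately have lx1: "x u - 1 < l * (x c - 1)" using mult_less_cancel_left_neg by blast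
    obtain t where t: "t \<in> D" "u \<in> t" using u unfolding U_def by auto
    obtain \<alpha> \<beta> \<delta> where L: "\<forall>u\<in>t. z u = \<alpha> * x u + \<beta> * y u + \<delta>" "\<forall>u\<in>U - t. \<alpha> * x u + \<beta> * y u + \<delta> < z u"
      using plane t by blast
    have le: "\<alpha> * x v + \<beta> * y v + \<delta> \<le> z v" if "v \<in> U" for v
      using L that by (cases "v \<in> t") (auto intro: less_imp_le)
    have d1: "\<delta> \<le> 0" "\<alpha> + \<delta> \<le> 0" "\<alpha> * x c + \<beta> * y c + \<delta> \<le> z c"
      using le[of a] le[of b] le[of c] abc base by auto
    \<comment> \<open>This makes one of the three corner inequalities strict.\<close>
    have "\<not> {a, b, c} \<subseteq> t"
    proof
      assume s: "{a, b, c} \<subseteq> t"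
      obtain d e f where "t = {d, e, f}" using nondeg t by blast
      then have "card t \<le> 3" "finite t" by (auto simp: card_insert_if)
      moreover have "card {a, b, c} = 3" using ac fan_disc_finite[OF disc] by auto
      ultimately have "{a, b, c} = t" using s by (intro card_seteq) auto
      then show False using out t by auto
    qed
    then have d2: "\<delta> < 0 \<or> \<alpha> + \<delta> < 0 \<or> \<alpha> * x c + \<beta> * y c + \<delta> < z c"
      using L(2)[rule_format, of a] L(2)[rule_format, of b] L(2)[rule_format, of c] abc base by auto
    \<comment> \<open>\<open>l1\<close>, \<open>l2\<close> and \<open>l\<close> are the barycentric
      coordinates of the shadow of \<open>u\<close> with respect to \<open>a\<close>,
      \<open>b\<close>, \<open>c\<close>. The last is positive because \<open>y u\<close> is, the
      others because \<open>u\<close> lies below the lines \<open>c b\<close> and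
      \<open>a c\<close>.\<close>
    define l2 where "l2 = x u - l * x c"
    define l1 where "l1 = 1 - l - l2"
    have l12: "0 < l2" "0 < l1" using lx lx1 unfolding l2_def l1_def by (auto simp: algebra_simps)
    have "z u = \<alpha> * x u + \<beta> * y u + \<delta>" using L t by auto
    also have "\<dots> = l * (\<alpha> * x c + \<beta> * y c + \<delta>) + l2 * (\<alpha> + \<delta>) + l1 * \<delta>"
      unfolding l1_def l2_def l(2) by (simp add: algebra_simps)
    also have "\<dots> < l * z c"
    proof -
      have "l * (\<alpha> * x c + \<beta> * y c + \<delta>) \<le> l * z c" "l2 * (\<alpha> + \<delta>) \<le> 0" "l1 * \<delta> \<le> 0"
        using d1 l l12 by (auto intro: mult_left_mono mult_nonneg_nonpos)
      moreover have "l * (\<alpha> * x c + \<beta> * y c + \<delta>) < l * z c \<or> l2 * (\<alpha> + \<delta>) < 0 \<or> l1 * \<delta> < 0"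
        using d2 l l12 by (auto intro: mult_strict_left_mono mult_pos_neg)
      ultimately show ?thesis by linarith
    qed
    finally show ?thesis unfolding l_def by (simp add: mult.commute)
  qed
  show ?thesis
  proof (rule that[of x y z]; rule ballI)
    fix t assume "t \<in> insert {a, b, c} D"
    then have "\<exists>\<alpha> \<beta> \<gamma> \<delta>. (\<forall>u\<in>t. \<alpha> * x u + \<beta> * y u + \<gamma> * z u = \<delta>) \<and>
        (\<forall>u\<in>U - t. \<alpha> * x u + \<beta> * y u + \<gamma> * z u < \<delta>)"
    proof
      assume t: "t = {a, b, c}"
      \<comment> \<open>The outer triangle faces upwards, hence the coefficient 1 of
        \<open>z\<close>; the triangles of \<open>D\<close> face downwards and take -1.\<close>
      have "0 * x u + (- z c / y c) * y u + 1 * z u < 0" if "u \<in> U - t" for u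
        using outer[of u] that t by simp
      moreover have "0 * x u + (- z c / y c) * y u + 1 * z u = 0" if "u \<in> t" for u
        using that t base c by auto
      ultimately show ?thesis by blast
    next
      assume "t \<in> D"
      then obtain \<alpha> \<beta> \<delta> where L: "\<forall>u\<in>t. z u = \<alpha> * x u + \<beta> * y u + \<delta>" "\<forall>u\<in>U - t. \<alpha> * x u + \<beta> * y u + \<delta> < z u"
        using plane by blast
      have "\<alpha> * x u + \<beta> * y u + (- 1) * z u = - \<delta>" if "u \<in> t" for u
        using bspec[OF L(1) that] by simp
      moreover have "\<alpha> * x u + \<beta> * y u + (- 1) * z u < - \<delta>" if "u \<in> U - t" for u
        using bspec[OF L(2) that] by simp
      ultimately show ?thesis by blast
    qed
    then show "\<exists>\<alpha> \<beta> \<gamma> \<delta>. (\<forall>u\<in>t. \<alpha> * x u + \<beta> * y u + \<gamma> * z u = \<delta>) \<and>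
        (\<forall>u\<in>\<Union>D \<union> {a, b, c} - t. \<alpha> * x u + \<beta> * y u + \<gamma> * z u < \<delta>)" unfolding U .
  next
    fix t assume "t \<in> insert {a, b, c} D"
    then show "\<exists>a b c. t = {a, b, c} \<and> (x b - x a) * (y c - y a) \<noteq> (x c - x a) * (y b - y a)"
    proof
      assume "t = {a, b, c}"
      then show ?thesis using base c by (intro exI[of _ a] exI[of _ b] exI[of _ c]) auto
    qed (use nondeg in blast)
  qed
qed

section \<open>Simplicial complexes homeomorphic to the sphere\<close>

abbreviation vtx :: "'a \<Rightarrow> 'a \<Rightarrow>\<^sub>0 real" where
  "vtx v \<equiv> Poly_Mapping.single v 1"

lemma lookup_scaleR: "Poly_Mapping.lookup (r *\<^sub>R x) v = r * Poly_Mapping.lookup x (v :: 'a)"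
  for x :: "'a \<Rightarrow>\<^sub>0 real"
proof -
  have "finite {i. r *\<^sub>R Poly_Mapping.lookup x i \<noteq> 0}"
    by (rule finite_subset[OF _ finite_keys[of x]]) (auto simp: in_keys_iff)
  then show ?thesis unfolding scaleR_poly_mapping_def by simp
qed

lemma lookup_vtx: "Poly_Mapping.lookup (vtx v) w = (if w = v then 1 else 0)"
  by (simp add: lookup_single when_def)

lemmas lookup_simps = lookup_scaleR lookup_vtx lookup_add lookup_minus lookup_sum

lemma abs_lookup_le_norm: "\<bar>Poly_Mapping.lookup x v\<bar> \<le> norm (x :: 'a \<Rightarrow>\<^sub>0 real)"
proof (cases "v \<in> Poly_Mapping.keys x")
  case True
  have "norm x = (\<Sum>n\<in>Poly_Mapping.keys x. \<bar>Poly_Mapping.lookup x n\<bar>)"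
    by (simp add: norm_poly_mapping_def dist_poly_mapping_def)
  then show ?thesis
    using member_le_sum[of v "Poly_Mapping.keys x" "\<lambda>n. \<bar>Poly_Mapping.lookup x n\<bar>"] True by simp
qed (simp add: in_keys_iff)

lemma bounded_linear_lookup: "bounded_linear (\<lambda>x :: 'a \<Rightarrow>\<^sub>0 real. Poly_Mapping.lookup x v)"
  by (rule bounded_linear_intro[of _ 1]) (auto simp: lookup_add lookup_scaleR abs_lookup_le_norm)

lemma continuous_on_lookup [continuous_intros]:
  "continuous_on A f \<Longrightarrow> continuous_on A (\<lambda>x. Poly_Mapping.lookup (f x :: 'a \<Rightarrow>\<^sub>0 real) v)"
  by (rule bounded_linear.continuous_on[OF bounded_linear_lookup])

lemma inj_vtx: "inj_on vtx A"
  by (rule inj_onI) (metis lookup_vtx zero_neq_one)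

lemma hull_vtx_iff:
  assumes "finite \<sigma>"
  shows "x \<in> convex hull (vtx ` \<sigma>) \<longleftrightarrow>
     Poly_Mapping.keys x \<subseteq> \<sigma> \<and> (\<forall>v. 0 \<le> Poly_Mapping.lookup x v) \<and> sum (Poly_Mapping.lookup x) \<sigma> = 1"
proof
  assume "x \<in> convex hull (vtx ` \<sigma>)"
  then obtain u where u: "\<forall>y\<in>vtx ` \<sigma>. 0 \<le> u y" "sum u (vtx ` \<sigma>) = 1" "sum (\<lambda>y. u y *\<^sub>R y) (vtx ` \<sigma>) = x"
    using convex_hull_finite[of "vtx ` \<sigma>"] assms by auto
  have l: "Poly_Mapping.lookup x w = (if w \<in> \<sigma> then u (vtx w) else 0)" for w
  proof -
    have "x = (\<Sum>v\<in>\<sigma>. u (vtx v) *\<^sub>R vtx v)"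
      using u(3) sum.reindex[OF inj_vtx, of "\<lambda>y. u y *\<^sub>R y" \<sigma>] by simp
    then have "Poly_Mapping.lookup x w = (\<Sum>v\<in>\<sigma>. if w = v then u (vtx v) else 0)"
      by (simp add: lookup_simps if_distrib cong: if_cong)
    then show ?thesis using assms by simp
  qed
  have "sum (Poly_Mapping.lookup x) \<sigma> = 1"
    using u(2) sum.reindex[OF inj_vtx, of u \<sigma>] by (simp add: l)
  then show "Poly_Mapping.keys x \<subseteq> \<sigma> \<and> (\<forall>v. 0 \<le> Poly_Mapping.lookup x v) \<and> sum (Poly_Mapping.lookup x) \<sigma> = 1"
    using u(1) by (auto simp: l in_keys_iff split: if_splits)
next
  assume a: "Poly_Mapping.keys x \<subseteq> \<sigma> \<and> (\<forall>v. 0 \<le> Poly_Mapping.lookup x v) \<and> sum (Poly_Mapping.lookup x) \<sigma> = 1"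
  have "x = (\<Sum>v\<in>\<sigma>. Poly_Mapping.lookup x v *\<^sub>R vtx v)"
  proof (rule poly_mapping_eqI)
    fix w
    have "Poly_Mapping.lookup (\<Sum>v\<in>\<sigma>. Poly_Mapping.lookup x v *\<^sub>R vtx v) w =
        (\<Sum>v\<in>\<sigma>. if w = v then Poly_Mapping.lookup x v else 0)"
      by (simp add: lookup_simps if_distrib cong: if_cong)
    also have "\<dots> = Poly_Mapping.lookup x w" using a assms by (auto simp: in_keys_iff)
    finally show "Poly_Mapping.lookup x w = Poly_Mapping.lookup (\<Sum>v\<in>\<sigma>. Poly_Mapping.lookup x v *\<^sub>R vtx v) w" by simp
  qed
  also have "\<dots> \<in> convex hull (vtx ` \<sigma>)"
    using assms a by (intro convex_sum) (auto intro: hull_inc)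
  finally show "x \<in> convex hull (vtx ` \<sigma>)" .
qed

text \<open>A point of both simplices has its support in \<open>\<sigma> \<inter> \<tau>\<close>.
  This is what keeps edge polygons free of self-intersections.\<close>

lemma hull_vtx_Int:
  assumes "finite \<sigma>" "finite \<tau>" "\<sigma> \<inter> \<tau> \<subseteq> {v}"
  shows "convex hull (vtx ` \<sigma>) \<inter> convex hull (vtx ` \<tau>) \<subseteq> {vtx v}"
proof
  fix x assume x: "x \<in> convex hull (vtx ` \<sigma>) \<inter> convex hull (vtx ` \<tau>)"
  then have k: "Poly_Mapping.keys x \<subseteq> {v}" and s: "sum (Poly_Mapping.lookup x) \<sigma> = 1"
    using assms by (auto simp: hull_vtx_iff)
  have 0: "Poly_Mapping.lookup x w = 0" if "w \<noteq> v" for w using k that by (auto simp: in_keys_iff)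
  have "v \<in> \<sigma>" using s 0 by (metis sum.neutral zero_neq_one)
  then have "Poly_Mapping.lookup x v = 1"
    using s sum.remove[OF assms(1), of v "Poly_Mapping.lookup x"] 0 by simp
  then have "x = vtx v" using 0 by (intro poly_mapping_eqI) (auto simp: lookup_vtx)
  then show "x \<in> {vtx v}" by simp
qed

lemma exists_polygonal_arc:
  assumes "distinct zs" "2 \<le> length zs"
  shows "\<exists>g. arc g \<and> pathstart g = vtx (hd zs) \<and> pathfinish g = vtx (last zs) \<and>
     path_image g = (\<Union>e\<in>ledges zs. convex hull (vtx ` e))"
  using assms
proof (induction zs rule: ledges.induct)
  case (1 a b xs)
  have ab: "vtx a \<noteq> vtx b" using 1 inj_onD[OF inj_vtx[of UNIV], of a b] by auto
  show ?case
  proof (cases xs)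
    case Nil
    then show ?thesis using ab
      by (intro exI[of _ "linepath (vtx a) (vtx b)"]) (auto simp: segment_convex_hull)
  next
    case (Cons c ys)
    then obtain g where g: "arc g" "pathstart g = vtx b" "pathfinish g = vtx (last (b # xs))"
      "path_image g = (\<Union>e\<in>ledges (b # xs). convex hull (vtx ` e))" using 1 by auto
    have im: "path_image (linepath (vtx a) (vtx b)) = convex hull (vtx ` {a, b})"
      by (simp add: segment_convex_hull)
    have "convex hull (vtx ` {a, b}) \<inter> convex hull (vtx ` e) \<subseteq> {vtx b}" if "e \<in> ledges (b # xs)" for e
    proof (rule hull_vtx_Int)
      have "e \<subseteq> set (b # xs)" using ledges_subset[OF that] .
      then show "finite e" "{a, b} \<inter> e \<subseteq> {b}" using 1 finite_subset by auto
    qed simp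
    then have "path_image (linepath (vtx a) (vtx b)) \<inter> path_image g \<subseteq> {pathstart g}"
      unfolding im g by blast
    then have "arc (linepath (vtx a) (vtx b) +++ g)"
      using g ab by (intro arc_join) auto
    moreover have "path_image (linepath (vtx a) (vtx b) +++ g) = (\<Union>e\<in>ledges (a # b # xs). convex hull (vtx ` e))"
      using g im by (simp add: path_image_join)
    ultimately show ?thesis using g
      by (intro exI[of _ "linepath (vtx a) (vtx b) +++ g"]) auto
  qed
qed auto

lemma exists_polygonal_loop:
  assumes zs: "distinct zs" "3 \<le> length zs"
  shows "\<exists>c. simple_path c \<and> pathfinish c = pathstart c \<and>
     path_image c = (\<Union>e\<in>insert {last zs, hd zs} (ledges zs). convex hull (vtx ` e))"
proof -
  obtain g where g: "arc g" "pathstart g = vtx (hd zs)" "pathfinish g = vtx (last zs)"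
     "path_image g = (\<Union>e\<in>ledges zs. convex hull (vtx ` e))" using exists_polygonal_arc[of zs] zs by auto
  obtain a xs where zs1: "zs = a # xs" using zs by (cases zs) auto
  have hl: "hd zs \<noteq> last zs" using zs unfolding zs1 by (cases xs rule: rev_cases) auto
  then have vhl: "vtx (last zs) \<noteq> vtx (hd zs)" using inj_onD[OF inj_vtx[of UNIV], of "last zs" "hd zs"] by auto
  let ?l = "linepath (vtx (last zs)) (vtx (hd zs))"
  have im: "path_image ?l = convex hull (vtx ` {last zs, hd zs})"
    by (simp add: segment_convex_hull)
  have "convex hull (vtx ` e) \<inter> convex hull (vtx ` {last zs, hd zs}) \<subseteq> {vtx (hd zs), vtx (last zs)}"
    if e: "e \<in> ledges zs" for e
  proof -
    have c: "card e = 2" using ledges_card[OF zs(1) e] .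
    then have fin: "finite e" using card.infinite by fastforce
    have "e \<noteq> {hd zs, last zs}" using ends_notin_ledges[OF zs] e by auto
    then have "\<not> {hd zs, last zs} \<subseteq> e"
      using c hl fin card_subset_eq[of e "{hd zs, last zs}"] by auto
    then have "e \<inter> {last zs, hd zs} \<subseteq> {hd zs} \<or> e \<inter> {last zs, hd zs} \<subseteq> {last zs}" by auto
    then show ?thesis using hull_vtx_Int[of e "{last zs, hd zs}"] fin by blast
  qed
  then have "path_image g \<inter> path_image ?l \<subseteq> {pathstart g, pathstart ?l}"
    unfolding im g by auto
  then have "simple_path (g +++ ?l)"
    using g vhl by (intro simple_path_join_loop) auto
  then show ?thesis using g im
    by (intro exI[of _ "g +++ ?l"]) (auto simp: path_image_join)
qed

text \<open>Deleting any one point leaves a plane. With the point varying, this gives charts for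
  invariance of domain around every place; with the point chosen off a closed curve, it gives a
  plane for the Jordan curve theorem.\<close>

locale sphere_complex =
  fixes S :: "'a set set"
  assumes cpx: "abstract_complex S"
    and carrier_connected: "connected (carrier_of S)"
    and carrier_nonempty: "carrier_of S \<noteq> {}"
    and chart: "p \<in> carrier_of S \<Longrightarrow> (carrier_of S - {p}) homeomorphic (UNIV :: complex set)"
begin

abbreviation "X \<equiv> carrier_of S"

lemma finS: "finite S" and fin_face: "\<sigma> \<in> S \<Longrightarrow> finite \<sigma>" and down: "\<sigma> \<in> S \<Longrightarrow> \<tau> \<subseteq> \<sigma> \<Longrightarrow> \<tau> \<in> S"
  using cpx unfolding abstract_complex_def by auto

lemma finV: "finite (\<Union>S)" using finS fin_face by auto

lemma carrier_iff:
  "x \<in> X \<longleftrightarrow> Poly_Mapping.keys x \<in> S \<and> (\<forall>v. 0 \<le> Poly_Mapping.lookup x v) \<and> sum (Poly_Mapping.lookup x) (\<Union>S) = 1"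
proof -
  have *: "sum (Poly_Mapping.lookup x) (\<Union>S) = sum (Poly_Mapping.lookup x) \<sigma>"
    if "\<sigma> \<in> S" "Poly_Mapping.keys x \<subseteq> \<sigma>" for \<sigma>
    using that finV by (intro sum.mono_neutral_right) (auto simp: in_keys_iff)
  show ?thesis
  proof
    assume "x \<in> X"
    then obtain \<sigma> where "\<sigma> \<in> S" "x \<in> convex hull (vtx ` \<sigma>)" unfolding carrier_of_def by auto
    then show "Poly_Mapping.keys x \<in> S \<and> (\<forall>v. 0 \<le> Poly_Mapping.lookup x v) \<and> sum (Poly_Mapping.lookup x) (\<Union>S) = 1"
      using * hull_vtx_iff[OF fin_face] down by auto
  next
    assume a: "Poly_Mapping.keys x \<in> S \<and> (\<forall>v. 0 \<le> Poly_Mapping.lookup x v) \<and> sum (Poly_Mapping.lookup x) (\<Union>S) = 1"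
    then have "x \<in> convex hull (vtx ` Poly_Mapping.keys x)"
      using *[of "Poly_Mapping.keys x"] hull_vtx_iff[of "Poly_Mapping.keys x" x] by auto
    then show "x \<in> X" using a unfolding carrier_of_def by auto
  qed
qed

lemma keys_pos: "x \<in> X \<Longrightarrow> v \<in> Poly_Mapping.keys x \<longleftrightarrow> 0 < Poly_Mapping.lookup x v"
  by (metis carrier_iff in_keys_iff less_eq_real_def less_irrefl)

lemma keys_nonempty: "x \<in> X \<Longrightarrow> Poly_Mapping.keys x \<noteq> {}"
  by (metis carrier_iff in_keys_iff empty_iff sum.neutral zero_neq_one)

lemma sum_lookup: "x \<in> X \<Longrightarrow> Poly_Mapping.keys x \<subseteq> \<sigma> \<Longrightarrow> finite \<sigma> \<Longrightarrow> sum (Poly_Mapping.lookup x) \<sigma> = 1"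
proof -
  assume a: "x \<in> X" "Poly_Mapping.keys x \<subseteq> \<sigma>" "finite \<sigma>"
  have "sum (Poly_Mapping.lookup x) (\<Union>S) = sum (Poly_Mapping.lookup x) (Poly_Mapping.keys x)"
    using a finV by (intro sum.mono_neutral_right) (auto simp: in_keys_iff carrier_iff)
  moreover have "sum (Poly_Mapping.lookup x) \<sigma> = sum (Poly_Mapping.lookup x) (Poly_Mapping.keys x)"
    using a by (intro sum.mono_neutral_right) (auto simp: in_keys_iff)
  ultimately show ?thesis using a carrier_iff by auto
qed

lemma keys_singleton: "x \<in> X \<Longrightarrow> Poly_Mapping.keys x = {v} \<Longrightarrow> x = vtx v"
proof -
  assume x: "x \<in> X" "Poly_Mapping.keys x = {v}"
  have "Poly_Mapping.lookup x v = 1" using sum_lookup[OF x(1), of "{v}"] x(2) by simp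
  moreover have "Poly_Mapping.lookup x w = 0" if "w \<noteq> v" for w
    using that x(2) by (metis in_keys_iff singletonD)
  ultimately show "x = vtx v" by (intro poly_mapping_eqI) (simp add: lookup_vtx)
qed

lemma combination_in_carrier:
  assumes "\<sigma> \<in> S" "\<And>v. v \<in> \<sigma> \<Longrightarrow> 0 \<le> c v" "sum c \<sigma> = 1"
  shows "(\<Sum>v\<in>\<sigma>. c v *\<^sub>R vtx v) \<in> X"
proof -
  have "(\<Sum>v\<in>\<sigma>. c v *\<^sub>R vtx v) \<in> convex hull (vtx ` \<sigma>)"
    using assms fin_face by (intro convex_sum) (auto intro: hull_inc)
  then show ?thesis using assms unfolding carrier_of_def by auto
qed

lemma lookup_combination:
  "finite \<sigma> \<Longrightarrow> Poly_Mapping.lookup (\<Sum>v\<in>\<sigma>. c v *\<^sub>R vtx v) w = (if w \<in> \<sigma> then c w else 0)"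
  by (simp add: lookup_simps if_distrib cong: if_cong)

definition bary :: "'a set \<Rightarrow> 'a \<Rightarrow>\<^sub>0 real" where
  "bary \<sigma> = (\<Sum>v\<in>\<sigma>. (1 / card \<sigma>) *\<^sub>R vtx v)"

lemma lookup_bary: "\<sigma> \<in> S \<Longrightarrow> Poly_Mapping.lookup (bary \<sigma>) w = (if w \<in> \<sigma> then 1 / card \<sigma> else 0)"
  unfolding bary_def using lookup_combination[OF fin_face] by simp

lemma bary_in: "\<sigma> \<in> S \<Longrightarrow> \<sigma> \<noteq> {} \<Longrightarrow> bary \<sigma> \<in> X"
  unfolding bary_def using fin_face[of \<sigma>] by (intro combination_in_carrier) auto

lemma keys_bary: "\<sigma> \<in> S \<Longrightarrow> Poly_Mapping.keys (bary \<sigma>) = \<sigma>"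
  using fin_face[of \<sigma>] by (auto simp: in_keys_iff lookup_bary split: if_splits)

lemma vtx_in: "v \<in> \<Union>S \<Longrightarrow> vtx v \<in> X"
  using combination_in_carrier[of "{v}" "\<lambda>_. 1"] down by auto

text \<open>The open star of \<open>\<sigma>\<close>. For a triangle it is the open triangle itself,
  since by \<open>card_face\<close> there are no larger faces.\<close>

definition ost :: "'a set \<Rightarrow> ('a \<Rightarrow>\<^sub>0 real) set" where
  "ost \<sigma> = {x \<in> X. \<sigma> \<subseteq> Poly_Mapping.keys x}"

lemma openin_ost:
  assumes "\<sigma> \<in> S"
  shows "openin (top_of_set X) (ost \<sigma>)"
proof -
  have "openin (top_of_set X) (X \<inter> (\<Inter>v\<in>\<sigma>. {x. 0 < Poly_Mapping.lookup x v}))"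
    using fin_face[OF assms] by (intro openin_open_Int open_INT) (auto intro!: open_Collect_less continuous_intros)
  moreover have "X \<inter> (\<Inter>v\<in>\<sigma>. {x. 0 < Poly_Mapping.lookup x v}) = ost \<sigma>"
    unfolding ost_def using keys_pos by blast
  ultimately show ?thesis by simp
qed

text \<open>The open star is star-shaped about \<open>bary \<sigma>\<close>: moving a point towards
  it never enlarges the support and never loses a vertex of \<open>\<sigma>\<close>.\<close>

lemma connected_ost:
  assumes "\<sigma> \<in> S" "\<sigma> \<noteq> {}"
  shows "connected (ost \<sigma>)"
proof -
  have "starlike (ost \<sigma>)"
    unfolding starlike_def
  proof (intro bexI[of _ "bary \<sigma>"] ballI subsetI)
    show "bary \<sigma> \<in> ost \<sigma>" using assms keys_bary bary_in unfolding ost_def by auto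
    fix x y assume x: "x \<in> ost \<sigma>" and y: "y \<in> closed_segment (bary \<sigma>) x"
    obtain u where u: "0 \<le> u" "u \<le> 1" "y = (1 - u) *\<^sub>R bary \<sigma> + u *\<^sub>R x"
      using y by (auto simp: closed_segment_def)
    have l: "Poly_Mapping.lookup y v = (1 - u) * Poly_Mapping.lookup (bary \<sigma>) v + u * Poly_Mapping.lookup x v" for v
      unfolding u by (simp add: lookup_simps)
    have xX: "x \<in> X" "\<sigma> \<subseteq> Poly_Mapping.keys x" using x unfolding ost_def by auto
    have bX: "bary \<sigma> \<in> X" using bary_in assms by auto
    have nn: "0 \<le> Poly_Mapping.lookup y v" for v
      unfolding l using u xX bX carrier_iff by auto
    have pos: "0 < Poly_Mapping.lookup y v" if "v \<in> \<sigma>" for v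
    proof -
      have b: "0 < Poly_Mapping.lookup (bary \<sigma>) v" "0 < Poly_Mapping.lookup x v"
        using that xX keys_pos bX keys_bary assms by blast+
      show ?thesis unfolding l
      proof (cases "u = 0")
        case False
        then show "0 < (1 - u) * Poly_Mapping.lookup (bary \<sigma>) v + u * Poly_Mapping.lookup x v"
          using b u by (intro add_nonneg_pos) auto
      qed (use b in auto)
    qed
    have "Poly_Mapping.keys y \<subseteq> Poly_Mapping.keys x"
      using xX(2) keys_bary[OF assms(1)] by (auto simp: in_keys_iff l)
    then have "Poly_Mapping.keys y \<in> S" using xX carrier_iff down by blast
    moreover have "sum (Poly_Mapping.lookup y) (\<Union>S) = 1"
      using xX bX unfolding carrier_iff l by (simp add: sum.distrib flip: sum_distrib_left)
    ultimately have "y \<in> X" using nn carrier_iff by auto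
    moreover have "\<sigma> \<subseteq> Poly_Mapping.keys y" using pos by (auto simp: in_keys_iff dest: pos)
    ultimately show "y \<in> ost \<sigma>" unfolding ost_def by auto
  qed
  then show ?thesis by (rule starlike_imp_connected)
qed

section \<open>Invariance of domain in charts\<close>

lemma chart_obtain:
  assumes "p \<in> X"
  obtains \<phi> \<psi> where "homeomorphism (X - {p}) (UNIV :: complex set) \<phi> \<psi>"
  using chart[OF assms] unfolding homeomorphic_def by blast

lemma openin_minus_point: "openin (top_of_set X) (X - {p})"
  by (metis Diff_eq open_Compl closed_singleton openin_open_Int)

lemma chart_open:
  assumes hom: "homeomorphism (X - {p}) (UNIV :: complex set) \<phi> \<psi>"
    and W: "openin (top_of_set X) W" "p \<notin> W"
  shows "open (\<phi> ` W)"
proof -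
  have "W \<subseteq> X - {p}" using W openin_imp_subset by blast
  then have "openin (top_of_set (X - {p})) W"
    using W openin_subset_trans[of X W "X - {p}"] by auto
  then have "openin (top_of_set UNIV) (\<phi> ` W)" by (rule homeomorphism_imp_open_map[OF hom])
  then show ?thesis by (simp only: subtopology_UNIV open_openin)
qed

text \<open>Invariance of domain, read through the chart that omits a point \<open>p\<close> outside
  \<open>W\<close>.\<close>

lemma domain_out:
  assumes W: "openin (top_of_set X) W" "p \<in> X - W"
    and g: "continuous_on W g" "inj_on g W"
  shows "open (g ` W :: complex set)"
proof -
  obtain \<phi> \<psi> where hom: "homeomorphism (X - {p}) (UNIV :: complex set) \<phi> \<psi>"
    using chart_obtain W by blast
  have op: "open (\<phi> ` W)" using chart_open[OF hom W(1)] W by auto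
  have Wsub: "W \<subseteq> X - {p}" using W openin_imp_subset by blast
  then have inv: "\<psi> (\<phi> x) = x" if "x \<in> W" for x using hom that unfolding homeomorphism_def by auto
  then have im: "\<psi> ` \<phi> ` W = W" by force
  have "continuous_on (\<phi> ` W) (g \<circ> \<psi>)"
    using hom g im unfolding homeomorphism_def by (intro continuous_on_compose) (auto intro: continuous_on_subset)
  moreover have "inj_on (g \<circ> \<psi>) (\<phi> ` W)"
    using g inv by (auto simp: inj_on_def)
  ultimately have "open ((g \<circ> \<psi>) ` \<phi> ` W)" using op invariance_of_domain by blast
  then show ?thesis unfolding image_comp[symmetric] im .
qed

text \<open>The counterpart of \<open>domain_out\<close> for maps from the plane into the carrier;
  \<open>p\<close> is now a point that the image misses.\<close>

lemma domain_in:
  assumes f: "continuous_on \<Omega> f" "inj_on f \<Omega>" "f ` \<Omega> \<subseteq> X - {p}" "open (\<Omega> :: complex set)" and p: "p \<in> X"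
  shows "openin (top_of_set X) (f ` \<Omega>)"
proof -
  obtain \<phi> \<psi> where hom: "homeomorphism (X - {p}) (UNIV :: complex set) \<phi> \<psi>"
    using chart_obtain p by blast
  have inv: "\<psi> (\<phi> x) = x" if "x \<in> f ` \<Omega>" for x using hom that f unfolding homeomorphism_def by auto
  have "continuous_on \<Omega> (\<phi> \<circ> f)"
    using hom f unfolding homeomorphism_def by (intro continuous_on_compose) (auto intro: continuous_on_subset)
  moreover have "inj_on (\<phi> \<circ> f) \<Omega>"
    by (rule comp_inj_on[OF f(2)]) (rule inj_on_inverseI[where g = \<psi>, OF inv])
  ultimately have "open ((\<phi> \<circ> f) ` \<Omega>)" using f invariance_of_domain by blast
  then have "openin (top_of_set UNIV) ((\<phi> \<circ> f) ` \<Omega>)" by (simp only: subtopology_UNIV open_openin)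
  then have "openin (top_of_set (X - {p})) (\<psi> ` (\<phi> \<circ> f) ` \<Omega>)"
    using homeomorphism_imp_open_map[OF homeomorphism_symD[OF hom]] by blast
  moreover have "\<psi> ` (\<phi> \<circ> f) ` \<Omega> = f ` \<Omega>" using inv by force
  ultimately show ?thesis using openin_trans openin_minus_point by metis
qed

text \<open>Finite sets do not disconnect connected open sets of the plane. A chart is available as
  soon as a point is missing: one outside \<open>W\<close> if \<open>W\<close> is proper, one of
  \<open>F\<close> if \<open>W\<close> is the whole carrier. If \<open>F\<close> misses the carrier
  as well, nothing is removed.\<close>

lemma connected_minus_finite:
  assumes W: "openin (top_of_set X) W" "connected W" and F: "finite F"
  shows "connected (W - F)"
proof -
  have WX: "W \<subseteq> X" using W openin_imp_subset by blast
  have *: "connected (U - F')" if U: "openin (top_of_set X) U" "U \<subseteq> X - {p}" "p \<in> X" "connected (\<phi> ` U)" "finite F'"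
      and hom: "homeomorphism (X - {p}) (UNIV :: complex set) \<phi> \<psi>" for p U F' \<phi> \<psi>
  proof -
    have "open (\<phi> ` U)" using chart_open[OF hom U(1)] U by auto
    then have "connected (\<phi> ` U - \<phi> ` (F' \<inter> U))"
      using U by (intro connected_open_diff_countable) (auto simp: countable_finite)
    moreover have "\<phi> ` U - \<phi> ` (F' \<inter> U) = \<phi> ` (U - F')"
      using U hom unfolding homeomorphism_def by (auto simp: inj_on_def) (metis subsetD)
    moreover have "(\<lambda>x. \<psi> (\<phi> x)) ` (U - F') = (\<lambda>x. x) ` (U - F')"
      using U hom unfolding homeomorphism_def by (intro image_cong) auto
    then have "\<psi> ` \<phi> ` (U - F') = U - F'" by (simp add: image_image)
    moreover have "continuous_on (\<phi> ` (U - F')) \<psi>"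
      using hom unfolding homeomorphism_def by (auto intro: continuous_on_subset)
    ultimately show ?thesis using connected_continuous_image by metis
  qed
  show ?thesis
  proof (cases "W = X")
    case False
    then obtain p where p: "p \<in> X" "p \<notin> W" using WX by auto
    obtain \<phi> \<psi> where hom: "homeomorphism (X - {p}) (UNIV :: complex set) \<phi> \<psi>" using chart_obtain p by blast
    have sub: "W \<subseteq> X - {p}" using p WX by auto
    then have "continuous_on W \<phi>" using hom unfolding homeomorphism_def by (auto intro: continuous_on_subset)
    then have "connected (\<phi> ` W)" using W connected_continuous_image by blast
    then show ?thesis using *[OF W(1) sub p(1) _ F hom] by auto
  next
    case True
    show ?thesis
    proof (cases "X \<inter> F = {}")
      case True
      then have "W - F = W" using WX by auto
      then show ?thesis using W by simp
    next
      case False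
      then obtain p where p: "p \<in> X" "p \<in> F" by auto
      obtain \<phi> \<psi> where hom: "homeomorphism (X - {p}) (UNIV :: complex set) \<phi> \<psi>" using chart_obtain p by blast
      then have "\<phi> ` (X - {p}) = UNIV" unfolding homeomorphism_def by auto
      then have "connected (\<phi> ` (X - {p}))" by (simp add: convex_connected)
      then have "connected ((X - {p}) - F)" by (rule *[OF openin_minus_point subset_refl p(1) _ F hom])
      moreover have "(X - {p}) - F = W - F" using p True by auto
      ultimately show ?thesis by simp
    qed
  qed
qed

lemma not_openin_singleton: "\<not> openin (top_of_set X) {x}"
proof
  assume o: "openin (top_of_set X) {x}"
  then have "x \<in> X" using openin_imp_subset by blast
  then have "X - {x} \<noteq> {}" using chart[of x] by (metis UNIV_not_empty homeomorphic_empty(1) homeomorphic_sym)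
  then obtain p where "p \<in> X - {x}" by auto
  from domain_out[OF o this, of "\<lambda>_. 0"] show False by (simp add: not_open_singleton)
qed

text \<open>A face with four vertices would contain an open piece of three-space, which a chart
  would embed in the plane, against invariance of dimension.\<close>

lemma card_face:
  assumes "\<sigma> \<in> S"
  shows "card \<sigma> \<le> 3"
proof (rule ccontr)
  assume "\<not> card \<sigma> \<le> 3"
  then obtain \<tau> where \<tau>: "\<tau> \<subseteq> \<sigma>" "card \<tau> = 4" using obtain_subset_with_card_n[of 4 \<sigma>] by auto
  then obtain a \<rho> where r: "\<tau> = insert a \<rho>" "card \<rho> = 3" "a \<notin> \<rho>"
    by (metis card_eq_SucD eval_nat_numeral(2) semiring_norm(26) semiring_norm(27))
  obtain b c d where bcd: "\<rho> = {b, c, d}" "b \<noteq> c" "b \<noteq> d" "c \<noteq> d"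
    using card_3_iff[THEN iffD1, OF r(2)] by blast
  have dist: "a \<noteq> b" "a \<noteq> c" "a \<noteq> d" "b \<noteq> c" "b \<noteq> d" "c \<noteq> d" using bcd r(3) by simp_all
  have "\<tau> = {a, b, c, d}" using r(1) bcd(1) by simp
  then have abcd: "{a, b, c, d} \<in> S" using down[OF assms \<tau>(1)] by simp
  define f where "f = (\<lambda>(r, s, t). r *\<^sub>R vtx a + s *\<^sub>R vtx b + t *\<^sub>R vtx c + (1 - r - s - t) *\<^sub>R vtx d)"
  define \<Omega> where "\<Omega> = {z :: real \<times> real \<times> real. 0 < fst z \<and> 0 < fst (snd z) \<and> 0 < snd (snd z) \<and> fst z + fst (snd z) + snd (snd z) < 1}"
  have op: "open \<Omega>" unfolding \<Omega>_def
    by (intro open_Collect_conj open_Collect_less continuous_intros)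
  have ne: "(1/4, 1/4, 1/4) \<in> \<Omega>" unfolding \<Omega>_def by simp
  have fX: "f z \<in> X" if "z \<in> \<Omega>" for z
  proof -
    define w where "w v = (if v = a then fst z else if v = b then fst (snd z) else if v = c then snd (snd z)
        else 1 - fst z - fst (snd z) - snd (snd z))" for v
    have "(\<Sum>v\<in>{a, b, c, d}. w v *\<^sub>R vtx v) \<in> X"
      using that dist by (intro combination_in_carrier abcd) (auto simp: w_def \<Omega>_def)
    moreover have "(\<Sum>v\<in>{a, b, c, d}. w v *\<^sub>R vtx v) = f z"
      using dist by (auto simp: w_def f_def split_beta)
    ultimately show ?thesis by simp
  qed
  have la: "Poly_Mapping.lookup (f z) a = fst z" "Poly_Mapping.lookup (f z) b = fst (snd z)" "Poly_Mapping.lookup (f z) c = snd (snd z)" for z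
    using dist by (auto simp: f_def split_beta lookup_simps)
  have inj: "inj_on f \<Omega>" by (rule inj_onI) (metis la prod_eqI)
  have p: "vtx a \<in> X" using vtx_in abcd by blast
  obtain \<phi> \<psi> where hom: "homeomorphism (X - {vtx a}) (UNIV :: complex set) \<phi> \<psi>" using chart_obtain p by blast
  have sub: "f ` \<Omega> \<subseteq> X - {vtx a}"
  proof -
    have "f z \<noteq> vtx a" if "z \<in> \<Omega>" for z using la(2)[of z] that dist by (auto simp: \<Omega>_def lookup_vtx)
    then show ?thesis using fX by auto
  qed
  have "continuous_on \<Omega> f" unfolding f_def split_beta by (intro continuous_intros)
  then have "continuous_on \<Omega> (\<phi> \<circ> f)"
    using hom sub unfolding homeomorphism_def by (intro continuous_on_compose) (auto intro: continuous_on_subset)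
  moreover have "inj_on (\<phi> \<circ> f) \<Omega>"
  proof (rule comp_inj_on[OF inj])
    have "inj_on \<phi> (X - {vtx a})" using hom unfolding homeomorphism_def by (metis inj_on_inverseI)
    then show "inj_on \<phi> (f ` \<Omega>)" using sub inj_on_subset by blast
  qed
  ultimately have "DIM(real \<times> real \<times> real) \<le> DIM(complex)"
    using op ne invariance_of_dimension by blast
  then show False by simp
qed

lemma tri_eq_insert:
  assumes "a \<noteq> b" "t \<in> tri S" "{a, b} \<subseteq> t"
  obtains c where "t = {a, b, c}" "c \<noteq> a" "c \<noteq> b"
  using assms card_3_third[of t a b] unfolding tri_def by auto

text \<open>Both bounds come from invariance of domain. With at most one triangle the open star of
  the edge lies to one side of the edge, so no chart can make it open in the plane. With three, two
  of them already form a neighbourhood of the open edge, and the third cannot approach it.\<close>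

lemma edge_in_two_triangles:
  assumes e: "e \<in> S" "card e = 2"
  shows "card {t \<in> tri S. e \<subseteq> t} = 2"
proof -
  obtain a b where ab: "e = {a, b}" "a \<noteq> b" using e by (meson card_2_iff)
  let ?N = "{t \<in> tri S. e \<subseteq> t}"
  have finN: "finite ?N" using finS unfolding tri_def by auto
  have eX: "bary e \<in> X" "Poly_Mapping.keys (bary e) = e" using bary_in keys_bary e ab by auto
  have pa: "vtx a \<in> X" using vtx_in e ab by blast
  have "2 \<le> card ?N"
  proof (rule ccontr)
    assume "\<not> 2 \<le> card ?N"
    then have "card ?N = 0 \<or> card ?N = 1" by linarith
    then have "\<exists>c. \<forall>t\<in>?N. t = {a, b, c}"
    proof
      assume "card ?N = 0"
      then have "?N = {}" using finN card_0_eq by blast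
      then show ?thesis by blast
    next
      assume "card ?N = 1"
      then obtain t where t: "?N = {t}" by (auto simp: card_1_singleton_iff)
      then have "t \<in> tri S" "{a, b} \<subseteq> t" using ab by auto
      then show ?thesis using tri_eq_insert[OF ab(2), of t] t by (metis singletonD)
    qed
    then obtain c where c: "\<forall>t\<in>?N. t = {a, b, c}" by auto
    have keys: "Poly_Mapping.keys x \<subseteq> {a, b, c}" if "x \<in> ost e" for x
    proof (cases "Poly_Mapping.keys x = e")
      case False
      have k: "Poly_Mapping.keys x \<in> S" "e \<subseteq> Poly_Mapping.keys x" using that unfolding ost_def carrier_iff by auto
      then have "card e < card (Poly_Mapping.keys x)" using False by (intro psubset_card_mono) auto
      then have "card (Poly_Mapping.keys x) = 3" using card_face[OF k(1)] e by auto
      then show ?thesis using c k unfolding tri_def by auto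
    qed (use ab in auto)
    \<comment> \<open>With all supports inside \<open>{a, b, c}\<close> the weights of
      \<open>a\<close> and \<open>b\<close> determine the point. The image stays in the half-plane
      \<open>Re + Im \<le> 1\<close>, and the barycenter of the edge sits on the rim.\<close>
    define g where "g x = Complex (Poly_Mapping.lookup x a) (Poly_Mapping.lookup x b)" for x :: "'a \<Rightarrow>\<^sub>0 real"
    have "inj_on g (ost e)"
    proof (rule inj_onI)
      fix x y assume xy: "x \<in> ost e" "y \<in> ost e" "g x = g y"
      then have X: "x \<in> X" "y \<in> X" unfolding ost_def by auto
      have lab: "Poly_Mapping.lookup x a = Poly_Mapping.lookup y a" "Poly_Mapping.lookup x b = Poly_Mapping.lookup y b"
        using xy unfolding g_def by auto
      have "sum (Poly_Mapping.lookup x) {a, b, c} = sum (Poly_Mapping.lookup y) {a, b, c}"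
        using sum_lookup X keys xy by simp
      then have lc: "Poly_Mapping.lookup x c = Poly_Mapping.lookup y c"
        using lab ab by (cases "c = a \<or> c = b") auto
      show "x = y"
      proof (rule poly_mapping_eqI)
        fix v
        show "Poly_Mapping.lookup x v = Poly_Mapping.lookup y v"
        proof (cases "v \<in> {a, b, c}")
          case False
          then have "v \<notin> Poly_Mapping.keys x" "v \<notin> Poly_Mapping.keys y" using keys xy by blast+
          then show ?thesis by (simp add: in_keys_iff)
        qed (use lab lc in auto)
      qed
    qed
    moreover have "continuous_on (ost e) g"
      unfolding g_def Complex_eq by (intro continuous_intros)
    moreover have "vtx a \<notin> ost e" using ab unfolding ost_def by auto
    ultimately have op: "open (g ` ost e)" using domain_out[OF openin_ost[OF e(1)]] pa by blast
    have half: "Re (g x) + Im (g x) \<le> 1" if "x \<in> ost e" for x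
    proof -
      have xX: "x \<in> X" using that unfolding ost_def by auto
      have "{a, b} \<subseteq> \<Union>S" using e ab by auto
      then have "sum (Poly_Mapping.lookup x) {a, b} \<le> sum (Poly_Mapping.lookup x) (\<Union>S)"
        using xX finV unfolding carrier_iff by (intro sum_mono2) auto
      then show ?thesis using xX ab unfolding carrier_iff g_def by simp
    qed
    have "g (bary e) \<in> g ` ost e" using eX unfolding ost_def by auto
    then obtain \<epsilon> where \<epsilon>: "0 < \<epsilon>" "ball (g (bary e)) \<epsilon> \<subseteq> g ` ost e"
      using op open_contains_ball by metis
    have gb: "g (bary e) = Complex (1/2) (1/2)" unfolding g_def using lookup_bary[OF e(1)] ab e by simp
    have "Complex (1/2 + \<epsilon>/2) (1/2) \<in> ball (g (bary e)) \<epsilon>"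
      unfolding gb using \<epsilon> by (simp add: dist_complex_def cmod_def complex_diff)
    then obtain x where x: "x \<in> ost e" "g x = Complex (1/2 + \<epsilon>/2) (1/2)" using \<epsilon> by auto
    then have "Re (g x) + Im (g x) = 1 + \<epsilon>/2" by simp
    then show False using half[OF x(1)] \<epsilon> by linarith
  qed
  moreover have "card ?N \<le> 2"
  proof (rule ccontr)
    assume "\<not> card ?N \<le> 2"
    then have "3 \<le> card ?N" by linarith
    from obtain_subset_with_card_n[OF this] obtain N' where N': "N' \<subseteq> ?N" "card N' = 3" by metis
    obtain t1 t2 t3 where t: "t1 \<noteq> t2" "t1 \<noteq> t3" "t2 \<noteq> t3" and "N' = {t1, t2, t3}"
      using card_3_iff[THEN iffD1, OF N'(2)] by metis
    then have tN: "t1 \<in> ?N" "t2 \<in> ?N" "t3 \<in> ?N" using N'(1) by blast+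
    obtain c1 where c1: "t1 = {a, b, c1}" "c1 \<noteq> a" "c1 \<noteq> b" using tri_eq_insert[OF ab(2), of t1] tN(1) ab(1) by blast
    obtain c2 where c2: "t2 = {a, b, c2}" "c2 \<noteq> a" "c2 \<noteq> b" using tri_eq_insert[OF ab(2), of t2] tN(2) ab(1) by blast
    obtain c3 where c3: "t3 = {a, b, c3}" "c3 \<noteq> a" "c3 \<noteq> b" using tri_eq_insert[OF ab(2), of t3] tN(3) ab(1) by blast
    have c: "c1 \<noteq> c2" "c1 \<noteq> c3" "c2 \<noteq> c3" using t c1 c2 c3 by auto
    have tS: "{a, b, c1} \<in> S" "{a, b, c2} \<in> S" "{a, b, c3} \<in> S" using tN c1 c2 c3 unfolding tri_def by auto
    \<comment> \<open>Two triangles glued along the edge: \<open>Im z\<close> is the weight of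
      \<open>c1\<close>, or negatively that of \<open>c2\<close>, and the rest is divided between
      \<open>a\<close> and \<open>b\<close> in the ratio of \<open>Re z\<close> to
      \<open>1 - Re z\<close>.\<close>
    define f where "f z = ((1 - \<bar>Im z\<bar>) * Re z) *\<^sub>R vtx a + ((1 - \<bar>Im z\<bar>) * (1 - Re z)) *\<^sub>R vtx b
        + max (Im z) 0 *\<^sub>R vtx c1 + max (- Im z) 0 *\<^sub>R vtx c2" for z
    define \<Omega> where "\<Omega> = {z. 0 < Re z \<and> Re z < 1 \<and> - 1 < Im z \<and> Im z < 1}"
    have op: "open \<Omega>" unfolding \<Omega>_def
      by (intro open_Collect_conj open_Collect_less continuous_intros)
    have l: "Poly_Mapping.lookup (f z) a = (1 - \<bar>Im z\<bar>) * Re z" "Poly_Mapping.lookup (f z) b = (1 - \<bar>Im z\<bar>) * (1 - Re z)"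
        "Poly_Mapping.lookup (f z) c1 = max (Im z) 0" "Poly_Mapping.lookup (f z) c2 = max (- Im z) 0"
        "Poly_Mapping.lookup (f z) c3 = 0" for z
      using ab c c1 c2 c3 by (auto simp: f_def lookup_simps)
    have fX: "f z \<in> X" if z: "z \<in> \<Omega>" for z
    proof -
      define w where "w v = (if v = a then (1 - \<bar>Im z\<bar>) * Re z else if v = b then (1 - \<bar>Im z\<bar>) * (1 - Re z) else \<bar>Im z\<bar>)" for v
      have nn: "0 \<le> (1 - \<bar>Im z\<bar>) * Re z" "0 \<le> (1 - \<bar>Im z\<bar>) * (1 - Re z)" using z by (auto simp: \<Omega>_def)
      have s: "(1 - \<bar>Im z\<bar>) * Re z + ((1 - \<bar>Im z\<bar>) * (1 - Re z) + \<bar>Im z\<bar>) = 1" by (simp add: algebra_simps)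
      have w: "(\<Sum>v\<in>{a, b, d}. w v *\<^sub>R vtx v) \<in> X" if "{a, b, d} \<in> S" "d \<noteq> a" "d \<noteq> b" for d
        using that ab nn s by (intro combination_in_carrier) (auto simp: w_def)
      show ?thesis
      proof (cases "0 \<le> Im z")
        case True
        have "f z = (\<Sum>v\<in>{a, b, c1}. w v *\<^sub>R vtx v)"
          using True ab c1 by (simp add: f_def w_def)
        then show ?thesis using w[OF tS(1)] c1 by simp
      next
        case False
        have "f z = (\<Sum>v\<in>{a, b, c2}. w v *\<^sub>R vtx v)"
          using False ab c2 by (simp add: f_def w_def)
        then show ?thesis using w[OF tS(2)] c2 by simp
      qed
    qed
    have inj: "inj_on f \<Omega>"
    proof (rule inj_onI)
      fix z z' assume z: "z \<in> \<Omega>" "z' \<in> \<Omega>" "f z = f z'"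
      then have m: "max (Im z) 0 = max (Im z') 0" "max (- Im z) 0 = max (- Im z') 0"
        "(1 - \<bar>Im z\<bar>) * Re z = (1 - \<bar>Im z'\<bar>) * Re z'" using l by metis+
      then have "Im z = Im z'" by (auto simp: max_def split: if_splits)
      moreover from this have "Re z = Re z'" using m z unfolding \<Omega>_def by auto
      ultimately show "z = z'" by (simp add: complex_eqI)
    qed
    have ne: "f z \<noteq> vtx a" if "z \<in> \<Omega>" for z
    proof
      assume "f z = vtx a"
      then have "(1 - \<bar>Im z\<bar>) * (1 - Re z) = 0" using l(2)[of z] ab by (simp add: lookup_vtx)
      then show False using that unfolding \<Omega>_def by auto
    qed
    have "continuous_on \<Omega> f" unfolding f_def by (intro continuous_intros)
    moreover have "f ` \<Omega> \<subseteq> X - {vtx a}" using fX ne by auto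
    ultimately have "openin (top_of_set X) (f ` \<Omega>)" by (rule domain_in[OF _ inj _ op pa])
    then obtain U where U: "open U" "f ` \<Omega> = X \<inter> U" by (auto simp: openin_open)
    \<comment> \<open>A segment from the midpoint of the edge into the third triangle. It starts in
      the open patch and so stays there for small \<open>\<tau>\<close>, yet the patch has no weight
      at \<open>c3\<close>.\<close>
    define y where "y \<tau> = ((1 - \<tau>) / 2) *\<^sub>R vtx a + ((1 - \<tau>) / 2) *\<^sub>R vtx b + \<tau> *\<^sub>R vtx c3" for \<tau> :: real
    have yX: "y \<tau> \<in> X" if "0 < \<tau>" "\<tau> < 1" for \<tau>
    proof -
      define w where "w v = (if v = a \<or> v = b then (1 - \<tau>) / 2 else \<tau>)" for v
      have "(\<Sum>v\<in>{a, b, c3}. w v *\<^sub>R vtx v) \<in> X"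
        using that ab c3 by (intro combination_in_carrier tS) (auto simp: w_def)
      moreover have "(\<Sum>v\<in>{a, b, c3}. w v *\<^sub>R vtx v) = y \<tau>" using ab c3 by (simp add: w_def y_def)
      ultimately show ?thesis by simp
    qed
    have "y 0 = f (1/2)" unfolding y_def f_def by simp
    moreover have "(1/2 :: complex) \<in> \<Omega>" unfolding \<Omega>_def by simp
    ultimately have "y 0 \<in> U" using U by blast
    have "(y \<longlongrightarrow> y 0) (at_right 0)"
      unfolding y_def by (auto intro!: tendsto_eq_intros)
    then have "\<forall>\<^sub>F \<tau> in at_right 0. y \<tau> \<in> U" using U(1) \<open>y 0 \<in> U\<close> by (rule topological_tendstoD)
    moreover have "\<forall>\<^sub>F \<tau> in at_right 0. 0 < \<tau> \<and> \<tau> < (1 :: real)"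
      using eventually_at_right_real[of 0 1] by (auto elim: eventually_mono)
    ultimately have "\<forall>\<^sub>F \<tau> in at_right 0. y \<tau> \<in> U \<and> 0 < \<tau> \<and> \<tau> < (1 :: real)" by (rule eventually_conj)
    then obtain \<tau> where \<tau>: "y \<tau> \<in> U" "0 < \<tau>" "\<tau> < 1"
      using eventually_happens'[OF trivial_limit_at_right_real] by blast
    then have "y \<tau> \<in> f ` \<Omega>" using yX U by blast
    then obtain z where "y \<tau> = f z" by auto
    then have "Poly_Mapping.lookup (y \<tau>) c3 = 0" using l by simp
    moreover have "Poly_Mapping.lookup (y \<tau>) c3 = \<tau>" unfolding y_def using c3 by (simp add: lookup_simps)
    ultimately show False using \<tau> by simp
  qed
  ultimately show ?thesis by simp
qed

text \<open>Edges are covered by \<open>edge_in_two_triangles\<close>. A vertex in no triangle would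
  have no edge either, so its open star would be a single point, and points are not open. The empty
  face needs only some vertex to exist.\<close>

lemma face_in_triangle:
  assumes "\<sigma> \<in> S"
  shows "\<exists>t\<in>tri S. \<sigma> \<subseteq> t"
proof -
  have e: "\<exists>t\<in>tri S. e \<subseteq> t" if "e \<in> S" "card e = 2" for e
  proof -
    have "{t \<in> tri S. e \<subseteq> t} \<noteq> {}" using edge_in_two_triangles[OF that] by (intro notI) simp
    then show ?thesis by blast
  qed
  have v: "\<exists>t\<in>tri S. v \<in> t" if "v \<in> \<Union>S" for v
  proof (rule ccontr)
    assume n: "\<not> ?thesis"
    have vS: "{v} \<in> S" using that down by blast
    have "ost {v} \<subseteq> {vtx v}"
    proof
      fix x assume x: "x \<in> ost {v}"
      then have k: "x \<in> X" "v \<in> Poly_Mapping.keys x" "Poly_Mapping.keys x \<in> S" unfolding ost_def carrier_iff by auto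
      have "Poly_Mapping.keys x = {v}"
      proof (rule ccontr)
        assume "Poly_Mapping.keys x \<noteq> {v}"
        then obtain w where w: "w \<in> Poly_Mapping.keys x" "w \<noteq> v" using k by auto
        then have "{v, w} \<in> S" using k down by auto
        then show False using e[of "{v, w}"] w n by auto
      qed
      then show "x \<in> {vtx v}" using keys_singleton k by auto
    qed
    moreover have "bary {v} \<in> ost {v}" using bary_in keys_bary vS unfolding ost_def by auto
    ultimately have "ost {v} = {vtx v}" using subset_singletonD by (metis empty_iff)
    then show False using openin_ost[OF vS] not_openin_singleton by metis
  qed
  have fc: "finite \<sigma>" "card \<sigma> \<le> 3" using card_face fin_face assms by auto
  then consider "card \<sigma> = 0" | "card \<sigma> = 1" | "card \<sigma> = 2" | "card \<sigma> = 3" by linarith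
  then show ?thesis
  proof cases
    case 1
    obtain x where "x \<in> X" using carrier_nonempty by auto
    then obtain w where "w \<in> \<Union>S" using keys_nonempty carrier_iff by blast
    then show ?thesis using v 1 fc by auto
  next
    case 2
    then show ?thesis using v assms by (auto simp: card_1_singleton_iff)
  next
    case 3
    then show ?thesis using e assms by auto
  next
    case 4
    then show ?thesis using assms unfolding tri_def by auto
  qed
qed

section \<open>Regions of the carrier and the Jordan curve theorem\<close>

lemma tri_Int_edge:
  assumes t: "t \<in> tri S" "t' \<in> tri S" "t \<noteq> t'" and k: "k \<subseteq> t" "k \<subseteq> t'" "k \<noteq> {}" "\<not> (\<exists>v. k = {v})"
  shows "k \<in> S \<and> card k = 2"
proof -
  have f: "finite t" "finite t'" "card t = 3" "card t' = 3" "t \<in> S" using t fin_face unfolding tri_def by auto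
  have fk: "finite k" using k(1) f(1) by (rule finite_subset)
  have "k \<noteq> t" using k t f card_subset_eq[of t' t] by auto
  then have "card k < 3" using psubset_card_mono[of t k] k f by auto
  moreover have "card k \<noteq> 0" "card k \<noteq> 1" using k fk by (auto simp: card_1_singleton_iff)
  ultimately show ?thesis using down f k by auto
qed

lemma closedin_cell: "closedin (top_of_set X) {x \<in> X. Poly_Mapping.keys x \<subseteq> \<sigma>}"
proof -
  have "closed (\<Inter>v\<in>- \<sigma>. {x. Poly_Mapping.lookup x v = (0 :: real)})"
    by (intro closed_INT ballI closed_Collect_eq continuous_intros)
  then have "closedin (top_of_set X) (X \<inter> (\<Inter>v\<in>- \<sigma>. {x. Poly_Mapping.lookup x v = 0}))"
    by (rule closedin_closed_Int)
  moreover have "X \<inter> (\<Inter>v\<in>- \<sigma>. {x. Poly_Mapping.lookup x v = 0}) = {x \<in> X. Poly_Mapping.keys x \<subseteq> \<sigma>}"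
    by (auto simp: in_keys_iff)
  ultimately show ?thesis by simp
qed

text \<open>The closed triangles in \<open>A\<close> and those outside \<open>A\<close> cover
  \<open>W\<close> by two relatively closed sets, which the hypothesis on \<open>A\<close> makes
  disjoint within \<open>W\<close>.\<close>

lemma connected_region:
  assumes W: "W \<subseteq> X" "connected W"
    and A: "\<And>x t t'. x \<in> W \<Longrightarrow> t \<in> tri S \<Longrightarrow> t' \<in> tri S \<Longrightarrow> t \<in> A \<Longrightarrow> t' \<notin> A \<Longrightarrow>
        Poly_Mapping.keys x \<subseteq> t \<Longrightarrow> Poly_Mapping.keys x \<subseteq> t' \<Longrightarrow> False"
    and xy: "x \<in> W" "y \<in> W" "t \<in> tri S" "t' \<in> tri S" "Poly_Mapping.keys x \<subseteq> t" "Poly_Mapping.keys y \<subseteq> t'"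
  shows "t \<in> A \<longleftrightarrow> t' \<in> A"
proof -
  define P where "P B = (\<Union>s\<in>B. {x \<in> X. Poly_Mapping.keys x \<subseteq> s})" for B :: "'a set set"
  have cl: "closedin (top_of_set W) (W \<inter> P B)" if "B \<subseteq> tri S" for B
  proof -
    have "finite B" using that finS finite_subset[of B S] unfolding tri_def by auto
    then have "closedin (top_of_set X) (P B)" unfolding P_def
      by (intro closedin_Union) (auto simp: closedin_cell)
    then obtain T where "closed T" "P B = X \<inter> T" by (auto simp: closedin_closed)
    then have "W \<inter> P B = W \<inter> T" using W by auto
    then show ?thesis using \<open>closed T\<close> by (auto simp: closedin_closed)
  qed
  have cover: "W \<subseteq> (W \<inter> P (tri S \<inter> A)) \<union> (W \<inter> P (tri S - A))"
  proof
    fix x assume "x \<in> W"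
    moreover from this obtain s where "s \<in> tri S" "Poly_Mapping.keys x \<subseteq> s"
      using face_in_triangle W carrier_iff by blast
    ultimately show "x \<in> (W \<inter> P (tri S \<inter> A)) \<union> (W \<inter> P (tri S - A))" using W unfolding P_def by blast
  qed
  have "(W \<inter> P (tri S \<inter> A)) \<inter> (W \<inter> P (tri S - A)) = {}" using A unfolding P_def by blast
  then have "W \<inter> P (tri S \<inter> A) = {} \<or> W \<inter> P (tri S - A) = {}"
    using W(2) cover cl[of "tri S \<inter> A"] cl[of "tri S - A"] unfolding connected_closedin by blast
  then show ?thesis using xy W unfolding P_def by blast
qed

text \<open>Without its finitely many vertices the carrier is still connected. Any remaining point
  shared by a triangle in \<open>A\<close> and one outside lies on an edge, and that edge would
  belong to \<open>bd S A\<close>.\<close>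

lemma no_boundary_trivial:
  assumes A: "A \<subseteq> tri S" "bd S A = {}"
  shows "A = {} \<or> A = tri S"
proof -
  let ?W = "X - vtx ` \<Union>S"
  have "openin (top_of_set X) X" by simp
  then have con: "connected ?W" using connected_minus_finite carrier_connected finV by blast
  have no: False if "x \<in> ?W" "t \<in> tri S" "t' \<in> tri S" "t \<in> A" "t' \<notin> A"
    "Poly_Mapping.keys x \<subseteq> t" "Poly_Mapping.keys x \<subseteq> t'" for x t t'
  proof -
    have "\<not> (\<exists>v. Poly_Mapping.keys x = {v})"
    proof
      assume "\<exists>v. Poly_Mapping.keys x = {v}"
      then obtain v where v: "Poly_Mapping.keys x = {v}" by auto
      then have "x = vtx v" "v \<in> \<Union>S" using keys_singleton that carrier_iff by auto
      then show False using that by auto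
    qed
    then have "Poly_Mapping.keys x \<in> S \<and> card (Poly_Mapping.keys x) = 2"
      using that keys_nonempty by (intro tri_Int_edge[of t t']) auto
    then have "Poly_Mapping.keys x \<in> bd S A" using that unfolding bd_def by blast
    then show False using A by auto
  qed
  have b: "bary t \<in> ?W \<and> Poly_Mapping.keys (bary t) \<subseteq> t" if "t \<in> tri S" for t
  proof -
    have t: "t \<in> S" "card t = 3" using that unfolding tri_def by auto
    then have tne: "t \<noteq> {}" by force
    have "bary t \<noteq> vtx v" for v
    proof
      assume "bary t = vtx v"
      then have "t = {v}" using keys_bary[OF t(1)] by simp
      then show False using t by simp
    qed
    then show ?thesis using bary_in[OF t(1) tne] keys_bary[OF t(1)] by auto
  qed
  have "t \<in> A \<longleftrightarrow> t' \<in> A" if "t \<in> tri S" "t' \<in> tri S" for t t'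
  proof (rule connected_region[where W = "?W" and x = "bary t" and y = "bary t'"])
    show "connected ?W" by (rule con)
  qed (use no b that in blast)+
  then show ?thesis using A by blast
qed

text \<open>The argument of \<open>no_boundary_trivial\<close> inside the punctured open star of
  \<open>v\<close>, where every shared point lies on an edge at \<open>v\<close>.\<close>

lemma star_trivial:
  assumes A: "A \<subseteq> {t \<in> tri S. v \<in> t}" "\<forall>e\<in>bd S A. v \<notin> e"
  shows "A = {} \<or> A = {t \<in> tri S. v \<in> t}"
proof (cases "{v} \<in> S")
  case False
  have "{v} \<in> S" if "t \<in> tri S" "v \<in> t" for t using that down unfolding tri_def by auto
  then show ?thesis using False A by blast
next
  case vS: True
  let ?W = "ost {v} - {vtx v}"
  have con: "connected ?W" using connected_minus_finite[OF openin_ost[OF vS] connected_ost[OF vS]] by auto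
  have no: False if "x \<in> ?W" "t \<in> tri S" "t' \<in> tri S" "t \<in> A" "t' \<notin> A"
    "Poly_Mapping.keys x \<subseteq> t" "Poly_Mapping.keys x \<subseteq> t'" for x t t'
  proof -
    have x: "x \<in> X" "v \<in> Poly_Mapping.keys x" "x \<noteq> vtx v" using that unfolding ost_def by auto
    then have "\<not> (\<exists>w. Poly_Mapping.keys x = {w})" using keys_singleton by auto
    then have "Poly_Mapping.keys x \<in> S \<and> card (Poly_Mapping.keys x) = 2"
      using that x by (intro tri_Int_edge[of t t']) auto
    then have "Poly_Mapping.keys x \<in> bd S A" using that unfolding bd_def by blast
    then show False using A x by auto
  qed
  have b: "bary t \<in> ?W \<and> Poly_Mapping.keys (bary t) \<subseteq> t" if "t \<in> tri S" "v \<in> t" for t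
  proof -
    have t: "t \<in> S" "card t = 3" using that unfolding tri_def by auto
    then have tne: "t \<noteq> {}" by force
    have "bary t \<noteq> vtx v"
    proof
      assume "bary t = vtx v"
      then have "t = {v}" using keys_bary[OF t(1)] by simp
      then show False using t by simp
    qed
    then show ?thesis using that bary_in[OF t(1) tne] keys_bary[OF t(1)] unfolding ost_def by auto
  qed
  have WX: "?W \<subseteq> X" unfolding ost_def by auto
  have "t \<in> A \<longleftrightarrow> t' \<in> A" if "t \<in> tri S" "t' \<in> tri S" "v \<in> t" "v \<in> t'" for t t'
  proof (rule connected_region[where W = "?W" and x = "bary t" and y = "bary t'"])
    show "connected ?W" by (rule con)
  qed (use WX no b that in blast)+
  then show ?thesis using A by blast
qed

text \<open>In the chart that omits a point \<open>p\<close> off the polygon, the polygon is a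
  Jordan curve, and \<open>A\<close> collects the open triangles inside it. Both sides have the
  whole curve as frontier, so an edge on the polygon sees both; an edge off it has a connected open
  star avoiding the curve, so its triangles lie on one side.\<close>

lemma cycle_bounds:
  assumes zs: "distinct zs" "3 \<le> length zs" and ZS: "insert {last zs, hd zs} (ledges zs) \<subseteq> S"
  shows "\<exists>A\<subseteq>tri S. bd S A = insert {last zs, hd zs} (ledges zs)"
proof -
  define Z where "Z = insert {last zs, hd zs} (ledges zs)"
  have Zcard: "card e = 2" if "e \<in> Z" for e
  proof -
    have "hd zs \<noteq> last zs" using zs by (cases zs; cases "tl zs" rule: rev_cases) auto
    then show ?thesis using that ledges_card[OF zs(1)] unfolding Z_def by auto
  qed
  have Zfin: "finite e" if "e \<in> Z" for e using Zcard[OF that] card.infinite by fastforce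
  obtain c where c: "simple_path c" "pathfinish c = pathstart c" "path_image c = (\<Union>e\<in>Z. convex hull (vtx ` e))"
    using exists_polygonal_loop[OF zs] unfolding Z_def by blast
  define C where "C = (\<Union>e\<in>Z. convex hull (vtx ` e))"
  have CX: "C \<subseteq> X" using ZS unfolding C_def carrier_of_def Z_def by auto
  have C_iff: "x \<in> C \<longleftrightarrow> (\<exists>e\<in>Z. Poly_Mapping.keys x \<subseteq> e)" if x: "x \<in> X" for x
  proof -
    have "x \<in> convex hull (vtx ` e) \<longleftrightarrow> Poly_Mapping.keys x \<subseteq> e" if "e \<in> Z" for e
      using hull_vtx_iff[OF Zfin[OF that], of x] sum_lookup[OF x _ Zfin[OF that]] x[unfolded carrier_iff] by blast
    then show ?thesis unfolding C_def by blast
  qed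
  have tC: "bary t \<in> X - C" if "t \<in> tri S" for t
  proof -
    have t: "t \<in> S" "card t = 3" using that unfolding tri_def by auto
    then have tne: "t \<noteq> {}" by force
    have "\<not> t \<subseteq> e" if "e \<in> Z" for e using card_mono[OF Zfin[OF that], of t] Zcard[OF that] t by auto
    moreover have "bary t \<in> X" using bary_in[OF t(1) tne] .
    ultimately show ?thesis using C_iff keys_bary[OF t(1)] by auto
  qed
  have "{last zs, hd zs} \<in> S" using ZS by auto
  then obtain t0 where "t0 \<in> tri S" using face_in_triangle by blast
  then obtain p where p: "p \<in> X" "p \<notin> C" using tC by blast
  obtain \<phi> \<psi> where hom: "homeomorphism (X - {p}) (UNIV :: complex set) \<phi> \<psi>" using chart_obtain p by blast
  have inj: "inj_on \<phi> (X - {p})" and cont: "continuous_on (X - {p}) \<phi>"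
    using hom unfolding homeomorphism_def by (metis inj_on_inverseI, simp)
  have Cp: "C \<subseteq> X - {p}" using CX p by auto
  define J where "J = path_image (\<phi> \<circ> c)"
  have J: "J = \<phi> ` C" unfolding J_def C_def c(3)[symmetric] by (rule path_image_compose)
  have "simple_path (\<phi> \<circ> c)"
    using c Cp cont inj unfolding C_def[symmetric]
    by (intro simple_path_continuous_image) (auto intro: continuous_on_subset inj_on_subset)
  moreover have "pathfinish (\<phi> \<circ> c) = pathstart (\<phi> \<circ> c)"
    using c by (simp add: pathfinish_compose pathstart_compose)
  ultimately have jordan: "open (inside J)" "open (outside J)" "frontier (inside J) = J" "frontier (outside J) = J"
    using Jordan_inside_outside[of "\<phi> \<circ> c"] unfolding J_def by auto
  have side: "(\<phi> x \<in> inside J) \<noteq> (\<phi> x \<in> outside J)" if "x \<in> X - {p}" "x \<notin> C" for x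
  proof -
    have "\<phi> x \<notin> J" using that Cp inj unfolding J inj_on_def by blast
    then show ?thesis using inside_Un_outside[of J] inside_Int_outside[of J] by blast
  qed
  have one_side: "\<phi> x \<in> inside J \<longleftrightarrow> \<phi> y \<in> inside J"
    if W: "connected W" "W \<subseteq> X - {p}" "W \<inter> C = {}" and xy: "x \<in> W" "y \<in> W" for W x y
  proof -
    have con: "connected (\<phi> ` W)" using W cont by (intro connected_continuous_image) (auto intro: continuous_on_subset)
    have "\<phi> ` W \<subseteq> inside J \<union> outside J" using side W by blast
    moreover have "inside J \<inter> outside J \<inter> \<phi> ` W = {}" using inside_Int_outside by blast
    ultimately have "inside J \<inter> \<phi> ` W = {} \<or> outside J \<inter> \<phi> ` W = {}"
      using connectedD[OF con jordan(1,2)] by blast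
    then show ?thesis using xy W side by blast
  qed
  have ost_con: "connected (ost \<sigma> - {p})" if "\<sigma> \<in> S" "\<sigma> \<noteq> {}" for \<sigma>
    using connected_minus_finite[OF openin_ost[OF that(1)] connected_ost[OF that]] by auto
  have ost_sub: "ost \<sigma> - {p} \<subseteq> X - {p}" for \<sigma> unfolding ost_def by auto
  have ost_tri: "x \<in> ost t \<longleftrightarrow> x \<in> X \<and> Poly_Mapping.keys x = t" if t: "t \<in> tri S" for x t
  proof
    assume x: "x \<in> ost t"
    then have k: "x \<in> X" "t \<subseteq> Poly_Mapping.keys x" "Poly_Mapping.keys x \<in> S" unfolding ost_def carrier_iff by auto
    have "t = Poly_Mapping.keys x"
      using k card_face[OF k(3)] t unfolding tri_def by (intro card_seteq) auto
    then show "x \<in> X \<and> Poly_Mapping.keys x = t" using k by auto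
  qed (auto simp: ost_def)
  \<comment> \<open>\<open>p\<close> may lie in an open triangle, hence the repeated
    \<open>- {p}\<close>. What remains of the open triangle is nonempty, as points are not open, and
    connected, so any of its points can represent it.\<close>
  define A where "A = {t \<in> tri S. \<exists>x\<in>ost t - {p}. \<phi> x \<in> inside J}"
  have nonempty: "ost t - {p} \<noteq> {}" if "t \<in> tri S" for t
  proof
    assume "ost t - {p} = {}"
    moreover have t: "t \<in> S" "t \<noteq> {}" using that unfolding tri_def by force+
    moreover have "bary t \<in> ost t" using bary_in[OF t] keys_bary[OF t(1)] unfolding ost_def by simp
    ultimately have "ost t = {p}" by blast
    then show False using openin_ost[of t] not_openin_singleton that unfolding tri_def by auto
  qed
  have A_iff: "t \<in> A \<longleftrightarrow> \<phi> x \<in> inside J" if "t \<in> tri S" "x \<in> ost t - {p}" for t x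
  proof -
    have "ost t \<inter> C = {}"
    proof -
      have "\<not> t \<subseteq> e" if "e \<in> Z" for e
        using card_mono[OF Zfin[OF that], of t] Zcard[OF that] \<open>t \<in> tri S\<close> unfolding tri_def by auto
      then show ?thesis using C_iff unfolding ost_def by blast
    qed
    then have disj: "(ost t - {p}) \<inter> C = {}" by blast
    have t: "t \<in> S" "t \<noteq> {}" using \<open>t \<in> tri S\<close> unfolding tri_def by force+
    have "\<phi> x \<in> inside J \<longleftrightarrow> \<phi> y \<in> inside J" if "y \<in> ost t - {p}" for y
      by (rule one_side[OF ost_con[OF t] ost_sub disj \<open>x \<in> ost t - {p}\<close> that])
    then show ?thesis using that unfolding A_def by blast
  qed
  have edge_out: "t \<in> A \<longleftrightarrow> t' \<in> A"
    if e: "e \<in> S" "card e = 2" "e \<notin> Z" and t: "t \<in> tri S" "t' \<in> tri S" "e \<subseteq> t" "e \<subseteq> t'" for e t t'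
  proof -
    have "ost e \<inter> C = {}"
    proof -
      have "\<not> e \<subseteq> e'" if "e' \<in> Z" for e'
        using card_subset_eq[OF Zfin[OF that], of e] Zcard[OF that] e that by auto
      then show ?thesis using C_iff unfolding ost_def by blast
    qed
    moreover obtain x y where "x \<in> ost t - {p}" "y \<in> ost t' - {p}" using nonempty t by blast
    moreover from this have "x \<in> ost e - {p}" "y \<in> ost e - {p}" using t unfolding ost_def by auto
    moreover have "e \<noteq> {}" using e by auto
    ultimately show ?thesis
      using A_iff t one_side[OF ost_con ost_sub, of e x y] e by blast
  qed
  have edge_in: "e \<in> bd S A" if e: "e \<in> Z" for e
  proof -
    have eS: "e \<in> S" "card e = 2" "e \<noteq> {}" using e ZS Zcard[OF e] unfolding Z_def by auto
    let ?W = "ost e - {p}"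
    have "?W = ost e \<inter> (X - {p})" unfolding ost_def by blast
    then have "openin (top_of_set X) ?W"
      using openin_Int[OF openin_ost[OF eS(1)] openin_minus_point[of p]] by simp
    then have op: "open (\<phi> ` ?W)" using chart_open[OF hom] by auto
    have b: "bary e \<in> X" "Poly_Mapping.keys (bary e) = e" using bary_in keys_bary eS by auto
    then have "bary e \<in> C" using C_iff e by auto
    then have bW: "bary e \<in> ?W" "\<phi> (bary e) \<in> J" using b p unfolding ost_def J by auto
    \<comment> \<open>The barycenter of the edge is a limit of points of the side \<open>R\<close>.
      Those close to it lie in the open star of the edge but off the polygon, hence in an open
      triangle at the edge.\<close>
    have hit: "\<exists>t\<in>tri S. e \<subseteq> t \<and> (\<exists>x\<in>ost t - {p}. \<phi> x \<in> R)" if R: "frontier R = J" "R \<inter> J = {}" for R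
    proof -
      have "\<phi> (bary e) \<in> closure R" using R bW unfolding frontier_def by auto
      then obtain y where "y \<in> R" "y \<in> \<phi> ` ?W"
        using op bW(1) open_Int_closure_eq_empty[OF op, of R] by blast
      then obtain x where x: "x \<in> ?W" "\<phi> x \<in> R" by auto
      then have "x \<notin> C" using R unfolding J by auto
      then have "Poly_Mapping.keys x \<noteq> e" using C_iff x e unfolding ost_def by auto
      have k: "Poly_Mapping.keys x \<in> S" "e \<subseteq> Poly_Mapping.keys x" "x \<in> X" using x unfolding ost_def carrier_iff by auto
      then have "card e < card (Poly_Mapping.keys x)" using \<open>Poly_Mapping.keys x \<noteq> e\<close> by (intro psubset_card_mono) auto
      then have "Poly_Mapping.keys x \<in> tri S" using card_face[OF k(1)] k eS unfolding tri_def by auto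
      then show ?thesis using k x ost_tri by (intro bexI[of _ "Poly_Mapping.keys x"]) auto
    qed
    have "inside J \<inter> J = {}" "outside J \<inter> J = {}" using inside_no_overlap outside_no_overlap by auto
    then obtain t t' x' where t: "t \<in> tri S" "e \<subseteq> t" "t \<in> A"
      and t': "t' \<in> tri S" "e \<subseteq> t'" "x' \<in> ost t' - {p}" "\<phi> x' \<in> outside J"
      using hit[OF jordan(3)] hit[OF jordan(4)] unfolding A_def by blast
    moreover from this have "t' \<notin> A" using A_iff[of t' x'] inside_Int_outside[of J] by blast
    ultimately show ?thesis using eS unfolding bd_def by blast
  qed
  have "bd S A = Z"
  proof
    show "bd S A \<subseteq> Z" using edge_out unfolding bd_def by blast
    show "Z \<subseteq> bd S A" using edge_in by auto
  qed
  moreover have "A \<subseteq> tri S" unfolding A_def by auto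
  ultimately show ?thesis unfolding Z_def by blast
qed

lemma planar_surface: "planar_surface S"
proof
  show "finite S" by (rule finS)
  show "\<And>\<sigma> \<tau>. \<sigma> \<in> S \<Longrightarrow> \<tau> \<subseteq> \<sigma> \<Longrightarrow> \<tau> \<in> S" by (rule down)
  show "\<And>\<sigma>. \<sigma> \<in> S \<Longrightarrow> finite \<sigma>" by (rule fin_face)
  obtain x where "x \<in> X" using carrier_nonempty by auto
  then show "S \<noteq> {}" using carrier_iff by blast
  show "\<And>\<sigma>. \<sigma> \<in> S \<Longrightarrow> \<exists>t\<in>tri S. \<sigma> \<subseteq> t" by (rule face_in_triangle)
  show "\<And>e. e \<in> S \<Longrightarrow> card e = 2 \<Longrightarrow> card {t \<in> tri S. e \<subseteq> t} = 2" by (rule edge_in_two_triangles)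
  show "\<And>A v. A \<subseteq> {t \<in> tri S. v \<in> t} \<Longrightarrow> \<forall>e\<in>bd S A. v \<notin> e \<Longrightarrow> A = {} \<or> A = {t \<in> tri S. v \<in> t}"
    by (rule star_trivial)
  show "\<And>A. A \<subseteq> tri S \<Longrightarrow> bd S A = {} \<Longrightarrow> A = {} \<or> A = tri S" by (rule no_boundary_trivial)
  show "\<And>zs. distinct zs \<Longrightarrow> 3 \<le> length zs \<Longrightarrow> insert {last zs, hd zs} (ledges zs) \<subseteq> S \<Longrightarrow>
      \<exists>A\<subseteq>tri S. bd S A = insert {last zs, hd zs} (ledges zs)" by (rule cycle_bounds)
qed

end

text \<open>The free vector space on \<open>nat\<close> is infinite-dimensional, so the boundary is
  pulled back along \<open>L\<close> to the standard simplex in four-space. There the relative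
  frontiers of bounded convex sets of equal dimension are homeomorphic, whatever space they sit
  in.\<close>

lemma tetrahedron_boundary_sphere:
  "carrier_of (simplex_boundary 2) homeomorphic sphere (0 :: real ^ 3) 1"
proof -
  define b :: "nat \<Rightarrow> real \<times> real \<times> real \<times> real" where
    "b k = (if k = 0 then (1, 0, 0, 0) else if k = 1 then (0, 1, 0, 0) else if k = 2 then (0, 0, 1, 0) else (0, 0, 0, 1))" for k
  define L :: "real \<times> real \<times> real \<times> real \<Rightarrow> nat \<Rightarrow>\<^sub>0 real" where
    "L = (\<lambda>z. fst z *\<^sub>R vtx 0 + fst (snd z) *\<^sub>R vtx 1 + fst (snd (snd z)) *\<^sub>R vtx 2 + snd (snd (snd z)) *\<^sub>R vtx 3)"
  let ?I = "{..3::nat}"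
  have I: "?I = {0, 1, 2, 3}"
    unfolding set_eq_iff atMost_iff insert_iff empty_iff by presburger
  have Lb: "L (b k) = vtx k" if "k \<in> ?I" for k
    using that unfolding I b_def L_def by auto
  have lin: "linear L" unfolding L_def by (intro linearI) (auto simp: algebra_simps)
  have "inj L"
  proof (rule injI)
    fix z z' assume e: "L z = L z'"
    have "Poly_Mapping.lookup (L z) k = Poly_Mapping.lookup (L z') k" for k using e by simp
    from this[of 0] this[of 1] this[of 2] this[of 3] show "z = z'"
      by (simp add: L_def lookup_simps prod_eq_iff)
  qed
  have contL: "continuous_on A L" for A unfolding L_def by (intro continuous_intros)
  have injb: "inj_on b ?I" by (rule inj_onI) (metis Lb inj_vtx[of UNIV] inj_on_def UNIV_I)
  have "b ` ?I \<subseteq> Basis" unfolding I b_def by (auto simp: Basis_prod_def zero_prod_def)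
  then have ind: "\<not> affine_dependent (b ` ?I)"
    using independent_mono[OF independent_Basis] affine_dependent_imp_dependent by blast
  let ?T = "convex hull (b ` ?I)"
  have aff: "aff_dim ?T = 3"
    using aff_dim_affine_independent[OF ind] card_image[OF injb] by (simp add: aff_dim_convex_hull)
  have rf: "rel_frontier ?T = (\<Union>k\<in>?I. convex hull (b ` (?I - {k})))"
  proof -
    have diff: "b ` ?I - {b k} = b ` (?I - {k})" if "k \<in> ?I" for k
      using inj_on_image_set_diff[OF injb, of ?I "{k}"] that by simp
    have "rel_frontier ?T = (\<Union>k\<in>?I. convex hull (b ` ?I - {b k}))"
      unfolding rel_frontier_convex_hull_cases[OF ind] by (simp only: Setcompr_eq_image image_image)
    also have "\<dots> = (\<Union>k\<in>?I. convex hull (b ` (?I - {k})))"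
      by (rule SUP_cong) (simp_all only: diff)
    finally show ?thesis .
  qed
  have hull_L: "L ` (convex hull (b ` \<sigma>)) = convex hull (vtx ` \<sigma>)" if "\<sigma> \<subseteq> ?I" for \<sigma>
  proof -
    have "L ` b ` \<sigma> = vtx ` \<sigma>" unfolding image_image using Lb that by (intro image_cong) auto
    then show ?thesis using convex_hull_linear_image[OF lin, of "b ` \<sigma>"] by simp
  qed
  have bnd: "simplex_boundary 2 = {\<sigma>. \<sigma> \<subset> ?I}" unfolding simplex_boundary_def by simp
  have im: "L ` rel_frontier ?T = carrier_of (simplex_boundary 2)"
  proof
    show "L ` rel_frontier ?T \<subseteq> carrier_of (simplex_boundary 2)"
    proof
      fix x assume "x \<in> L ` rel_frontier ?T"
      then obtain k where k: "k \<in> ?I" "x \<in> L ` (convex hull (b ` (?I - {k})))" unfolding rf by blast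
      then have "x \<in> convex hull (vtx ` (?I - {k}))" using hull_L[of "?I - {k}"] by auto
      moreover have "?I - {k} \<in> simplex_boundary 2" using k(1) unfolding bnd by blast
      ultimately show "x \<in> carrier_of (simplex_boundary 2)" unfolding carrier_of_def by blast
    qed
    show "carrier_of (simplex_boundary 2) \<subseteq> L ` rel_frontier ?T"
    proof
      fix x assume "x \<in> carrier_of (simplex_boundary 2)"
      then obtain \<sigma> where s: "\<sigma> \<subset> ?I" "x \<in> convex hull (vtx ` \<sigma>)"
        unfolding carrier_of_def bnd by blast
      then obtain k where k: "k \<in> ?I" "\<sigma> \<subseteq> ?I - {k}" by blast
      then have "x \<in> convex hull (vtx ` (?I - {k}))" using s hull_mono[of "vtx ` \<sigma>" "vtx ` (?I - {k})" convex] by blast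
      then have "x \<in> L ` (convex hull (b ` (?I - {k})))" using hull_L[of "?I - {k}"] by auto
      then show "x \<in> L ` rel_frontier ?T" unfolding rf using k by blast
    qed
  qed
  have cpt: "compact (rel_frontier ?T)"
    by (intro compact_rel_frontier_bounded) (simp add: finite_imp_bounded_convex_hull)
  have "inj_on L (rel_frontier ?T)" using \<open>inj L\<close> by (rule inj_on_subset) simp
  then have "rel_frontier ?T homeomorphic carrier_of (simplex_boundary 2)"
    by (rule homeomorphic_compact[OF cpt contL im])
  moreover have "rel_frontier ?T homeomorphic rel_frontier (cball (0 :: real ^ 3) 1)"
    using aff by (intro homeomorphic_rel_frontiers_convex_bounded_sets)
      (auto simp: aff_dim_cball finite_imp_bounded_convex_hull)
  moreover have "rel_frontier (cball (0 :: real ^ 3) 1) = sphere 0 1"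
    by (simp add: rel_frontier_cball)
  ultimately show ?thesis by (metis homeomorphic_sym homeomorphic_trans)
qed

text \<open>A sphere without a point is a plane; this provides the charts of
  \<open>sphere_complex\<close>.\<close>

lemma combinatorial_sphere_planar_surface:
  assumes "combinatorial_sphere 2 S"
  shows "planar_surface S"
proof -
  have cpx: "abstract_complex S" and pl: "pl_homeomorphic (carrier_of S) (carrier_of (simplex_boundary 2))"
    using assms unfolding combinatorial_sphere_def by auto
  have "carrier_of S homeomorphic carrier_of (simplex_boundary 2)"
    using pl unfolding pl_homeomorphic_def homeomorphic_def by blast
  then have hs: "carrier_of S homeomorphic sphere (0 :: real ^ 3) 1"
    using tetrahedron_boundary_sphere homeomorphic_trans by blast
  have "sphere_complex S"
  proof
    show "abstract_complex S" by (rule cpx)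
    show "connected (carrier_of S)"
      using homeomorphic_connectedness[OF hs] connected_sphere[of "0 :: real ^ 3" 1] by simp
    show "carrier_of S \<noteq> {}"
      using hs by (metis homeomorphic_empty(1) homeomorphic_sym sphere_eq_empty not_one_less_zero)
    fix p assume p: "p \<in> carrier_of S"
    obtain h k where hk: "homeomorphism (carrier_of S) (sphere (0 :: real ^ 3) 1) h k"
      using hs unfolding homeomorphic_def by blast
    have hp: "h p \<in> sphere 0 1" using hk p unfolding homeomorphism_def by auto
    have "homeomorphism (carrier_of S - {p}) (sphere 0 1 - {h p}) h k"
    proof (rule homeomorphism_of_subsets[OF hk])
      show "h ` (carrier_of S - {p}) = sphere 0 1 - {h p}"
        using hk p unfolding homeomorphism_def by (auto, metis)
    qed auto
    then have "(carrier_of S - {p}) homeomorphic (sphere 0 1 - {h p})"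
      unfolding homeomorphic_def by blast
    moreover have "(sphere 0 1 - {h p}) homeomorphic (UNIV :: complex set)"
      using hp by (intro homeomorphic_punctured_sphere_affine) auto
    ultimately show "(carrier_of S - {p}) homeomorphic (UNIV :: complex set)"
      using homeomorphic_trans by blast
  qed
  then show ?thesis by (rule sphere_complex.planar_surface)
qed

section \<open>Lifting to a polytope in general position\<close>

definition exposes :: "('a \<Rightarrow> 'e::euclidean_space) \<Rightarrow> 'a set \<Rightarrow> 'a set \<Rightarrow> bool" where
  "exposes q V t \<longleftrightarrow> (\<exists>n c. (\<forall>v\<in>t. n \<bullet> q v = c) \<and> (\<forall>u\<in>V - t. n \<bullet> q u < c))"

text \<open>Affine independence of the points of \<open>t\<close> in dual form; these functionals
  serve as the corrections in \<open>eventually_exposes\<close>.\<close>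

definition separates :: "('a \<Rightarrow> 'e::euclidean_space) \<Rightarrow> 'a set \<Rightarrow> bool" where
  "separates q t \<longleftrightarrow> (\<forall>v\<in>t. \<exists>n c. n \<bullet> q v \<noteq> c \<and> (\<forall>u\<in>t - {v}. n \<bullet> q u = c))"

text \<open>Injectivity is demanded separately because the image, being a set, cannot reveal
  coinciding points.\<close>

definition general_position :: "('a \<Rightarrow> 'e::euclidean_space) \<Rightarrow> 'a set \<Rightarrow> bool" where
  "general_position q V \<longleftrightarrow>
     (\<forall>A\<subseteq>V. card A \<le> DIM('e) + 1 \<longrightarrow> inj_on q A \<and> \<not> affine_dependent (q ` A))"

text \<open>
  When a vertex \<open>v\<close> of \<open>t\<close> moves, the exposing functional is corrected by a small multiple of a
  functional separating \<open>v\<close> from the other vertices of \<open>t\<close>, so that it is constant on \<open>t\<close> again.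
\<close>

lemma eventually_exposes:
  fixes q :: "'a \<Rightarrow> 'e::euclidean_space"
  assumes "finite V" and ex: "exposes q V t" and sep: "separates q t"
  shows "\<forall>\<^sub>F y in nhds (q v). exposes (q(v := y)) V t \<and> separates (q(v := y)) t"
proof -
  have lim: "((\<lambda>y. n \<bullet> y) \<longlongrightarrow> n \<bullet> q v) (nhds (q v))" for n :: 'e
    by (intro tendsto_intros filterlim_ident)
  obtain n c where n: "\<forall>w\<in>t. n \<bullet> q w = c" "\<forall>u\<in>V - t. n \<bullet> q u < c"
    using ex unfolding exposes_def by blast
  show ?thesis
  proof (cases "v \<in> t")
    case False
    have "separates (q(v := y)) t" for y
    proof -
      have "\<And>w. w \<in> t \<Longrightarrow> w \<noteq> v" using False by auto
      then show ?thesis using sep unfolding separates_def by (auto simp: fun_upd_def)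
    qed
    moreover have "exposes (q(v := y)) V t" if y: "v \<in> V \<longrightarrow> n \<bullet> y < c" for y
      unfolding exposes_def using n y False by (intro exI[of _ n] exI[of _ c]) (auto simp: fun_upd_def)
    moreover have "\<forall>\<^sub>F y in nhds (q v). v \<in> V \<longrightarrow> n \<bullet> y < c"
    proof (cases "v \<in> V")
      case True
      then have "n \<bullet> q v < c" using n False by auto
      from order_tendstoD(2)[OF lim this] show ?thesis by (rule eventually_mono) simp
    qed simp
    ultimately show ?thesis by (auto elim: eventually_mono)
  next
    case True
    obtain m d where m: "m \<bullet> q v \<noteq> d" "\<forall>u\<in>t - {v}. m \<bullet> q u = d"
      using sep True unfolding separates_def by blast
    have ev1: "\<forall>\<^sub>F y in nhds (q v). m \<bullet> y \<noteq> d"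
      using tendsto_imp_eventually_ne[OF lim m(1)] .
    \<comment> \<open>The multiple of \<open>m\<close> to subtract from \<open>n\<close> so that the
      moved vertex is back on the hyperplane of \<open>t\<close>. It tends to 0 because
      \<open>n \<bullet> q v = c\<close>, so the strict inequalities survive.\<close>
    define r where "r y = (n \<bullet> y - c) / (m \<bullet> y - d)" for y
    have "(r \<longlongrightarrow> (n \<bullet> q v - c) / (m \<bullet> q v - d)) (nhds (q v))"
      unfolding r_def using m by (intro tendsto_intros lim filterlim_ident) auto
    then have rlim: "(r \<longlongrightarrow> 0) (nhds (q v))" using n True by simp
    have ev2: "\<forall>\<^sub>F y in nhds (q v). \<forall>u\<in>V - t. (n \<bullet> q u - c) - r y * (m \<bullet> q u - d) < 0"
    proof (rule eventually_ball_finite)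
      show "\<forall>u\<in>V - t. \<forall>\<^sub>F y in nhds (q v). (n \<bullet> q u - c) - r y * (m \<bullet> q u - d) < 0"
      proof
        fix u assume "u \<in> V - t"
        then have "(n \<bullet> q u - c) - 0 * (m \<bullet> q u - d) < 0" using n by auto
        moreover have "((\<lambda>y. (n \<bullet> q u - c) - r y * (m \<bullet> q u - d)) \<longlongrightarrow> (n \<bullet> q u - c) - 0 * (m \<bullet> q u - d)) (nhds (q v))"
          by (intro tendsto_intros rlim)
        ultimately show "\<forall>\<^sub>F y in nhds (q v). (n \<bullet> q u - c) - r y * (m \<bullet> q u - d) < 0"
          by (rule order_tendstoD(2)[rotated])
      qed
    qed (use \<open>finite V\<close> in auto)
    show ?thesis
    proof (rule eventually_mono[OF eventually_conj[OF ev1 ev2]])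
      fix y assume y: "m \<bullet> y \<noteq> d \<and> (\<forall>u\<in>V - t. (n \<bullet> q u - c) - r y * (m \<bullet> q u - d) < 0)"
      have ry: "r y * (m \<bullet> y - d) = n \<bullet> y - c" unfolding r_def using y by auto
      let ?q = "q(v := y)"
      have "exposes ?q V t"
        unfolding exposes_def
      proof (intro exI[of _ "n - r y *\<^sub>R m"] exI[of _ "c - r y * d"] conjI ballI)
        fix w assume w: "w \<in> t"
        show "(n - r y *\<^sub>R m) \<bullet> ?q w = c - r y * d"
        proof (cases "w = v")
          case True
          then show ?thesis using ry by (simp add: inner_diff_left algebra_simps)
        next
          case False
          then show ?thesis using w n m by (simp add: inner_diff_left)
        qed
      next
        fix u assume u: "u \<in> V - t"
        then have "u \<noteq> v" using True by auto
        then show "(n - r y *\<^sub>R m) \<bullet> ?q u < c - r y * d"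
          using y u by (simp add: inner_diff_left algebra_simps)
      qed
      moreover have "separates ?q t"
        unfolding separates_def
      proof
        fix w assume w: "w \<in> t"
        show "\<exists>n c. n \<bullet> ?q w \<noteq> c \<and> (\<forall>u\<in>t - {w}. n \<bullet> ?q u = c)"
        proof (cases "w = v")
          case True
          then show ?thesis using y m by (intro exI[of _ m] exI[of _ d]) auto
        next
          case False
          obtain k e where k: "k \<bullet> q w \<noteq> e" "\<forall>u\<in>t - {w}. k \<bullet> q u = e"
            using sep w unfolding separates_def by blast
          \<comment> \<open>The same correction for the functional that singles out
            \<open>w\<close>: it takes its constant again at the moved vertex, and its difference
            from the constant at \<open>w\<close> is unchanged because \<open>m\<close> equals
            \<open>d\<close> there.\<close>
          define s where "s = (k \<bullet> y - e) / (m \<bullet> y - d)"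
          have sy: "s * (m \<bullet> y - d) = k \<bullet> y - e" unfolding s_def using y by auto
          show ?thesis
          proof (intro exI[of _ "k - s *\<^sub>R m"] exI[of _ "e - s * d"] conjI ballI)
            show "(k - s *\<^sub>R m) \<bullet> ?q w \<noteq> e - s * d"
              using k m w False by (simp add: inner_diff_left)
            fix u assume u: "u \<in> t - {w}"
            show "(k - s *\<^sub>R m) \<bullet> ?q u = e - s * d"
            proof (cases "u = v")
              case True
              then show ?thesis using sy by (simp add: inner_diff_left algebra_simps)
            next
              case False
              then show ?thesis using u k m by (simp add: inner_diff_left)
            qed
          qed
        qed
      qed
      ultimately show "exposes ?q V t \<and> separates ?q t" by blast
    qed
  qed
qed

lemma interior_finite_Union_empty:
  "finite F \<Longrightarrow> (\<And>s. s \<in> F \<Longrightarrow> closed s \<and> interior s = {}) \<Longrightarrow> interior (\<Union>F) = {}"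
  by (induction F rule: finite_induct) (auto simp: interior_closed_Un_empty_interior)

text \<open>Vertices move one at a time. The forbidden places of \<open>v\<close> form a finite
  union of proper flats, which has no interior, while \<open>eventually_exposes\<close> leaves an
  open set of admissible places.\<close>

lemma perturb_to_general_position:
  fixes q :: "'a \<Rightarrow> 'e::euclidean_space"
  assumes "finite V" "finite Ts" and Ts: "\<And>t. t \<in> Ts \<Longrightarrow> exposes q V t \<and> separates q t"
    and "finite P"
  shows "\<exists>q' :: 'a \<Rightarrow> 'e. (\<forall>t\<in>Ts. exposes q' V t \<and> separates q' t) \<and> general_position q' P"
  using \<open>finite P\<close>
proof (induction P rule: finite_induct)
  case empty
  then show ?case using Ts by (intro exI[of _ q]) (auto simp: general_position_def)
next
  case (insert v P)
  then obtain p :: "'a \<Rightarrow> 'e" where p: "\<forall>t\<in>Ts. exposes p V t \<and> separates p t"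
    and gp: "general_position p P" by blast
  \<comment> \<open>Avoiding these flats is enough: a point off the affine hull of independent
    points extends them to an independent set, and at most \<open>DIM('e)\<close> earlier points
    accompany \<open>v\<close> in any subset to be tested.\<close>
  define Bad where "Bad = \<Union>((\<lambda>A. affine hull (p ` A)) ` {A. A \<subseteq> P \<and> card A \<le> DIM('e)})"
  have "interior Bad = {}"
    unfolding Bad_def
  proof (rule interior_finite_Union_empty)
    show "finite ((\<lambda>A. affine hull (p ` A)) ` {A. A \<subseteq> P \<and> card A \<le> DIM('e)})"
      using insert by auto
    fix s assume "s \<in> (\<lambda>A. affine hull (p ` A)) ` {A. A \<subseteq> P \<and> card A \<le> DIM('e)}"
    then obtain A where A: "s = affine hull (p ` A)" "A \<subseteq> P" "card A \<le> DIM('e)" by auto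
    then have "finite A" using insert finite_subset by auto
    then have "card (p ` A) \<le> DIM('e)" using card_image_le[of A p] A by auto
    then have "interior (affine hull (p ` A)) = {}"
      using \<open>finite A\<close> by (intro empty_interior_affine_hull) auto
    then show "closed s \<and> interior s = {}" unfolding A(1) by (simp add: closed_affine_hull)
  qed
  have "\<forall>\<^sub>F y in nhds (p v). \<forall>t\<in>Ts. exposes (p(v := y)) V t \<and> separates (p(v := y)) t"
    using p assms by (intro eventually_ball_finite) (auto intro!: eventually_exposes)
  then obtain W where W: "open W" "p v \<in> W"
    "\<And>y. y \<in> W \<Longrightarrow> \<forall>t\<in>Ts. exposes (p(v := y)) V t \<and> separates (p(v := y)) t"
    unfolding eventually_nhds by blast
  have "\<not> W \<subseteq> Bad" using W \<open>interior Bad = {}\<close> interior_maximal by blast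
  then obtain y where y: "y \<in> W" "y \<notin> Bad" by blast
  have "general_position (p(v := y)) (insert v P)"
    unfolding general_position_def
  proof (intro allI impI)
    fix A assume A: "A \<subseteq> insert v P" "card A \<le> DIM('e) + 1"
    have finA: "finite A" using A insert finite_subset by auto
    show "inj_on (p(v := y)) A \<and> \<not> affine_dependent (p(v := y) ` A)"
    proof (cases "v \<in> A")
      case False
      then have "A \<subseteq> P" "p(v := y) ` A = p ` A" "inj_on (p(v := y)) A \<longleftrightarrow> inj_on p A"
        using A by (auto simp: inj_on_def)
      then show ?thesis using gp A unfolding general_position_def by auto
    next
      case True
      define B where "B = A - {v}"
      have B: "A = insert v B" "v \<notin> B" "B \<subseteq> P" "card B \<le> DIM('e)"
        using True A finA unfolding B_def by auto
      have "y \<notin> affine hull (p ` B)" using y B unfolding Bad_def by blast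
      moreover have "inj_on p B" "\<not> affine_dependent (p ` B)"
        using gp B unfolding general_position_def by auto
      ultimately have "\<not> affine_dependent (insert y (p ` B))"
        by (intro affine_independent_insert)
      moreover have im: "p(v := y) ` A = insert y (p ` B)" using B by auto
      moreover have "y \<notin> p ` B"
        using \<open>y \<notin> affine hull (p ` B)\<close> hull_inc[of y "p ` B" affine] by blast
      then have "inj_on (p(v := y)) A" using \<open>inj_on p B\<close> B by (auto simp: inj_on_def)
      ultimately show ?thesis by simp
    qed
  qed
  then show ?case using W(3)[OF y(1)] by blast
qed

text \<open>In general position any \<open>DIM('e) + 1\<close> of the points span the whole space,
  so a proper face is spanned by fewer and is a simplex. Each exposed proper subset spans a face,
  and since the faces in \<open>S\<close> cover \<open>V\<close>, every point remains a vertex of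
  the hull.\<close>

lemma general_position_polytope:
  fixes q :: "'a \<Rightarrow> 'e::euclidean_space" and S :: "'a set set"
  assumes V: "finite V" "DIM('e) + 1 \<le> card V" and gp: "general_position q V"
    and S: "\<Union>S = V" "\<And>\<sigma>. \<sigma> \<in> S \<Longrightarrow> \<exists>t\<subset>V. \<sigma> \<subseteq> t \<and> exposes q V t"
  shows "\<exists>T :: 'a set set. polytopal_sphere TYPE('e) T \<and> S \<subseteq> T \<and> \<Union>T = V"
proof -
  define Q where "Q = convex hull (q ` V)"
  have fin: "finite \<sigma>" if "\<sigma> \<subseteq> V" for \<sigma> using that V finite_subset by auto
  have inj: "inj_on q V"
  proof (rule inj_onI)
    fix a b assume ab: "a \<in> V" "b \<in> V" "q a = q b"
    have "card {a, b} \<le> DIM('e) + 1" using DIM_positive[where 'a='e] by (auto simp: card_insert_if)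
    then have "inj_on q {a, b}" using gp[unfolded general_position_def, rule_format, of "{a, b}"] ab by simp
    then show "a = b" by (rule inj_onD[where f = q, OF _ ab(3)]) simp_all
  qed
  have aff: "aff_dim (q ` \<sigma>) = int (card \<sigma>) - 1" if "\<sigma> \<subseteq> V" "card \<sigma> \<le> DIM('e) + 1" for \<sigma>
  proof -
    have "\<not> affine_dependent (q ` \<sigma>)" "inj_on q \<sigma>" using gp that unfolding general_position_def by auto
    then show ?thesis using aff_dim_affine_independent[of "q ` \<sigma>"] card_image[of q \<sigma>] by simp
  qed
  have full: "aff_dim (q ` \<sigma>) = int DIM('e)" if "\<sigma> \<subseteq> V" "DIM('e) + 1 \<le> card \<sigma>" for \<sigma>
  proof -
    from obtain_subset_with_card_n[OF \<open>DIM('e) + 1 \<le> card \<sigma>\<close>]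
    obtain A where A: "A \<subseteq> \<sigma>" "card A = DIM('e) + 1" by metis
    then have "aff_dim (q ` A) = int DIM('e)" using aff[of A] that by auto
    moreover have "aff_dim (q ` A) \<le> aff_dim (q ` \<sigma>)" using A by (intro aff_dim_subset) auto
    moreover have "aff_dim (q ` \<sigma>) \<le> int DIM('e)" by (rule aff_dim_le_DIM)
    ultimately show ?thesis by linarith
  qed
  have Qdim: "aff_dim Q = int DIM('e)" unfolding Q_def using full[of V] V by (simp add: aff_dim_convex_hull)
  have proper: "card \<sigma> \<le> DIM('e) \<and> \<not> affine_dependent (q ` \<sigma>) \<and> inj_on q \<sigma>"
    if "\<sigma> \<subseteq> V" "convex hull (q ` \<sigma>) face_of Q" "convex hull (q ` \<sigma>) \<noteq> Q" for \<sigma>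
  proof -
    have "aff_dim (convex hull (q ` \<sigma>)) < aff_dim Q"
      using that unfolding Q_def by (intro face_of_aff_dim_lt) auto
    then have "\<not> DIM('e) + 1 \<le> card \<sigma>" using full[OF that(1)] Qdim by (auto simp: aff_dim_convex_hull)
    then have "card \<sigma> \<le> DIM('e)" by auto
    then show ?thesis using gp that unfolding general_position_def by auto
  qed
  have faces: "\<exists>\<sigma>\<subseteq>V. F = convex hull (q ` \<sigma>)" if F: "F face_of Q" for F
  proof -
    have "compact (q ` V)" using V by (simp add: finite_imp_compact)
    from face_of_convex_hull_subset[OF this F[unfolded Q_def]]
    obtain s where "s \<subseteq> q ` V" "F = convex hull s" by blast
    then show ?thesis by (metis subset_imageE)
  qed
  \<comment> \<open>The boundary complex of \<open>Q\<close> with the elements of \<open>V\<close>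
    as labels in place of their images, so that \<open>S\<close> is literally a subcomplex.\<close>
  define T where "T = {\<sigma>. \<sigma> \<subseteq> V \<and> convex hull (q ` \<sigma>) face_of Q \<and> convex hull (q ` \<sigma>) \<noteq> Q}"
  have T_sub: "\<tau> \<in> T" if "\<sigma> \<in> T" "\<tau> \<subseteq> \<sigma>" for \<sigma> \<tau>
  proof -
    have \<sigma>: "\<sigma> \<subseteq> V" "convex hull (q ` \<sigma>) face_of Q" "convex hull (q ` \<sigma>) \<noteq> Q"
      using that unfolding T_def by auto
    have "convex hull (q ` \<tau>) face_of convex hull (q ` \<sigma>)"
      using face_of_convex_hull_affine_independent[of "q ` \<sigma>"] proper[OF \<sigma>] that by blast
    then have "convex hull (q ` \<tau>) face_of Q" using \<sigma> face_of_trans by blast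
    moreover have "convex hull (q ` \<tau>) \<noteq> Q"
      using \<sigma> that face_of_imp_subset[OF \<sigma>(2)] hull_mono[of "q ` \<tau>" "q ` \<sigma>" convex] by blast
    ultimately show ?thesis using \<sigma> that unfolding T_def by auto
  qed
  have extT: "{x. x extreme_point_of (convex hull (q ` \<sigma>))} = q ` \<sigma>" if "\<sigma> \<in> T" for \<sigma>
    using proper[of \<sigma>] that extreme_point_of_convex_hull_affine_independent[of "q ` \<sigma>"] unfolding T_def by auto
  have bc: "boundary_complex Q = (\<lambda>\<sigma>. q ` \<sigma>) ` T"
  proof
    show "boundary_complex Q \<subseteq> (\<lambda>\<sigma>. q ` \<sigma>) ` T"
    proof
      fix s assume "s \<in> boundary_complex Q"
      then obtain F where F: "F face_of Q" "F \<noteq> Q" "s = {v. v extreme_point_of F}"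
        unfolding boundary_complex_def by auto
      obtain \<sigma> where "\<sigma> \<subseteq> V" "F = convex hull (q ` \<sigma>)" using faces[OF F(1)] by auto
      then have "\<sigma> \<in> T" "s = q ` \<sigma>" using F extT[of \<sigma>] unfolding T_def by auto
      then show "s \<in> (\<lambda>\<sigma>. q ` \<sigma>) ` T" by auto
    qed
    show "(\<lambda>\<sigma>. q ` \<sigma>) ` T \<subseteq> boundary_complex Q"
    proof
      fix s assume "s \<in> (\<lambda>\<sigma>. q ` \<sigma>) ` T"
      then obtain \<sigma> where "\<sigma> \<in> T" "s = q ` \<sigma>" by auto
      then show "s \<in> boundary_complex Q"
        using extT[of \<sigma>] unfolding boundary_complex_def T_def by blast
    qed
  qed
  have ST: "S \<subseteq> T"
  proof
    fix \<sigma> assume "\<sigma> \<in> S"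
    from S(2)[OF this] obtain t where t: "t \<subset> V" "\<sigma> \<subseteq> t" "exposes q V t"
      by (elim exE conjE) (rule that)
    have qQ: "q v \<in> Q" if "v \<in> V" for v unfolding Q_def using that by (intro hull_inc) simp
    obtain n c where n: "\<forall>v\<in>t. n \<bullet> q v = c" "\<forall>u\<in>V - t. n \<bullet> q u < c"
      using t unfolding exposes_def by blast
    have le: "n \<bullet> q v \<le> c" if "v \<in> V" for v using n that by (cases "v \<in> t") (auto intro: less_imp_le)
    have Qle: "n \<bullet> x \<le> c" if "x \<in> Q" for x
    proof -
      have "Q \<subseteq> {x. n \<bullet> x \<le> c}"
        unfolding Q_def using le by (intro hull_minimal convex_halfspace_le) auto
      then show ?thesis using that by auto
    qed
    \<comment> \<open>The supporting hyperplane cuts out a face spanned by points of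
      \<open>V\<close>. Strictness off \<open>t\<close> leaves only points of \<open>t\<close>, so
      the face is the hull of the image of \<open>t\<close>.\<close>
    define F where "F = Q \<inter> {x. n \<bullet> x = c}"
    have F: "F face_of Q" unfolding F_def
      using Qle by (intro face_of_Int_supporting_hyperplane_le) (auto simp: Q_def)
    then obtain \<rho> where \<rho>: "\<rho> \<subseteq> V" "F = convex hull (q ` \<rho>)" using faces by blast
    have "\<rho> \<subseteq> t"
    proof
      fix v assume "v \<in> \<rho>"
      then have "q v \<in> F" "v \<in> V" using \<rho> hull_inc[of "q v" "q ` \<rho>"] by auto
      then show "v \<in> t" using n unfolding F_def by force
    qed
    then have "F \<subseteq> convex hull (q ` t)" unfolding \<rho>(2) by (intro hull_mono) auto
    moreover have "convex hull (q ` t) \<subseteq> F"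
    proof (rule hull_minimal)
      show "q ` t \<subseteq> F" using n t qQ unfolding F_def by auto
      show "convex F" using F face_of_imp_convex by (metis Q_def convex_convex_hull)
    qed
    ultimately have Ft: "F = convex hull (q ` t)" by blast
    \<comment> \<open>A point of \<open>V\<close> outside \<open>t\<close> shows that the face is
      proper.\<close>
    obtain u where u: "u \<in> V" "u \<notin> t" using t by auto
    then have "q u \<in> Q" "q u \<notin> F" using n qQ unfolding F_def by auto
    then have "t \<in> T" using t F Ft unfolding T_def by auto
    then show "\<sigma> \<in> T" using T_sub t by blast
  qed
  have UT: "\<Union>T = V" using ST S unfolding T_def by blast
  have "simplicial_polytope Q"
    unfolding simplicial_polytope_def
  proof (intro conjI allI impI)
    show "polytope Q" unfolding Q_def polytope_def using V by blast
    show "aff_dim Q = int DIM('e)" by (rule Qdim)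
    fix F assume "F face_of Q \<and> F \<noteq> Q"
    then obtain \<sigma> where \<sigma>: "\<sigma> \<subseteq> V" "F = convex hull (q ` \<sigma>)" "\<not> affine_dependent (q ` \<sigma>)"
      using faces proper by blast
    then show "\<exists>m. m simplex F" unfolding simplex_def
      by (intro exI[of _ "int (card (q ` \<sigma>)) - 1"] exI[of _ "q ` \<sigma>"]) auto
  qed
  moreover have "abstract_complex T"
    unfolding abstract_complex_def
  proof (intro conjI ballI allI impI)
    have "T \<subseteq> Pow V" unfolding T_def by blast
    then show "finite T" using V finite_subset by blast
    show "finite \<sigma>" if "\<sigma> \<in> T" for \<sigma> using that by (intro fin) (simp add: T_def)
    show "\<tau> \<in> T" if "\<sigma> \<in> T" "\<tau> \<subseteq> \<sigma>" for \<sigma> \<tau> using that by (rule T_sub)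
  qed
  moreover have "complex_iso T (boundary_complex Q)"
    unfolding complex_iso_def
  proof (intro exI[of _ q] conjI)
    show "(\<lambda>\<sigma>. q ` \<sigma>) ` T = boundary_complex Q" using bc by simp
    have "\<Union>(boundary_complex Q) = q ` V" unfolding bc UT[symmetric] by auto
    then show "bij_betw q (\<Union>T) (\<Union>(boundary_complex Q))" unfolding UT bij_betw_def using inj by auto
  qed
  ultimately have "polytopal_sphere TYPE('e) T" unfolding polytopal_sphere_def by blast
  then show ?thesis using ST UT by blast
qed

text \<open>Used both for points and for coefficient vectors of functionals. All lifted points lie
  in a hyperplane, and only the perturbation makes their hull four-dimensional.\<close>

definition lift4 :: "real \<Rightarrow> real \<Rightarrow> real \<Rightarrow> real ^ 4" where
  "lift4 a b c = (\<chi> i. if i = 1 then a else if i = 2 then b else if i = 3 then c else 0)"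

lemma inner_lift4: "lift4 a b c \<bullet> lift4 a' b' c' = a * a' + b * b' + c * c'"
  unfolding lift4_def by (simp add: inner_vec_def sum_4)

text \<open>The shadow in the first two coordinates is a nondegenerate triangle, so functionals that
  ignore \<open>z\<close> already separate its vertices.\<close>

lemma separates_triangle:
  fixes x y z :: "'a \<Rightarrow> real"
  assumes "(x b - x a) * (y c - y a) \<noteq> (x c - x a) * (y b - y a)"
  shows "separates (\<lambda>u. lift4 (x u) (y u) (z u)) {a, b, c}"
proof -
  \<comment> \<open>The functional is the normal of the line through \<open>b\<close> and
    \<open>c\<close> in the projection. At \<open>a\<close> it differs from its constant by twice
    the signed area of the projected triangle, up to sign.\<close>
  have *: "\<exists>n d. n \<bullet> lift4 (x a) (y a) (z a) \<noteq> d \<and> (\<forall>u\<in>{a, b, c} - {a}. n \<bullet> lift4 (x u) (y u) (z u) = d)"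
    if "(x b - x a) * (y c - y a) \<noteq> (x c - x a) * (y b - y a)" for a b c
    using that
    by (intro exI[of _ "lift4 (y b - y c) (x c - x b) 0"] exI[of _ "x c * y b - x b * y c"])
       (auto simp: inner_lift4 algebra_simps)
  have "{b, c, a} = {a, b, c}" "{c, a, b} = {a, b, c}" by auto
  then show ?thesis
    using *[of b a c] *[of c b a] *[of a c b] assms unfolding separates_def
    by (auto simp: algebra_simps)
qed

theorem corollary3:
  fixes S :: "'a set set" and n :: nat
  assumes "combinatorial_sphere 2 S"
    and "card (\<Union>S) = n"
    and "n \<ge> 5"
  shows "\<exists>T :: 'a set set. polytopal_sphere TYPE(real^4) T \<and> card (\<Union>T) = n \<and>
           S \<subseteq> T \<and> \<Union>S = \<Union>T"
proof -
  interpret planar_surface S using assms(1) by (rule combinatorial_sphere_planar_surface)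
  define V where "V = \<Union>S"
  have V: "finite V" "5 \<le> card V"
    using finite_complex face_finite assms unfolding V_def by auto
  obtain a b c where abc: "a \<noteq> b" "a \<noteq> c" "b \<noteq> c" "{a, b, c} \<in> tri S"
    and disc: "fan_disc a b (tri S - {{a, b, c}}) [a, c, b]"
    by (rule fan_disc_complement)
  have out: "{a, b, c} \<notin> tri S - {{a, b, c}}" by simp
  have triS: "insert {a, b, c} (tri S - {{a, b, c}}) = tri S" using abc by blast
  have UV: "\<Union>(tri S - {{a, b, c}}) \<union> {a, b, c} = V"
  proof
    show "\<Union>(tri S - {{a, b, c}}) \<union> {a, b, c} \<subseteq> V" using abc unfolding V_def tri_def by blast
    show "V \<subseteq> \<Union>(tri S - {{a, b, c}}) \<union> {a, b, c}" using face_in_triangle unfolding V_def by blast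
  qed
  obtain x y z :: "'a \<Rightarrow> real" where
    planes: "\<forall>t\<in>tri S. \<exists>\<alpha> \<beta> \<gamma> \<delta>. (\<forall>u\<in>t. \<alpha> * x u + \<beta> * y u + \<gamma> * z u = \<delta>) \<and>
        (\<forall>u\<in>V - t. \<alpha> * x u + \<beta> * y u + \<gamma> * z u < \<delta>)"
    and nondeg: "\<forall>t\<in>tri S. \<exists>a b c. t = {a, b, c} \<and> (x b - x a) * (y c - y a) \<noteq> (x c - x a) * (y b - y a)"
    by (rule fan_disc_supporting_planes[OF disc out abc(2,3), unfolded triS UV])
  define q where "q u = lift4 (x u) (y u) (z u)" for u
  have q: "exposes q V t \<and> separates q t" if t: "t \<in> tri S" for t
  proof
    from bspec[OF planes t] obtain \<alpha> \<beta> \<gamma> \<delta> where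
      "\<forall>u\<in>t. \<alpha> * x u + \<beta> * y u + \<gamma> * z u = \<delta>"
      "\<forall>u\<in>V - t. \<alpha> * x u + \<beta> * y u + \<gamma> * z u < \<delta>"
      by (elim exE conjE) (rule that)
    then show "exposes q V t"
      unfolding exposes_def q_def by (intro exI[of _ "lift4 \<alpha> \<beta> \<gamma>"] exI[of _ \<delta>]) (simp add: inner_lift4)
    from bspec[OF nondeg t] obtain d e f where "t = {d, e, f}"
      "(x e - x d) * (y f - y d) \<noteq> (x f - x d) * (y e - y d)"
      by (elim exE conjE) (rule that)
    then show "separates q t" unfolding q_def by (simp add: separates_triangle)
  qed
  have "\<exists>q' :: 'a \<Rightarrow> real ^ 4. (\<forall>t\<in>tri S. exposes q' V t \<and> separates q' t) \<and> general_position q' V"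
  proof (rule perturb_to_general_position)
    show "finite V" "finite V" by (rule V(1))+
    show "finite (tri S)" using finite_complex unfolding tri_def by simp
    show "exposes q V t \<and> separates q t" if "t \<in> tri S" for t using that by (rule q)
  qed
  then obtain q' :: "'a \<Rightarrow> real ^ 4" where q': "\<forall>t\<in>tri S. exposes q' V t \<and> separates q' t"
    and gp: "general_position q' V"
    by (elim exE conjE) (rule that)
  have small: "t \<subset> V" if "t \<in> tri S" for t
  proof -
    have "t \<subseteq> V" "card t = 3" using that unfolding V_def tri_def by auto
    then show ?thesis using V by auto
  qed
  have "\<exists>T :: 'a set set. polytopal_sphere TYPE(real^4) T \<and> S \<subseteq> T \<and> \<Union>T = V"
  proof (rule general_position_polytope[OF V(1) _ gp])
    \<comment> \<open>Here \<open>n \<ge> 5\<close> gives the hull its full dimension.\<close>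
    show "DIM(real ^ 4) + 1 \<le> card V" using V by simp
    show "\<Union>S = V" unfolding V_def ..
    show "\<exists>t\<subset>V. \<sigma> \<subseteq> t \<and> exposes q' V t" if "\<sigma> \<in> S" for \<sigma>
      using face_in_triangle[OF that] q' small by blast
  qed
  then obtain T :: "'a set set" where "polytopal_sphere TYPE(real^4) T" "S \<subseteq> T" "\<Union>T = V" by blast
  then show ?thesis using assms(2) unfolding V_def by (intro exI[of _ T]) simp
qed

end
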